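(* Let $0<p<1$ and $\alpha\in\mathbb{R}$. Then for all $u\in b^p_\alpha$ and $x\in\mathbb{B}$, $$|u(x)|\lesssim\|u\|_{b^p_\alpha}\begin{cases}1,&\text{if }\alpha\le-n;\\[1mm]\dfrac1{(1-|x|^2)^{(n+\alpha)/p}},&\text{if }\alpha>-n.\end{cases}$$
   Context: $\mathbb{B}$ is the open unit ball of $\mathbb{R}^n$, $n\ge2$; $d\nu$ is Lebesgue measure on $\mathbb{B}$ normalized by $\nu(\mathbb{B})=1$. For $\alpha\in\mathbb{R}$, $d\nu_\alpha(x)=\frac1{V_\alpha}(1-|x|^2)^\alpha d\nu(x)$, where $V_\alpha$ is chosen so that $\nu_\alpha(\mathbb{B})=1$ if $\alpha>-1$ and $V_\alpha=1$ if $\alpha\le-1$. $L^p_\alpha=L^p(d\nu_\alpha)$, with $\|f\|_{L^p_\alpha}=(\int_{\mathbb{B}}|f|^pd\nu_\alpha)^{1/p}$. $h(\mathbb{B})$ is the space of complex-valued harmonic functions on $\mathbb{B}$; each $u\in h(\mathbb{B})$ has a homogeneous expansion $u=\sum_{k\ge0}u_k$ with $u_k$ a homogeneous harmonic polynomial of degree $k$. With $(a)_b=\Gamma(a+b)/\Gamma(a)$, define for $\alpha\in\mathbb{R}$ $$\gamma_k(\alpha)=\begin{cases}\dfrac{(1+n/2+\alpha)_k}{(n/2)_k},&\alpha>-(1+n/2),\\[2mm]\dfrac{((1)_k)^2}{(1-(n/2+\alpha))_k(n/2)_k},&\alpha\le-(1+n/2).\end{cases}$$ For $s,t\in\mathbb{R}$,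 $D^t_su=\sum_k\frac{\gamma_k(s+t)}{\gamma_k(s)}u_k$ and $I^t_su(x)=(1-|x|^2)^tD^t_su(x)$. Harmonic Besov space $b^p_\alpha$ ($0<p<1$, $\alpha\in\mathbb{R}$): all $u\in h(\mathbb{B})$ such that $I^t_su\in L^p_\alpha$ for some (equivalently, every) $s,t\in\mathbb{R}$ with $\alpha+pt>-1$. All the quasinorms $\|I^t_su\|_{L^p_\alpha}$ with $\alpha+pt>-1$ are equivalent on $b^p_\alpha$, and $\|\cdot\|_{b^p_\alpha}$ denotes any one of them. $X\lesssim Y$ means $X\le CY$ with a constant $C>0$ independent of $u$ and $x$. *)

theory Defs
  imports "HOL-Analysis.Analysis"
begin

definition harmonic_on :: "'a::euclidean_space set \<Rightarrow> ('a \<Rightarrow> complex) \<Rightarrow> bool" where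
  "harmonic_on S u \<longleftrightarrow>
     (\<exists>(u' :: 'a \<Rightarrow> 'a \<Rightarrow>\<^sub>L complex) (u'' :: 'a \<Rightarrow> 'a \<Rightarrow>\<^sub>L 'a \<Rightarrow>\<^sub>L complex).
        (\<forall>x\<in>S. (u has_derivative blinfun_apply (u' x)) (at x)) \<and>
        (\<forall>x\<in>S. (u' has_derivative blinfun_apply (u'' x)) (at x)) \<and>
        continuous_on S u'' \<and>
        (\<forall>x\<in>S. (\<Sum>b\<in>Basis. blinfun_apply (blinfun_apply (u'' x) b) b) = 0))"

definition homogeneous_harmonic_polynomial :: "nat \<Rightarrow> ('a::euclidean_space \<Rightarrow> complex) \<Rightarrow> bool" where
  "homogeneous_harmonic_polynomial k q \<longleftrightarrow>
     polynomial_function q \<and> harmonic_on UNIV q \<and>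
     (\<forall>c x. q (c *\<^sub>R x) = c ^ k *\<^sub>R q x)"

definition homogeneous_expansion ::
    "('a::euclidean_space \<Rightarrow> complex) \<Rightarrow> (nat \<Rightarrow> 'a \<Rightarrow> complex) \<Rightarrow> bool" where
  "homogeneous_expansion u U \<longleftrightarrow>
     (\<forall>k. homogeneous_harmonic_polynomial k (U k)) \<and>
     (\<forall>x\<in>ball 0 1. (\<lambda>k. U k x) sums u x)"

(* The expansion is unique: for fixed x, the numbers U k x are the coefficients of
   the power series of r \<mapsto> u (r x) near r = 0. *)
definition homogeneous_part :: "('a::euclidean_space \<Rightarrow> complex) \<Rightarrow> nat \<Rightarrow> 'a \<Rightarrow> complex" where
  "homogeneous_part u = (THE U. homogeneous_expansion u U)"

(* n is the dimension.  The first argument of every Pochhammer symbol is positive, so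
   pochhammer a k = Gamma (a + k) / Gamma a. *)
definition besov_coeff :: "nat \<Rightarrow> nat \<Rightarrow> real \<Rightarrow> real" where
  "besov_coeff n k \<alpha> =
     (if \<alpha> > - (1 + real n / 2)
      then pochhammer (1 + real n / 2 + \<alpha>) k / pochhammer (real n / 2) k
      else (pochhammer 1 k)\<^sup>2 /
           (pochhammer (1 - (real n / 2 + \<alpha>)) k * pochhammer (real n / 2) k))"

definition D_op ::
    "real \<Rightarrow> real \<Rightarrow> ('a::euclidean_space \<Rightarrow> complex) \<Rightarrow> 'a \<Rightarrow> complex" where
  "D_op s t u x =
     (\<Sum>k. of_real (besov_coeff DIM('a) k (s + t) / besov_coeff DIM('a) k s) *
            homogeneous_part u k x)"

definition I_op ::
    "real \<Rightarrow> real \<Rightarrow> ('a::euclidean_space \<Rightarrow> complex) \<Rightarrow> 'a \<Rightarrow> complex" where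
  "I_op s t u x = of_real ((1 - (norm x)\<^sup>2) powr t) * D_op s t u x"

definition ball_measure :: "'a::euclidean_space measure" where
  "ball_measure = uniform_measure (lebesgue_on (ball 0 1)) (ball 0 1)"

definition weight_const :: "'a::euclidean_space itself \<Rightarrow> real \<Rightarrow> real" where
  "weight_const _ \<alpha> =
     (if \<alpha> > -1 then LINT x|(ball_measure :: 'a measure). (1 - (norm x)\<^sup>2) powr \<alpha> else 1)"

definition weighted_ball_measure :: "real \<Rightarrow> 'a::euclidean_space measure" where
  "weighted_ball_measure \<alpha> =
     density ball_measure
       (\<lambda>x. ennreal (1 / weight_const TYPE('a) \<alpha> * (1 - (norm x)\<^sup>2) powr \<alpha>))"

(* Extended-valued; the case distinction is only there because powr is not available on ennreal. *)
definition Lp_quasinorm :: "real \<Rightarrow> 'a measure \<Rightarrow> ('a \<Rightarrow> complex) \<Rightarrow> ennreal" where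
  "Lp_quasinorm p M f =
     (let J = \<integral>\<^sup>+ x. ennreal (norm (f x) powr p) \<partial>M
      in if J = \<infinity> then \<infinity> else ennreal (enn2real J powr (1 / p)))"

definition Lp_functions :: "real \<Rightarrow> 'a measure \<Rightarrow> ('a \<Rightarrow> complex) set" where
  "Lp_functions p M = {f \<in> borel_measurable M. Lp_quasinorm p M f < \<infinity>}"

definition harmonic_besov :: "real \<Rightarrow> real \<Rightarrow> ('a::euclidean_space \<Rightarrow> complex) set" where
  "harmonic_besov p \<alpha> =
     {u. harmonic_on (ball 0 1) u \<and>
         (\<exists>s t. \<alpha> + p * t > -1 \<and> I_op s t u \<in> Lp_functions p (weighted_ball_measure \<alpha>))}"

(* One of the equivalent quasinorms on the Besov space; which one depends on s and t,
   to be taken with \<alpha> + p * t > -1. *)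
definition besov_quasinorm ::
    "real \<Rightarrow> real \<Rightarrow> real \<Rightarrow> real \<Rightarrow> ('a::euclidean_space \<Rightarrow> complex) \<Rightarrow> ennreal" where
  "besov_quasinorm p \<alpha> s t u = Lp_quasinorm p (weighted_ball_measure \<alpha>) (I_op s t u)"

end

theory Submission
  imports Defs "HOL-Complex_Analysis.Complex_Analysis"
begin

text \<open>
  Write \<open>n\<close> for the dimension and \<open>v = D\<^sub>s\<^sup>t u\<close>. The coefficients of \<open>D\<^sub>s\<^sup>t\<close> are products of two ratios
  \<open>(b)\<^sub>k / (a)\<^sub>k\<close> with positive parameters, and the differences \<open>b - a\<close> add up to \<open>t\<close>. So \<open>u\<close> is recovered from
  \<open>v\<close> by the multipliers \<open>(a)\<^sub>k / (b)\<^sub>k\<close>, and the theorem is an estimate for these multipliers.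

  For large \<open>m\<close> such a ratio factors as \<open>(b + m)\<^sub>k / (b)\<^sub>k\<close> times \<open>(a)\<^sub>k / (b + m)\<^sub>k\<close>. The first factor is a
  polynomial in \<open>k\<close> of degree \<open>m\<close>, that is, a differential operator of order \<open>m\<close> in the radial direction;
  the mean value property bounds it locally, at the price of one power of the distance to the
  boundary for each order (\<open>locally_controlled_raise\<close>). The second factor is the \<open>k\<close>-th moment of a
  Beta distribution on \<open>[0, 1]\<close>, so it averages a function over the segment from the origin to the
  point (\<open>dyadic_majorant_moment\<close>). This distribution gives mass of order \<open>h\<close> to the power \<open>b + m - a\<close> to
  the interval \<open>[1 - h, 1]\<close>, which returns the powers that were lost, together with the factor that
  corresponds to \<open>t\<close>.

  The starting point is the inequality \<open>|v(x)|\<^sup>p \<le> C \<delta>\<^sup>-\<^sup>n \<integral> |v|\<^sup>p\<close> over the ball of radius \<open>\<delta>\<close> about \<open>x\<close>, which a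
  maximum argument derives from the case of exponent 1 (\<open>norm_powr_sub_mean_value\<close>). In the shell where
  \<open>1 - |y|\<close> is about \<open>h = 2\<^sup>-\<^sup>j\<close> it bounds \<open>v\<close> in terms of the part \<open>G\<^sub>j\<close> of the quasinorm integral that comes from this
  shell. After the multipliers, \<open>|u(x)|\<close> is at most a constant times the sum of
  \<open>h\<close> to the power \<open>-(n + \<alpha>)/p\<close> times \<open>G\<^sub>j\<close> to the power \<open>1/p\<close>, over the shells that meet the segment from
  the origin to \<open>x\<close>. The shells overlap boundedly and \<open>1/p \<ge> 1\<close>, so the numbers \<open>G\<^sub>j\<close> to the power
  \<open>1/p\<close> add up to at most a multiple of the quasinorm; this avoids the logarithm that a bound of each \<open>G\<^sub>j\<close> by the
  full integral would produce at \<open>\<alpha> = -n\<close>. The remaining factor is bounded if \<open>\<alpha> \<le> -n\<close>, and at most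
  \<open>1 - |x|\<close> to the power \<open>-(n + \<alpha>)/p\<close> otherwise.

  All this needs that a harmonic function in the ball has an expansion into homogeneous harmonic
  polynomials which converges in the whole ball, with a geometric bound. Green's identity for a
  cut-off of \<open>u\<close> represents \<open>u\<close> in a ball of radius \<open>R < 1\<close> as the Newtonian potential of a function on an
  annulus around this ball. Along each ray the Newtonian kernel extends holomorphically to a disc of
  radius \<open>R\<close>, and its Taylor coefficients are polynomials (\<open>newton_coeff_bound\<close>,
  \<open>local_homogeneous_expansion\<close>). If the kernel is truncated near its pole, the same identity yields the
  mean value property (\<open>newton_representation_and_mean_value\<close>).
\<close>


section \<open>Green's identity for compactly supported functions\<close>

text \<open>Green's identity only involves first and second derivatives along the coordinate axes. Recording
  smoothness through these reduces all differentiation to functions of one real variable.\<close>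
definition pure_C2_on :: "'a::euclidean_space set \<Rightarrow> ('a \<Rightarrow> 'b::real_normed_vector) \<Rightarrow>
    ('a \<Rightarrow> 'a \<Rightarrow> 'b) \<Rightarrow> ('a \<Rightarrow> 'a \<Rightarrow> 'b) \<Rightarrow> bool" where
  "pure_C2_on S f f1 f2 \<longleftrightarrow> continuous_on S f \<and>
     (\<forall>b\<in>Basis. continuous_on S (f1 b) \<and> continuous_on S (f2 b) \<and>
       (\<forall>x\<in>S. ((\<lambda>\<tau>. f (x + \<tau> *\<^sub>R b)) has_vector_derivative f1 b x) (at 0) \<and>
              ((\<lambda>\<tau>. f1 b (x + \<tau> *\<^sub>R b)) has_vector_derivative f2 b x) (at 0)))"

lemma pure_C2_onD:
  assumes "pure_C2_on S f f1 f2"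
  shows "continuous_on S f"
    and "b \<in> Basis \<Longrightarrow> continuous_on S (f1 b)"
    and "b \<in> Basis \<Longrightarrow> continuous_on S (f2 b)"
    and "b \<in> Basis \<Longrightarrow> x \<in> S \<Longrightarrow> ((\<lambda>\<tau>. f (x + \<tau> *\<^sub>R b)) has_vector_derivative f1 b x) (at 0)"
    and "b \<in> Basis \<Longrightarrow> x \<in> S \<Longrightarrow> ((\<lambda>\<tau>. f1 b (x + \<tau> *\<^sub>R b)) has_vector_derivative f2 b x) (at 0)"
  using assms unfolding pure_C2_on_def by blast+

lemma has_derivative_imp_line_derivative:
  assumes "(f has_derivative f') (at x)"
  shows "((\<lambda>\<tau>. f (x + \<tau> *\<^sub>R b)) has_vector_derivative f' b) (at 0)"
proof -
  have "((\<lambda>\<tau>. x + \<tau> *\<^sub>R b) has_derivative (\<lambda>\<tau>. \<tau> *\<^sub>R b)) (at (0::real))"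
    by (auto intro!: derivative_eq_intros)
  moreover have "(f has_derivative f') (at (x + 0 *\<^sub>R b))" using assms by simp
  ultimately have "((\<lambda>\<tau>. f (x + \<tau> *\<^sub>R b)) has_derivative (\<lambda>\<tau>. f' (\<tau> *\<^sub>R b))) (at 0)"
    by (rule has_derivative_compose[where f="\<lambda>\<tau>. x + \<tau> *\<^sub>R b" and g=f])
  moreover have "f' (\<tau> *\<^sub>R b) = \<tau> *\<^sub>R f' b" for \<tau>
    using assms by (meson has_derivative_linear linear_cmul)
  ultimately show ?thesis unfolding has_vector_derivative_def by simp
qed

lemma harmonic_on_imp_pure_C2_on:
  assumes "harmonic_on S u"
  obtains u1 u2 where "pure_C2_on S u u1 u2" "\<And>x. x \<in> S \<Longrightarrow> (\<Sum>b\<in>Basis. u2 b x) = 0"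
proof -
  obtain u' :: "'a \<Rightarrow> 'a \<Rightarrow>\<^sub>L complex" and u'' :: "'a \<Rightarrow> 'a \<Rightarrow>\<^sub>L 'a \<Rightarrow>\<^sub>L complex" where
    1: "\<And>x. x \<in> S \<Longrightarrow> (u has_derivative blinfun_apply (u' x)) (at x)" and
    2: "\<And>x. x \<in> S \<Longrightarrow> (u' has_derivative blinfun_apply (u'' x)) (at x)" and
    3: "continuous_on S u''" and
    4: "\<And>x. x \<in> S \<Longrightarrow> (\<Sum>b\<in>Basis. blinfun_apply (blinfun_apply (u'' x) b) b) = 0"
    using assms unfolding harmonic_on_def by blast
  have c1: "continuous_on S u" "continuous_on S u'"
    by (rule has_derivative_continuous_on[OF has_derivative_at_withinI], erule 1,
        rule has_derivative_continuous_on[OF has_derivative_at_withinI], erule 2)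
  have 5: "((\<lambda>x. blinfun_apply (u' x) b) has_derivative (\<lambda>h. blinfun_apply (u'' x h) b)) (at x)" 
    if "x \<in> S" for b x
    by (rule bounded_linear.has_derivative[OF blinfun.bounded_linear_left 2[OF that]])
  have "pure_C2_on S u (\<lambda>b x. blinfun_apply (u' x) b) (\<lambda>b x. blinfun_apply (blinfun_apply (u'' x) b) b)"
    unfolding pure_C2_on_def
    using has_derivative_imp_line_derivative[OF 1] has_derivative_imp_line_derivative[OF 5]
    by (intro conjI ballI c1 bounded_linear.continuous_on[OF blinfun.bounded_linear_left] 3) auto
  then show ?thesis using 4 that by blast
qed

lemma pure_C2_on_radial:
  fixes g g' g'' :: "real \<Rightarrow> real" and x :: "'a::euclidean_space"
  assumes "\<And>s. (g has_real_derivative g' s) (at s)" "\<And>s. (g' has_real_derivative g'' s) (at s)"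
    "continuous_on UNIV g''"
  shows "pure_C2_on S (\<lambda>y. g ((norm (y - x))\<^sup>2)) (\<lambda>b y. 2 * ((y - x) \<bullet> b) * g' ((norm (y - x))\<^sup>2))
     (\<lambda>b y. 4 * ((y - x) \<bullet> b)\<^sup>2 * g'' ((norm (y - x))\<^sup>2) + 2 * g' ((norm (y - x))\<^sup>2))"
proof -
  have cg: "continuous_on UNIV g" "continuous_on UNIV g'"
    using DERIV_continuous_on assms(1,2) has_field_derivative_at_within by blast+
  have cN: "continuous_on S (\<lambda>y. (norm (y - x))\<^sup>2)" by (intro continuous_intros)
  have c: "continuous_on S (\<lambda>y. h ((norm (y - x))\<^sup>2))" if "continuous_on UNIV h" for h :: "real \<Rightarrow> real"
    using continuous_on_compose2[OF that cN] by simp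
  have d: "((\<lambda>\<tau>. (norm (y + \<tau> *\<^sub>R b - x))\<^sup>2) has_real_derivative 2 * ((y - x) \<bullet> b)) (at 0)" 
    if "b \<in> Basis" for b y
  proof -
    have eq: "(\<lambda>\<tau>. (norm (y + \<tau> *\<^sub>R b - x))\<^sup>2) = (\<lambda>\<tau>. (y - x) \<bullet> (y - x) + 2 * \<tau> * ((y - x) \<bullet> b) + \<tau>\<^sup>2)"
      unfolding power2_norm_eq_inner
      using that by (auto simp: fun_eq_iff algebra_simps inner_commute power2_eq_square)
    show ?thesis unfolding eq by (auto intro!: derivative_eq_intros)
  qed
  have dl: "((\<lambda>\<tau>. 2 * ((y + \<tau> *\<^sub>R b - x) \<bullet> b)) has_real_derivative 2) (at 0)" if "b \<in> Basis" for b y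
    using that by (auto intro!: derivative_eq_intros simp: inner_add_left inner_diff_left)
  have dg: "((\<lambda>\<tau>. h ((norm (y + \<tau> *\<^sub>R b - x))\<^sup>2)) has_real_derivative 
     h' ((norm (y - x))\<^sup>2) * (2 * ((y - x) \<bullet> b))) (at 0)" 
    if "b \<in> Basis" "\<And>s. (h has_real_derivative h' s) (at s)" for b y h h'
    using DERIV_chain2[where f=h and g="\<lambda>\<tau>. (norm (y + \<tau> *\<^sub>R b - x))\<^sup>2", OF that(2) d[OF that(1)]] by simp
  have 1: "((\<lambda>\<tau>. g ((norm (y + \<tau> *\<^sub>R b - x))\<^sup>2)) has_real_derivative 
     2 * ((y - x) \<bullet> b) * g' ((norm (y - x))\<^sup>2)) (at 0)" if "b \<in> Basis" for b y
    using dg[OF that assms(1), of y] by (simp add: mult_ac)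
  have 2: "((\<lambda>\<tau>. 2 * ((y + \<tau> *\<^sub>R b - x) \<bullet> b) * g' ((norm (y + \<tau> *\<^sub>R b - x))\<^sup>2)) has_real_derivative 
     4 * ((y - x) \<bullet> b)\<^sup>2 * g'' ((norm (y - x))\<^sup>2) + 2 * g' ((norm (y - x))\<^sup>2)) (at 0)" if "b \<in> Basis" for b y
    by (rule DERIV_cong[OF DERIV_mult[OF dl[OF that] dg[OF that assms(2)]]]) (simp add: power2_eq_square)
  show ?thesis unfolding pure_C2_on_def
    using 1 2 by (intro conjI ballI continuous_intros c cg assms)
      (simp_all add: has_real_derivative_iff_has_vector_derivative)
qed

lemma radial_laplacian:
  fixes x y :: "'a::euclidean_space"
  shows "(\<Sum>b\<in>Basis. 4 * ((y - x) \<bullet> b)\<^sup>2 * A + 2 * B) = 4 * (norm (y - x))\<^sup>2 * A + 2 * real DIM('a) * B"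
proof -
  have "(norm (y - x))\<^sup>2 = (\<Sum>b\<in>Basis. ((y - x) \<bullet> b)\<^sup>2)"
    unfolding power2_norm_eq_inner by (subst euclidean_inner) (simp add: power2_eq_square)
  then show ?thesis by (simp add: sum.distrib sum_distrib_left sum_distrib_right mult_ac)
qed

lemma pure_C2_on_scaleR:
  fixes f :: "'a::euclidean_space \<Rightarrow> real" and g :: "'a \<Rightarrow> 'b::real_normed_vector"
  assumes f: "pure_C2_on S f f1 f2" and g: "pure_C2_on S g g1 g2"
  shows "pure_C2_on S (\<lambda>x. f x *\<^sub>R g x) (\<lambda>b x. f1 b x *\<^sub>R g x + f x *\<^sub>R g1 b x)
     (\<lambda>b x. f2 b x *\<^sub>R g x + 2 *\<^sub>R f1 b x *\<^sub>R g1 b x + f x *\<^sub>R g2 b x)"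
proof -
  have 1: "((\<lambda>\<tau>. f (x + \<tau> *\<^sub>R b) *\<^sub>R g (x + \<tau> *\<^sub>R b)) has_vector_derivative
      f1 b x *\<^sub>R g x + f x *\<^sub>R g1 b x) (at 0)" if "b \<in> Basis" "x \<in> S" for b x
    using has_vector_derivative_scaleR[OF pure_C2_onD(4)[OF f that, folded has_real_derivative_iff_has_vector_derivative]
       pure_C2_onD(4)[OF g that]]
    by (simp add: add.commute)
  have 2: "((\<lambda>\<tau>. f1 b (x + \<tau> *\<^sub>R b) *\<^sub>R g (x + \<tau> *\<^sub>R b) + f (x + \<tau> *\<^sub>R b) *\<^sub>R g1 b (x + \<tau> *\<^sub>R b)) 
      has_vector_derivative
      f2 b x *\<^sub>R g x + 2 *\<^sub>R f1 b x *\<^sub>R g1 b x + f x *\<^sub>R g2 b x) (at 0)" if "b \<in> Basis" "x \<in> S" for b x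
    using has_vector_derivative_add[OF 
      has_vector_derivative_scaleR[OF pure_C2_onD(5)[OF f that, folded has_real_derivative_iff_has_vector_derivative]
       pure_C2_onD(4)[OF g that]]
      has_vector_derivative_scaleR[OF pure_C2_onD(4)[OF f that, folded has_real_derivative_iff_has_vector_derivative]
       pure_C2_onD(5)[OF g that]]]
    by (simp add: algebra_simps flip: scaleR_add_left scaleR_2)
  show ?thesis unfolding pure_C2_on_def
    using 1 2 f g by (intro conjI ballI continuous_intros; simp add: pure_C2_onD)
qed

lemma continuous_on_UNIV_extend_zero:
  fixes f :: "'a::topological_space \<Rightarrow> 'b::{topological_space, zero}"
  assumes "continuous_on S f" "open S" "closed K" "K \<subseteq> S" "\<And>x. x \<notin> K \<Longrightarrow> f x = 0"
  shows "continuous_on UNIV f"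
proof -
  have "continuous_on (- K) f"
    by (rule continuous_on_cong[THEN iffD1, OF _ _ continuous_on_const[of _ 0]]) (use assms in auto)
  then have "continuous_on (S \<union> - K) f"
    using assms by (intro continuous_on_open_Un) auto
  moreover have "S \<union> - K = UNIV" using assms by auto
  ultimately show ?thesis by simp
qed

text \<open>Applied to a product with a cutoff: outside the support of the cutoff the other factor, which is
  arbitrary outside the ball, is multiplied by zero.\<close>
lemma pure_C2_on_UNIV_extend_zero:
  assumes C2: "pure_C2_on S f f1 f2" and "open S" "closed K" "K \<subseteq> S" 
    "\<And>x. x \<notin> K \<Longrightarrow> f x = 0" "\<And>b x. x \<notin> K \<Longrightarrow> f1 b x = 0" "\<And>b x. x \<notin> K \<Longrightarrow> f2 b x = 0"
  shows "pure_C2_on UNIV f f1 f2"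
proof -
  have ev: "eventually (\<lambda>\<tau>. x + \<tau> *\<^sub>R b \<notin> K) (at 0)" if "x \<notin> K" for x b
  proof -
    have "((\<lambda>\<tau>. x + \<tau> *\<^sub>R b) \<longlongrightarrow> x + 0 *\<^sub>R b) (at (0::real))" by (intro tendsto_intros)
    then show ?thesis
      using topological_tendstoD[of _ "x + 0 *\<^sub>R b" "at 0" "- K"] assms that by auto
  qed
  have 0: "((\<lambda>\<tau>. h (x + \<tau> *\<^sub>R b)) has_vector_derivative 0) (at 0)" if "x \<notin> K" "\<And>x. x \<notin> K \<Longrightarrow> h x = 0" 
    for x b and h :: "'a \<Rightarrow> 'b"
  proof -
    have "((\<lambda>\<tau>. 0::'b) has_vector_derivative 0) (at 0 within UNIV)" by simp
    then show ?thesis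
    proof (rule has_vector_derivative_transform_within_open[where S="{\<tau>. x + \<tau> *\<^sub>R b \<in> - K}"])
      show "open {\<tau>. x + \<tau> *\<^sub>R b \<in> - K}"
        unfolding vimage_def[symmetric]
        by (intro open_vimage open_Compl assms continuous_intros)
    qed (use that in auto)
  qed
  show ?thesis unfolding pure_C2_on_def
  proof (intro conjI ballI)
    show "continuous_on UNIV f" by (rule continuous_on_UNIV_extend_zero) (use assms pure_C2_onD in blast)+
    fix b :: 'a assume b: "b \<in> Basis"
    show "continuous_on UNIV (f1 b)"
      by (rule continuous_on_UNIV_extend_zero[OF pure_C2_onD(2)[OF C2 b]]) (use assms in blast)+
    show "continuous_on UNIV (f2 b)"
      by (rule continuous_on_UNIV_extend_zero[OF pure_C2_onD(3)[OF C2 b]]) (use assms in blast)+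
    fix x
    show "((\<lambda>\<tau>. f (x + \<tau> *\<^sub>R b)) has_vector_derivative f1 b x) (at 0)"
    proof (cases "x \<in> K")
      case True then show ?thesis using pure_C2_onD(4)[OF C2 b] assms by blast
    next
      case False then show ?thesis using 0[OF False, of f b] assms by simp
    qed
    show "((\<lambda>\<tau>. f1 b (x + \<tau> *\<^sub>R b)) has_vector_derivative f2 b x) (at 0)"
    proof (cases "x \<in> K")
      case True then show ?thesis using pure_C2_onD(5)[OF C2 b] assms by blast
    next
      case False then show ?thesis using 0[OF False, of "f1 b" b] assms by simp
    qed
  qed
qed

lemma norm_le_norm_add_dist: "norm y \<le> norm x + dist x (y :: 'a::real_normed_vector)"
  using norm_triangle_ineq2[of y x] by (simp add: dist_norm norm_minus_commute)

lemma integrable_compact_support: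
  fixes f :: "'a::euclidean_space \<Rightarrow> 'b::euclidean_space"
  assumes "continuous_on UNIV f" "compact K" "\<And>x. x \<notin> K \<Longrightarrow> f x = 0"
  shows "integrable lborel f"
proof -
  have "integrable lborel (\<lambda>x. indicator K x *\<^sub>R f x)"
    by (intro borel_integrable_compact assms(2) continuous_on_subset[OF assms(1)]) auto
  moreover have "(\<lambda>x. indicator K x *\<^sub>R f x) = f" using assms by (auto simp: indicator_def)
  ultimately show ?thesis by simp
qed

text \<open>The form of term-by-term integration that suits power series in the radius.\<close>
lemma sums_integral_geometric:
  fixes f :: "nat \<Rightarrow> 'a \<Rightarrow> 'b::{banach, second_countable_topology}"
  assumes f: "\<And>k. integrable M (f k)" and g: "integrable M g"
    and bound: "\<And>k y. norm (f k y) \<le> g y * r ^ k" and r: "0 \<le> r" "r < 1"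
  shows "(\<lambda>k. LINT y|M. f k y) sums (LINT y|M. (\<Sum>k. f k y))"
proof (rule sums_integral[OF f])
  have geo: "summable (\<lambda>k. c * r ^ k)" for c using r by (intro summable_mult summable_geometric) auto
  show "AE y in M. summable (\<lambda>k. norm (f k y))"
    by (intro AE_I2 summable_comparison_test'[OF geo]) (use bound in auto)
  have "(LINT y|M. norm (f k y)) \<le> (LINT y|M. g y) * r ^ k" for k
  proof -
    have "(LINT y|M. norm (f k y)) \<le> (LINT y|M. g y * r ^ k)"
      by (intro integral_mono bound integrable_norm f) (use g in auto)
    then show ?thesis by simp
  qed
  then show "summable (\<lambda>k. LINT y|M. norm (f k y))"
    by (intro summable_comparison_test'[OF geo]) auto
qed

lemma integral_translate:
  fixes f :: "'a::euclidean_space \<Rightarrow> 'b::{banach, second_countable_topology}"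
  assumes "f \<in> borel_measurable borel"
  shows "(LINT x|lborel. f (c + x)) = (LINT x|lborel. f x)"
proof -
  have "(LINT x|lborel. f x) = (LINT x|distr lborel borel ((+) c). f x)"
    by (simp add: lborel_distr_plus)
  also have "\<dots> = (LINT x|lborel. f (c + x))"
    by (rule integral_distr) (use assms in auto)
  finally show ?thesis by simp
qed

text \<open>Difference quotients of \<open>h\<close> have integral zero by translation invariance. They are bounded by the
  supremum of \<open>hb\<close> and supported in one ball, so dominated convergence applies.\<close>
lemma integral_line_derivative_eq_0:
  fixes h hb :: "'a::euclidean_space \<Rightarrow> 'b::euclidean_space"
  assumes b: "b \<in> Basis" and K: "compact K"
    and "continuous_on UNIV h" "continuous_on UNIV hb"
    and supp: "\<And>x. x \<notin> K \<Longrightarrow> h x = 0" "\<And>x. x \<notin> K \<Longrightarrow> hb x = 0"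
    and D: "\<And>x. ((\<lambda>\<tau>. h (x + \<tau> *\<^sub>R b)) has_vector_derivative hb x) (at 0)"
  shows "(LINT x|lborel. hb x) = 0"
proof -
  have "bounded (hb ` K)"
    by (rule compact_imp_bounded[OF compact_continuous_image[OF continuous_on_subset[OF assms(4)] K]]) simp
  then obtain M0 where "\<And>x. x \<in> K \<Longrightarrow> norm (hb x) \<le> M0" by (auto simp: bounded_iff)
  then have M: "norm (hb x) \<le> max 0 M0" for x using supp(2)[of x]
    by (cases "x \<in> K") (simp_all add: le_max_iff_disj)
  obtain r where "\<forall>x\<in>K. norm x \<le> r" using compact_imp_bounded[OF K] bounded_iff by blast
  then have r: "K \<subseteq> cball 0 r" by auto
  have mvt: "norm (h (x + \<tau> *\<^sub>R b) - h x) \<le> max 0 M0 * \<bar>\<tau>\<bar>" for x \<tau>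
  proof -
    have D': "((\<lambda>\<sigma>. h (x + \<sigma> *\<^sub>R b)) has_vector_derivative hb (x + s *\<^sub>R b)) (at s)" for s
    proof -
      have "((\<lambda>\<tau>. h (x + s *\<^sub>R b + \<tau> *\<^sub>R b)) \<circ> (\<lambda>\<sigma>. \<sigma> - s) has_vector_derivative (1 *\<^sub>R hb (x + s *\<^sub>R b))) (at s)"
        by (rule vector_diff_chain_at) (use D in \<open>auto intro!: derivative_eq_intros\<close>)
      then show ?thesis by (simp add: o_def algebra_simps)
    qed
    have "norm ((\<lambda>\<sigma>. h (x + \<sigma> *\<^sub>R b)) \<tau> - (\<lambda>\<sigma>. h (x + \<sigma> *\<^sub>R b)) 0) \<le> max 0 M0 * norm (\<tau> - 0)"
    proof (rule differentiable_bound[where S=UNIV])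
      show "((\<lambda>\<sigma>. h (x + \<sigma> *\<^sub>R b)) has_derivative (\<lambda>\<delta>. \<delta> *\<^sub>R hb (x + s *\<^sub>R b))) (at s within UNIV)" for s
        using D'[of s] by (simp add: has_vector_derivative_def)
      show "onorm (\<lambda>\<delta>::real. \<delta> *\<^sub>R hb (x + s *\<^sub>R b)) \<le> max 0 M0" for s
        using M[of "x + s *\<^sub>R b"]
        by (intro onorm_le) (simp add: mult.commute mult_left_mono)
    qed auto
    then show ?thesis by simp
  qed
  define q where "q j x = real (Suc j) *\<^sub>R (h (x + inverse (real (Suc j)) *\<^sub>R b) - h x)" for j x
  have qb: "norm (q j x) \<le> max 0 M0 * indicator (cball 0 (r + 1)) x" for j x
  proof (cases "x \<in> cball 0 (r + 1)")
    case True
    have "norm (q j x) \<le> real (Suc j) * (max 0 M0 * inverse (real (Suc j)))"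
      unfolding q_def norm_scaleR using mvt[of x "inverse (real (Suc j))"]
      by (intro mult_mono) auto
    also have "\<dots> = max 0 M0" by simp
    finally show ?thesis using True by simp
  next
    case False
    have "norm x \<le> norm (x + inverse (real (Suc j)) *\<^sub>R b) + norm (inverse (real (Suc j)) *\<^sub>R b)"
      by (metis add_diff_cancel norm_triangle_ineq4)
    also have "norm (inverse (real (Suc j)) *\<^sub>R b) \<le> 1" using b by (simp add: field_simps)
    finally have "x + inverse (real (Suc j)) *\<^sub>R b \<notin> K" "x \<notin> K" using False r by auto
    then show ?thesis using supp False by (simp add: q_def)
  qed
  have mh: "h \<in> borel_measurable borel" using assms borel_measurable_continuous_onI by blast
  have "(\<lambda>j. LINT x|lborel. q j x) \<longlonglongrightarrow> (LINT x|lborel. hb x)"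
  proof (rule integral_dominated_convergence)
    show "integrable lborel (\<lambda>x::'a. max 0 M0 * indicator (cball 0 (r + 1)) x)"
      by (intro integrable_mult_right integrable_real_indicator) (use emeasure_bounded_finite[OF bounded_cball, of "0::'a" "r + 1"] in auto)
    show "AE x in lborel. (\<lambda>i. q i x) \<longlonglongrightarrow> hb x"
    proof (intro AE_I2)
      fix x
      have "((\<lambda>\<tau>. (h (x + \<tau> *\<^sub>R b) - h x) /\<^sub>R \<tau>) \<longlongrightarrow> hb x) (at 0)"
      proof -
        have "((\<lambda>\<tau>. norm ((h (x + \<tau> *\<^sub>R b) - h x) - \<tau> *\<^sub>R hb x) / norm \<tau>) \<longlongrightarrow> 0) (at 0)"
          using D[of x] by (simp add: has_vector_derivative_def has_derivative_at)
        moreover have "norm ((h (x + \<tau> *\<^sub>R b) - h x) - \<tau> *\<^sub>R hb x) / norm \<tau> = norm ((h (x + \<tau> *\<^sub>R b) - h x) /\<^sub>R \<tau> - hb x)" 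
          if "\<tau> \<noteq> 0" for \<tau>
        proof -
          have "(h (x + \<tau> *\<^sub>R b) - h x) /\<^sub>R \<tau> - hb x = ((h (x + \<tau> *\<^sub>R b) - h x) - \<tau> *\<^sub>R hb x) /\<^sub>R \<tau>"
            using that by (simp add: algebra_simps)
          then show ?thesis by (simp add: divide_inverse mult.commute)
        qed
        ultimately have "((\<lambda>\<tau>. norm ((h (x + \<tau> *\<^sub>R b) - h x) /\<^sub>R \<tau> - hb x)) \<longlongrightarrow> 0) (at 0)"
          by (subst tendsto_cong[where g="\<lambda>\<tau>. norm ((h (x + \<tau> *\<^sub>R b) - h x) - \<tau> *\<^sub>R hb x) / norm \<tau>"])
            (auto simp: eventually_at_filter)
        then show ?thesis by (metis tendsto_norm_zero_iff LIM_zero_iff)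
      qed
      moreover have "filterlim (\<lambda>j. inverse (real (Suc j))) (at 0) sequentially"
        using LIMSEQ_inverse_real_of_nat by (auto simp: filterlim_at intro!: always_eventually)
      ultimately have "(\<lambda>j. (h (x + inverse (real (Suc j)) *\<^sub>R b) - h x) /\<^sub>R inverse (real (Suc j))) \<longlonglongrightarrow> hb x"
        by (rule filterlim_compose)
      then show "(\<lambda>i. q i x) \<longlonglongrightarrow> hb x" by (simp add: q_def)
    qed
    show "hb \<in> borel_measurable lborel" using assms borel_measurable_continuous_onI by auto
    show "q i \<in> borel_measurable lborel" for i unfolding q_def using mh by measurable
  qed (use qb in auto)
  moreover have "(LINT x|lborel. q j x) = 0" for j
  proof -
    have ih: "integrable lborel h" using assms integrable_compact_support by blast
    have "integrable lborel (\<lambda>x. h (inverse (real (Suc j)) *\<^sub>R b + x))"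
    proof -
      have "integrable (distr lborel borel ((+) (inverse (real (Suc j)) *\<^sub>R b))) h"
        using ih by (simp add: lborel_distr_plus)
      then show ?thesis by (subst (asm) integrable_distr_eq) (use mh in auto)
    qed
    then show ?thesis unfolding q_def
      using integral_translate[OF mh, of "inverse (real (Suc j)) *\<^sub>R b"] ih
      by (simp add: add.commute)
  qed
  ultimately show ?thesis by (simp add: LIMSEQ_const_iff)
qed

text \<open>In each coordinate direction the difference of the two integrands is the derivative of the
  compactly supported function \<open>\<psi> f' - \<psi>' f\<close>.\<close>
lemma green_identity:
  fixes f :: "'a::euclidean_space \<Rightarrow> 'b::euclidean_space" and \<psi> :: "'a \<Rightarrow> real"
  assumes f: "pure_C2_on UNIV f f1 f2" and \<psi>: "pure_C2_on UNIV \<psi> \<psi>1 \<psi>2" and K: "compact K"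
    and supp: "(\<forall>x. x \<notin> K \<longrightarrow> f x = 0 \<and> (\<forall>b. f1 b x = 0 \<and> f2 b x = 0)) \<or>
       (\<forall>x. x \<notin> K \<longrightarrow> \<psi> x = 0 \<and> (\<forall>b. \<psi>1 b x = 0 \<and> \<psi>2 b x = 0))"
  shows "(LINT x|lborel. \<psi> x *\<^sub>R (\<Sum>b\<in>Basis. f2 b x)) = (LINT x|lborel. (\<Sum>b\<in>Basis. \<psi>2 b x) *\<^sub>R f x)"
proof -
  have int1: "integrable lborel (\<lambda>x. \<psi> x *\<^sub>R f2 b x)" if "b \<in> Basis" for b
    by (rule integrable_compact_support[OF _ K])
      (use that supp in \<open>auto intro!: continuous_intros pure_C2_onD[OF f] pure_C2_onD[OF \<psi>]\<close>)
  have int2: "integrable lborel (\<lambda>x. \<psi>2 b x *\<^sub>R f x)" if "b \<in> Basis" for b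
    by (rule integrable_compact_support[OF _ K])
      (use that supp in \<open>auto intro!: continuous_intros pure_C2_onD[OF f] pure_C2_onD[OF \<psi>]\<close>)
  have "(LINT x|lborel. \<psi> x *\<^sub>R f2 b x - \<psi>2 b x *\<^sub>R f x) = 0" if b: "b \<in> Basis" for b
  proof (rule integral_line_derivative_eq_0[OF b K, where h="\<lambda>x. \<psi> x *\<^sub>R f1 b x - \<psi>1 b x *\<^sub>R f x"])
    fix x
    have "((\<lambda>\<tau>. \<psi> (x + \<tau> *\<^sub>R b) *\<^sub>R f1 b (x + \<tau> *\<^sub>R b) - \<psi>1 b (x + \<tau> *\<^sub>R b) *\<^sub>R f (x + \<tau> *\<^sub>R b)) has_vector_derivative
      (\<psi> (x + 0 *\<^sub>R b) *\<^sub>R f2 b x + \<psi>1 b x *\<^sub>R f1 b (x + 0 *\<^sub>R b)) - (\<psi>1 b (x + 0 *\<^sub>R b) *\<^sub>R f1 b x + \<psi>2 b x *\<^sub>R f (x + 0 *\<^sub>R b))) (at 0)"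
      by (intro has_vector_derivative_diff has_vector_derivative_scaleR)
        (use pure_C2_onD(4,5)[OF f b] pure_C2_onD(4,5)[OF \<psi> b] in 
          \<open>simp_all add: has_real_derivative_iff_has_vector_derivative\<close>)
    then show "((\<lambda>\<tau>. \<psi> (x + \<tau> *\<^sub>R b) *\<^sub>R f1 b (x + \<tau> *\<^sub>R b) - \<psi>1 b (x + \<tau> *\<^sub>R b) *\<^sub>R f (x + \<tau> *\<^sub>R b)) has_vector_derivative
      \<psi> x *\<^sub>R f2 b x - \<psi>2 b x *\<^sub>R f x) (at 0)" by simp
  qed (use b supp in \<open>auto intro!: continuous_intros pure_C2_onD[OF f] pure_C2_onD[OF \<psi>]\<close>)
  then have "(LINT x|lborel. \<psi> x *\<^sub>R f2 b x) = (LINT x|lborel. \<psi>2 b x *\<^sub>R f x)" if "b \<in> Basis" for b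
    using that int1 int2 by simp
  then show ?thesis
    by (simp add: scaleR_sum_right scaleR_sum_left Bochner_Integration.integral_sum int1 int2)
qed

section \<open>Mean values and the Newtonian representation\<close>

lemma has_real_derivative_glue:
  fixes p q :: "real \<Rightarrow> real"
  assumes "\<And>s. s \<le> s0 \<Longrightarrow> (p has_real_derivative p' s) (at s)"
    and "\<And>s. s0 \<le> s \<Longrightarrow> (q has_real_derivative q' s) (at s)"
    and "p s0 = q s0" "p' s0 = q' s0"
  shows "((\<lambda>s. if s \<le> s0 then p s else q s) has_real_derivative (if s \<le> s0 then p' s else q' s)) (at s)"
proof -
  have "((\<lambda>s. if s \<in> {..s0} then p s else q s) has_vector_derivative
      (if s \<in> {..s0} then p' s else q' s)) (at s within UNIV)"
  proof (rule has_vector_derivative_If_within_closures[where T="{s0<..}"])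
    show "(p has_vector_derivative p' s) (at s within {..s0} \<union> closure {..s0} \<inter> closure {s0<..})"
      if "s \<in> {..s0} \<union> closure {..s0} \<inter> closure {s0<..}"
      using that assms(1)[of s] unfolding has_real_derivative_iff_has_vector_derivative
      by (auto intro: has_vector_derivative_at_within)
    show "(q has_vector_derivative q' s) (at s within {s0<..} \<union> closure {..s0} \<inter> closure {s0<..})"
      if "s \<in> {s0<..} \<union> closure {..s0} \<inter> closure {s0<..}"
      using that assms(2)[of s] unfolding has_real_derivative_iff_has_vector_derivative
      by (auto intro: has_vector_derivative_at_within)
    have "s = s0" if "s \<in> closure {..s0}" "s \<in> closure {s0<..}" using that by auto
    then show "p s = q s" "p' s = q' s" if "s \<in> closure {..s0}" "s \<in> closure {s0<..}" 
      using that assms by blast+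
  qed auto
  then show ?thesis by (simp add: has_real_derivative_iff_has_vector_derivative)
qed

lemma continuous_on_glue:
  fixes p q :: "real \<Rightarrow> real"
  assumes "continuous_on {..s0} p" "continuous_on {s0..} q" "p s0 = q s0"
  shows "continuous_on UNIV (\<lambda>s. if s \<le> s0 then p s else q s)"
proof -
  have "continuous_on ({..s0} \<union> {s0..}) (\<lambda>s. if s \<le> s0 then p s else q s)"
    by (rule continuous_on_If) (use assms in \<open>auto\<close>)
  moreover have "{..s0} \<union> {s0..} = (UNIV :: real set)" by auto
  ultimately show ?thesis by simp
qed

text \<open>The cube of the positive part is the simplest function of class \<open>C\<^sup>2\<close> that vanishes on a half-line.\<close>
lemma has_derivative_max_0_cube:
  "((\<lambda>t. max 0 t ^ 3) has_real_derivative 3 * (max 0 t)\<^sup>2) (at (t::real))"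
  "((\<lambda>t. 3 * (max 0 t)\<^sup>2) has_real_derivative 6 * max 0 t) (at (t::real))"
proof -
  have 1: "((\<lambda>t::real. if t \<le> 0 then 0 else t ^ 3) has_real_derivative (if t \<le> 0 then 0 else 3 * t\<^sup>2)) (at t)"
    by (rule has_real_derivative_glue) (auto intro!: derivative_eq_intros simp: power2_eq_square)
  have 2: "((\<lambda>t::real. if t \<le> 0 then 0 else 3 * t\<^sup>2) has_real_derivative (if t \<le> 0 then 0 else 6 * t)) (at t)"
    by (rule has_real_derivative_glue) (auto intro!: derivative_eq_intros)
  have "(\<lambda>t::real. if t \<le> 0 then 0 else t ^ 3) = (\<lambda>t. max 0 t ^ 3)"
    "(\<lambda>t::real. if t \<le> 0 then 0 else 3 * t\<^sup>2) = (\<lambda>t. 3 * (max 0 t)\<^sup>2)"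
    by (auto simp: fun_eq_iff max_def)
  then show "((\<lambda>t. max 0 t ^ 3) has_real_derivative 3 * (max 0 t)\<^sup>2) (at t)"
    "((\<lambda>t. 3 * (max 0 t)\<^sup>2) has_real_derivative 6 * max 0 t) (at t)"
    using 1 2 by (auto simp: max_def split: if_splits)
qed

text \<open>The composition \<open>\<eta>(1 - \<eta>((s - r) / (r' - r)))\<close>, where \<open>\<eta>\<close> is the cube of the positive part, has both
  plateaus.\<close>
lemma smooth_cutoff:
  assumes "(r::real) < r'"
  obtains \<theta> \<theta>' \<theta>'' where
    "\<And>s. (\<theta> has_real_derivative \<theta>' s) (at s)" "\<And>s. (\<theta>' has_real_derivative \<theta>'' s) (at s)"
    "continuous_on UNIV \<theta>''"
    "\<And>s. s \<le> r \<Longrightarrow> \<theta> s = 1 \<and> \<theta>' s = 0 \<and> \<theta>'' s = 0"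
    "\<And>s. r' \<le> s \<Longrightarrow> \<theta> s = 0 \<and> \<theta>' s = 0 \<and> \<theta>'' s = 0"
proof
  define w where "w = r' - r"
  define e0 e1 e2 where "e0 = (\<lambda>t::real. max 0 t ^ 3)" and "e1 = (\<lambda>t::real. 3 * (max 0 t)\<^sup>2)"
    and "e2 = (\<lambda>t::real. 6 * max 0 t)"
  define T where "T = (\<lambda>s. (s - r) / w)"
  have w: "w > 0" using assms by (simp add: w_def)
  have d0: "(e0 has_real_derivative e1 t) (at t)" and d1: "(e1 has_real_derivative e2 t) (at t)" for t
    unfolding e0_def e1_def e2_def by (rule has_derivative_max_0_cube)+
  have dT: "(T has_real_derivative inverse w) (at s)" for s
    unfolding T_def using w by (auto intro!: derivative_eq_intros simp: divide_inverse)
  have dT0: "((\<lambda>s. 1 - e0 (T s)) has_real_derivative - (e1 (T s) * inverse w)) (at s)" for s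
    by (rule DERIV_cong[OF DERIV_diff[OF DERIV_const DERIV_chain2[OF d0 dT]]]) simp
  show "((\<lambda>s. e0 (1 - e0 (T s))) has_real_derivative e1 (1 - e0 (T s)) * - (e1 (T s) * inverse w)) (at s)" for s
    by (rule DERIV_chain2[OF d0 dT0])
  show "((\<lambda>s. e1 (1 - e0 (T s)) * - (e1 (T s) * inverse w)) has_real_derivative 
      (e2 (1 - e0 (T s)) * - (e1 (T s) * inverse w)) * - (e1 (T s) * inverse w)
       + - (e2 (T s) * inverse w * inverse w) * e1 (1 - e0 (T s))) (at s)" for s
    by (rule DERIV_mult[OF DERIV_chain2[OF d1 dT0] DERIV_minus[OF DERIV_cmult_right[OF DERIV_chain2[OF d1 dT]]]])
  show "continuous_on UNIV (\<lambda>s. (e2 (1 - e0 (T s)) * - (e1 (T s) * inverse w)) * - (e1 (T s) * inverse w)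
       + - (e2 (T s) * inverse w * inverse w) * e1 (1 - e0 (T s)))"
    unfolding e0_def e1_def e2_def T_def using w by (intro continuous_intros) auto
  have T0: "T s \<le> 0" if "s \<le> r" for s using that w by (simp add: T_def divide_le_0_iff)
  show "e0 (1 - e0 (T s)) = 1 \<and> e1 (1 - e0 (T s)) * - (e1 (T s) * inverse w) = 0 \<and>
     (e2 (1 - e0 (T s)) * - (e1 (T s) * inverse w)) * - (e1 (T s) * inverse w)
       + - (e2 (T s) * inverse w * inverse w) * e1 (1 - e0 (T s)) = 0" if "s \<le> r" for s
    using T0[OF that] by (simp add: e0_def e1_def e2_def max_def)
  show "e0 (1 - e0 (T s)) = 0 \<and> e1 (1 - e0 (T s)) * - (e1 (T s) * inverse w) = 0 \<and>
     (e2 (1 - e0 (T s)) * - (e1 (T s) * inverse w)) * - (e1 (T s) * inverse w)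
       + - (e2 (T s) * inverse w * inverse w) * e1 (1 - e0 (T s)) = 0" if "r' \<le> s" for s
  proof -
    have "1 \<le> T s" using that w by (simp add: T_def w_def le_divide_eq)
    then have "1 \<le> e0 (T s)" by (simp add: e0_def max_def)
    then have "1 - e0 (T s) \<le> 0" by simp
    then have "e0 (1 - e0 (T s)) = 0" "e1 (1 - e0 (T s)) = 0" "e2 (1 - e0 (T s)) = 0"
      by (simp_all add: e0_def[of] e1_def e2_def max_def)
    then show ?thesis by simp
  qed
qed

text \<open>The Newtonian kernel as a function of the squared distance. With this normalization its derivative
  is \<open>s\<close> to the power \<open>-n/2\<close> in every dimension, and the proofs below only see this derivative.\<close>
definition newton_profile :: "nat \<Rightarrow> real \<Rightarrow> real" where
  "newton_profile n s = (if n = 2 then ln s else s powr (1 - n / 2) / (1 - n / 2))"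

lemma has_derivative_newton_profile:
  assumes "s > 0"
  shows "(newton_profile n has_real_derivative s powr (- real n / 2)) (at s)"
proof (cases "n = 2")
  case True
  have "newton_profile 2 = ln" by (simp add: newton_profile_def fun_eq_iff)
  then show ?thesis using DERIV_ln[OF assms] assms by (simp add: True powr_minus)
next
  case False
  then have "1 - real n / 2 \<noteq> 0" by auto
  then have "((\<lambda>s. s powr (1 - n / 2) / (1 - n / 2)) has_real_derivative s powr (- real n / 2)) (at s)"
    using assms by (auto intro!: derivative_eq_intros)
  moreover have "newton_profile n = (\<lambda>s. s powr (1 - n / 2) / (1 - n / 2))" 
    using False by (auto simp: newton_profile_def)
  ultimately show ?thesis by simp
qed

text \<open>Mean values are taken with this weight because it is, up to a constant, the Laplacian of a
  truncated Newtonian kernel.\<close>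
definition bump :: "'a::euclidean_space \<Rightarrow> real" where
  "bump z = max 0 (1 - (norm z)\<^sup>2)"

lemma bump_nonneg [simp]: "0 \<le> bump z" by (simp add: bump_def)
lemma bump_le_1: "bump z \<le> 1" by (simp add: bump_def)
lemma bump_eq_0: "1 \<le> norm z \<Longrightarrow> bump z = 0" 
  by (simp add: bump_def max_def) (smt (verit) one_le_power)

lemma bump_scaled_eq_0: "0 < \<delta> \<Longrightarrow> \<delta> \<le> dist x y \<Longrightarrow> bump ((1 / \<delta>) *\<^sub>R (y - x)) = 0"
  by (intro bump_eq_0) (simp add: dist_norm norm_minus_commute)

lemma continuous_on_bump [continuous_intros]:
  "continuous_on S f \<Longrightarrow> continuous_on S (\<lambda>x. bump (f x))"
  unfolding bump_def by (intro continuous_intros)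

text \<open>Inside the ball of radius \<open>\<delta>\<close> the profile \<open>g\<close> is replaced by its second Taylor polynomial at \<open>s = \<delta>\<^sup>2\<close>,
  so that the kernel remains of class \<open>C\<^sup>2\<close>. The Laplacian \<open>4 s g'' + 2 n g'\<close> of the polynomial is affine in
  \<open>s\<close> and vanishes at \<open>s = \<delta>\<^sup>2\<close>, because the kernel is harmonic at this distance; hence it is a multiple of \<open>\<delta>\<^sup>2 - s\<close>.\<close>
lemma truncated_newton_kernel:
  fixes x :: "'a::euclidean_space"
  assumes "\<delta> > 0"
  obtains \<psi> \<psi>1 \<psi>2 where "pure_C2_on UNIV \<psi> \<psi>1 \<psi>2"
    "\<And>y. \<delta> \<le> norm (y - x) \<Longrightarrow> \<psi> y = newton_profile DIM('a) ((norm (y - x))\<^sup>2)"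
    "\<And>y. (\<Sum>b\<in>Basis. \<psi>2 b y) = 
       real (DIM('a) * (DIM('a) + 2)) / \<delta> ^ DIM('a) * bump ((1 / \<delta>) *\<^sub>R (y - x))"
proof -
  define n where "n = real DIM('a)"
  define s0 where "s0 = \<delta>\<^sup>2"
  have s0: "s0 > 0" using assms by (simp add: s0_def)
  \<comment> \<open>the first two derivatives of the profile at \<open>s0\<close>\<close>
  define g1 g2 where "g1 = s0 powr (- n / 2)" and "g2 = - (n / 2) * s0 powr (- n / 2 - 1)"
  define h where "h = newton_profile DIM('a)"
  define G G1 G2 where 
    "G = (\<lambda>s. if s \<le> s0 then h s0 + g1 * (s - s0) + g2 / 2 * (s - s0)\<^sup>2 else h s)" and
    "G1 = (\<lambda>s. if s \<le> s0 then g1 + g2 * (s - s0) else s powr (- n / 2))" and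
    "G2 = (\<lambda>s. if s \<le> s0 then g2 else - (n / 2) * s powr (- n / 2 - 1))"
  have G: "(G has_real_derivative G1 s) (at s)" for s
    unfolding G_def G1_def
  proof (rule has_real_derivative_glue)
    show "(h has_real_derivative s powr (- n / 2)) (at s)" if "s0 \<le> s" for s
      unfolding h_def n_def using that s0 by (intro has_derivative_newton_profile) auto
  qed (auto intro!: derivative_eq_intros simp: g1_def)
  have G1: "(G1 has_real_derivative G2 s) (at s)" for s
    unfolding G1_def G2_def
  proof (rule has_real_derivative_glue)
    show "((\<lambda>s. s powr (- n / 2)) has_real_derivative - (n / 2) * s powr (- n / 2 - 1)) (at s)" if "s0 \<le> s" for s
      using that s0 by (auto intro!: derivative_eq_intros)
  qed (auto intro!: derivative_eq_intros simp: g1_def g2_def)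
  have G2: "continuous_on UNIV G2"
    unfolding G2_def by (rule continuous_on_glue) (use s0 in \<open>auto intro!: continuous_intros simp: g2_def\<close>)
  have lap: "4 * s * G2 s + 2 * n * G1 s = n * (n + 2) / \<delta> ^ DIM('a) * max 0 (1 - s / s0)" for s
  proof (cases "s \<le> s0")
    case True
    have e1: "s0 powr (- n / 2) = s0 * s0 powr (- n / 2 - 1)"
      using s0 by (simp add: powr_diff)
    have e2: "s0 powr (- n / 2) = 1 / \<delta> ^ DIM('a)"
    proof -
      have "s0 powr (- n / 2) = \<delta> powr (2 * (- n / 2))"
      proof -
        have "s0 = \<delta> powr 2" using assms by (simp add: s0_def)
        then show ?thesis by (simp only: powr_powr)
      qed
      also have "2 * (- n / 2) = - real DIM('a)" by (simp add: n_def)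
      also have "\<delta> powr (- real DIM('a)) = 1 / \<delta> ^ DIM('a)"
        using assms by (simp only: powr_minus powr_realpow divide_inverse mult_1_left)
      finally show ?thesis .
    qed
    have "4 * s * G2 s + 2 * n * G1 s = 4 * s * g2 + 2 * n * (g1 + g2 * (s - s0))"
      using True by (simp add: G1_def G2_def)
    also have "\<dots> = n * (n + 2) * s0 powr (- n / 2 - 1) * (s0 - s)"
      unfolding g1_def g2_def e1 by (simp add: field_simps)
    also have "\<dots> = n * (n + 2) * s0 powr (- n / 2) * (1 - s / s0)"
      unfolding e1 using s0 by (simp add: field_simps)
    finally show ?thesis using True s0 e2 by (simp add: max_def)
  next
    case False
    then have "s > 0" using s0 by simp
    then have "s powr (- n / 2) = s * s powr (- n / 2 - 1)" by (simp add: powr_diff)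
    then show ?thesis using False s0 by (simp add: G1_def G2_def max_def)
  qed
  show thesis
  proof (rule that[OF pure_C2_on_radial[OF G G1 G2, where x=x]])
    fix y :: 'a
    show "G ((norm (y - x))\<^sup>2) = newton_profile DIM('a) ((norm (y - x))\<^sup>2)" if "\<delta> \<le> norm (y - x)"
    proof -
      have "s0 \<le> (norm (y - x))\<^sup>2" using that assms by (simp add: s0_def power_mono)
      then show ?thesis by (cases "(norm (y - x))\<^sup>2 = s0") (auto simp: G_def h_def)
    qed
    have "(norm ((1 / \<delta>) *\<^sub>R (y - x)))\<^sup>2 = (norm (y - x))\<^sup>2 / s0"
      by (simp add: s0_def power_divide)
    then show "(\<Sum>b\<in>Basis. 4 * ((y - x) \<bullet> b)\<^sup>2 * G2 ((norm (y - x))\<^sup>2) + 2 * G1 ((norm (y - x))\<^sup>2)) =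
      real (DIM('a) * (DIM('a) + 2)) / \<delta> ^ DIM('a) * bump ((1 / \<delta>) *\<^sub>R (y - x))"
      unfolding radial_laplacian using lap[of "(norm (y - x))\<^sup>2"] by (simp add: bump_def n_def algebra_simps)
  qed
qed

lemma continuous_on_weight_scaleR:
  fixes f :: "'a::euclidean_space \<Rightarrow> 'b::euclidean_space" and w :: "'a \<Rightarrow> real"
  assumes "continuous_on S f" "open S" "cball x \<delta> \<subseteq> S" "continuous_on UNIV w" 
    "\<And>y. \<delta> < dist x y \<Longrightarrow> w y = 0"
  shows "continuous_on UNIV (\<lambda>y. w y *\<^sub>R f y)" "integrable lborel (\<lambda>y. w y *\<^sub>R f y)"
proof -
  show c: "continuous_on UNIV (\<lambda>y. w y *\<^sub>R f y)"
    by (rule continuous_on_UNIV_extend_zero[of S _ "cball x \<delta>"])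
      (use assms in \<open>auto intro!: continuous_intros intro: continuous_on_subset\<close>)
  show "integrable lborel (\<lambda>y. w y *\<^sub>R f y)"
    by (rule integrable_compact_support[OF c, of "cball x \<delta>"]) (use assms in auto)
qed

lemma integral_affine:
  fixes f :: "'a::euclidean_space \<Rightarrow> 'b::euclidean_space"
  assumes "f \<in> borel_measurable borel" "\<delta> > 0"
  shows "(LINT y|lborel. f y) = \<delta> ^ DIM('a) *\<^sub>R (LINT z|lborel. f (x + \<delta> *\<^sub>R z))"
proof -
  have "(LINT y|lborel. f y) = (LINT y|density (distr lborel borel (\<lambda>z. x + \<delta> *\<^sub>R z)) (\<lambda>_. \<bar>\<delta>\<bar> ^ DIM('a)). f y)"
    using assms by (subst lborel_affine[of \<delta> x]) auto
  also have "\<dots> = (LINT y|distr lborel borel (\<lambda>z. x + \<delta> *\<^sub>R z). \<bar>\<delta>\<bar> ^ DIM('a) *\<^sub>R f y)"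
    by (rule integral_density) (use assms in auto)
  also have "\<dots> = (LINT z|lborel. \<bar>\<delta>\<bar> ^ DIM('a) *\<^sub>R f (x + \<delta> *\<^sub>R z))"
    by (rule integral_distr) (use assms in auto)
  also have "\<dots> = \<delta> ^ DIM('a) *\<^sub>R (LINT z|lborel. f (x + \<delta> *\<^sub>R z))"
    using assms by simp
  finally show ?thesis .
qed

text \<open>The dilated weights concentrate at \<open>x\<close>.\<close>
lemma weighted_mean_tendsto:
  fixes f :: "'a::euclidean_space \<Rightarrow> 'b::euclidean_space" and w :: "'a \<Rightarrow> real"
  assumes f: "continuous_on S f" "open S" "cball x \<delta> \<subseteq> S" and \<delta>: "\<delta> > 0" and w: "continuous_on UNIV w" 
    "\<And>z. 1 < norm z \<Longrightarrow> w z = 0"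
  shows "(\<lambda>j. LINT z|lborel. w z *\<^sub>R f (x + (\<delta> / real (Suc j)) *\<^sub>R z)) \<longlonglongrightarrow> (LINT z|lborel. w z) *\<^sub>R f x"
proof -
  have iw: "integrable lborel w"
    by (rule integrable_compact_support[OF w(1), of "cball 0 1"]) (use w in auto)
  have "bounded (f ` cball x \<delta>)"
    by (rule compact_imp_bounded[OF compact_continuous_image[OF continuous_on_subset[OF f(1,3)]]]) simp
  then obtain M where "\<forall>y\<in>f ` cball x \<delta>. norm y \<le> M" using bounded_iff by blast
  then have M: "\<And>y. y \<in> cball x \<delta> \<Longrightarrow> norm (f y) \<le> M" by blast
  have dj: "0 < \<delta> / real (Suc j)" "\<delta> / real (Suc j) \<le> \<delta>" for j
    using \<delta> by (auto simp: divide_le_eq mult_le_cancel_left1)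
  have in_cball: "x + (\<delta> / real (Suc j)) *\<^sub>R z \<in> cball x \<delta>" if "norm z \<le> 1" for j z
    using mult_mono[OF dj(2)[of j] that] \<delta> by (simp add: dist_norm)
  have cont: "continuous_on UNIV (\<lambda>z. w z *\<^sub>R f (x + (\<delta> / real (Suc j)) *\<^sub>R z))" for j
  proof (rule continuous_on_weight_scaleR(1)[of "(\<lambda>z. x + (\<delta> / real (Suc j)) *\<^sub>R z) -` S" _ 0 1])
    show "continuous_on ((\<lambda>z. x + (\<delta> / real (Suc j)) *\<^sub>R z) -` S) (\<lambda>z. f (x + (\<delta> / real (Suc j)) *\<^sub>R z))"
      by (rule continuous_on_compose2[OF f(1)]) (auto intro!: continuous_intros)
    show "open ((\<lambda>z. x + (\<delta> / real (Suc j)) *\<^sub>R z) -` S)" 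
      by (intro open_vimage f continuous_intros)
    show "cball 0 1 \<subseteq> (\<lambda>z. x + (\<delta> / real (Suc j)) *\<^sub>R z) -` S"
      using subsetD[OF f(3) in_cball] by auto
  qed (use w in auto)
  have "(\<lambda>j. LINT z|lborel. w z *\<^sub>R f (x + (\<delta> / real (Suc j)) *\<^sub>R z)) \<longlonglongrightarrow> (LINT z|lborel. w z *\<^sub>R f x)"
  proof (rule integral_dominated_convergence)
    show "integrable lborel (\<lambda>z. \<bar>w z\<bar> * M)" using iw by auto
    show "AE z in lborel. norm (w z *\<^sub>R f (x + (\<delta> / real (Suc j)) *\<^sub>R z)) \<le> \<bar>w z\<bar> * M" for j
    proof (intro AE_I2)
      fix z
      show "norm (w z *\<^sub>R f (x + (\<delta> / real (Suc j)) *\<^sub>R z)) \<le> \<bar>w z\<bar> * M"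
      proof (cases "norm z \<le> 1")
        case True
        then show ?thesis using M[OF in_cball[OF True, of j]] by (auto intro: mult_left_mono)
      next
        case False then show ?thesis using w(2)[of z] by simp
      qed
    qed
    have "(\<lambda>j. \<delta> / real (Suc j)) \<longlonglongrightarrow> 0"
      using tendsto_mult[OF tendsto_const[of \<delta>] LIMSEQ_inverse_real_of_nat] by (simp add: divide_inverse)
    then have l0: "(\<lambda>j. x + (\<delta> / real (Suc j)) *\<^sub>R z) \<longlonglongrightarrow> x" for z
      using tendsto_add[OF tendsto_const[of x] tendsto_scaleR[OF _ tendsto_const[of z]]] by fastforce
    have "isCont f x" using f \<delta> by (metis centre_in_cball continuous_on_eq_continuous_at less_imp_le subsetD)
    then show "AE z in lborel. (\<lambda>j. w z *\<^sub>R f (x + (\<delta> / real (Suc j)) *\<^sub>R z)) \<longlonglongrightarrow> w z *\<^sub>R f x"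
      by (intro AE_I2 tendsto_intros isCont_tendsto_compose[OF _ l0])
    show "(\<lambda>z. w z *\<^sub>R f (x + (\<delta> / real (Suc j)) *\<^sub>R z)) \<in> borel_measurable lborel" for j
      using borel_measurable_continuous_onI[OF cont[of j]] by simp
    show "(\<lambda>z. w z *\<^sub>R f x) \<in> borel_measurable lborel" using iw by auto
  qed
  moreover have "(LINT z|lborel. w z *\<^sub>R f x) = (LINT z|lborel. w z) *\<^sub>R f x"
    by (rule integral_scaleR_left) (rule iw)
  ultimately show ?thesis by simp
qed

definition bump_mass :: "'a::euclidean_space itself \<Rightarrow> real" where
  "bump_mass _ = (LINT z|(lborel :: 'a measure). bump z)"

lemma bump_mass_pos: "bump_mass TYPE('a::euclidean_space) > 0"
proof -
  have c: "continuous_on UNIV (bump :: 'a \<Rightarrow> real)" by (intro continuous_intros)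
  have i: "integrable lborel (bump :: 'a \<Rightarrow> real)"
    by (rule integrable_compact_support[OF c, of "cball 0 1"]) (auto intro: bump_eq_0)
  have "(LINT z|lborel. (3/4) * indicator (cball 0 (1/2)) (z::'a)) \<le> (LINT z|lborel. bump (z::'a))"
  proof (rule integral_mono[OF _ i])
    show "integrable lborel (\<lambda>z::'a. (3/4) * indicator (cball 0 (1/2)) z :: real)"
      by (intro integrable_mult_right integrable_real_indicator) (use emeasure_bounded_finite[OF bounded_cball, of "0::'a" "1/2"] in auto)
    show "(3/4) * indicator (cball 0 (1/2)) z \<le> bump z" for z :: 'a
      using power_mono[of "norm z" "1/2" 2] by (auto simp: indicator_def bump_def max_def power2_eq_square)
  qed
  moreover have "(LINT z|lborel. (3/4) * indicator (cball 0 (1/2)) (z::'a)) = (3/4) * measure lborel (cball (0::'a) (1/2))"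
    by simp
  moreover have "measure lborel (cball (0::'a) (1/2)) > 0"
    using content_cball_pos[of "1/2" "0::'a"] by simp
  ultimately show ?thesis unfolding bump_mass_def by linarith
qed

lemma cball_subset_unit_ball:
  fixes x :: "'a::real_normed_vector"
  assumes "norm x + \<delta> < 1"
  shows "cball x \<delta> \<subseteq> ball 0 1"
proof
  fix y assume "y \<in> cball x \<delta>"
  then have "norm y \<le> norm x + \<delta>" using norm_le_norm_add_dist[of y x] by auto
  then show "y \<in> ball 0 1" using assms by simp
qed

lemma integrable_bump_scaleR:
  fixes f :: "'a::euclidean_space \<Rightarrow> 'b::euclidean_space"
  assumes "continuous_on S f" "open S" "\<delta> > 0" "cball x \<delta> \<subseteq> S"
  shows "integrable lborel (\<lambda>y. bump ((1 / \<delta>) *\<^sub>R (y - x)) *\<^sub>R f y)"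
    and "continuous_on UNIV (\<lambda>y. bump ((1 / \<delta>) *\<^sub>R (y - x)) *\<^sub>R f y)"
proof -
  have 1: "bump ((1 / \<delta>) *\<^sub>R (y - x)) = 0" if "\<delta> < dist x y" for y
    using that assms by (simp add: bump_scaled_eq_0)
  have 2: "continuous_on UNIV (\<lambda>y. bump ((1 / \<delta>) *\<^sub>R (y - x)))" by (intro continuous_intros)
  show "integrable lborel (\<lambda>y. bump ((1 / \<delta>) *\<^sub>R (y - x)) *\<^sub>R f y)"
    "continuous_on UNIV (\<lambda>y. bump ((1 / \<delta>) *\<^sub>R (y - x)) *\<^sub>R f y)"
    using continuous_on_weight_scaleR[OF assms(1,2,4) 2 1] by auto
qed

text \<open>The product of \<open>u\<close> with a radial cutoff. It is smooth in the whole space, so Green's identity applies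
  to it without boundary terms.\<close>
lemma harmonic_cutoff:
  fixes u :: "'a::euclidean_space \<Rightarrow> complex"
  assumes u: "harmonic_on (ball 0 1) u" and R: "0 < R" "R < R'" "R' < 1"
  obtains F F1 F2 where "pure_C2_on UNIV F F1 F2" "\<And>y. norm y \<le> R \<Longrightarrow> F y = u y"
    "\<And>y. norm y \<le> R \<Longrightarrow> (\<Sum>b\<in>Basis. F2 b y) = 0"
    "\<And>b y. R' \<le> norm y \<Longrightarrow> F y = 0 \<and> F1 b y = 0 \<and> F2 b y = 0"
proof -
  obtain u1 u2 where C2u: "pure_C2_on (ball 0 1) u u1 u2" 
    and lap0: "\<And>x. x \<in> ball 0 1 \<Longrightarrow> (\<Sum>b\<in>Basis. u2 b x) = 0"
    by (rule harmonic_on_imp_pure_C2_on[OF u]) (rule that)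
  have "R\<^sup>2 < R'\<^sup>2" using R by (intro power_strict_mono) auto
  then obtain \<theta> \<theta>' \<theta>'' where \<theta>: "\<And>s. (\<theta> has_real_derivative \<theta>' s) (at s)" 
    "\<And>s. (\<theta>' has_real_derivative \<theta>'' s) (at s)" "continuous_on UNIV \<theta>''"
    "\<And>s. s \<le> R\<^sup>2 \<Longrightarrow> \<theta> s = 1 \<and> \<theta>' s = 0 \<and> \<theta>'' s = 0"
    "\<And>s. R'\<^sup>2 \<le> s \<Longrightarrow> \<theta> s = 0 \<and> \<theta>' s = 0 \<and> \<theta>'' s = 0"
    using smooth_cutoff by blast
  define \<omega> where "\<omega> y = \<theta> ((norm (y - 0))\<^sup>2)" for y :: 'a
  define \<omega>1 where "\<omega>1 b y = 2 * ((y - 0) \<bullet> b) * \<theta>' ((norm (y - 0))\<^sup>2)" for b y :: 'a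
  define \<omega>2 where "\<omega>2 b y = 4 * ((y - 0) \<bullet> b)\<^sup>2 * \<theta>'' ((norm (y - 0))\<^sup>2) + 2 * \<theta>' ((norm (y - 0))\<^sup>2)" for b y :: 'a
  have C2\<omega>: "pure_C2_on (ball 0 1) \<omega> \<omega>1 \<omega>2"
    unfolding \<omega>_def \<omega>1_def \<omega>2_def by (rule pure_C2_on_radial[OF \<theta>(1-3)])
  have \<omega>in: "\<omega> y = 1" "\<omega>1 b y = 0" "\<omega>2 b y = 0" if "norm y \<le> R" for b y
    using \<theta>(4)[of "(norm y)\<^sup>2"] power_mono[OF that, of 2] by (auto simp: \<omega>_def \<omega>1_def \<omega>2_def)
  have \<omega>out: "\<omega> y = 0" "\<omega>1 b y = 0" "\<omega>2 b y = 0" if "R' \<le> norm y" for b y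
    using \<theta>(5)[of "(norm y)\<^sup>2"] power_mono[OF that, of 2] R by (auto simp: \<omega>_def \<omega>1_def \<omega>2_def)
  define F where "F y = \<omega> y *\<^sub>R u y" for y
  define F1 where "F1 b y = \<omega>1 b y *\<^sub>R u y + \<omega> y *\<^sub>R u1 b y" for b y
  define F2 where "F2 b y = \<omega>2 b y *\<^sub>R u y + 2 *\<^sub>R \<omega>1 b y *\<^sub>R u1 b y + \<omega> y *\<^sub>R u2 b y" for b y
  have "pure_C2_on (ball 0 1) F F1 F2"
    unfolding F_def F1_def F2_def by (rule pure_C2_on_scaleR[OF C2\<omega> C2u])
  then have C2F: "pure_C2_on UNIV F F1 F2"
    by (rule pure_C2_on_UNIV_extend_zero[where K="cball 0 R'"])
      (use R \<omega>out in \<open>auto simp: F_def F1_def F2_def\<close>)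
  show thesis
  proof (rule that[OF C2F])
    show "F y = u y" if "norm y \<le> R" for y using that by (simp add: F_def \<omega>in)
    show "(\<Sum>b\<in>Basis. F2 b y) = 0" if "norm y \<le> R" for y
      using that R lap0[of y] by (simp add: F2_def \<omega>in)
    show "F y = 0 \<and> F1 b y = 0 \<and> F2 b y = 0" if "R' \<le> norm y" for b y
      using that by (simp add: F_def F1_def F2_def \<omega>out)
  qed
qed

text \<open>Green's identity for the cut-off function and the truncated kernel. The Laplacian \<open>W\<close> of the cut-off
  function lives in an annulus that has distance at least \<open>\<delta>\<close> from \<open>x\<close>, where the truncation is not
  visible; therefore the left-hand side does not depend on \<open>\<delta>\<close>.\<close>
lemma newton_potential_identity:
  fixes u :: "'a::euclidean_space \<Rightarrow> complex"
  assumes u: "harmonic_on (ball 0 1) u" and R: "0 < R" "R < R'" "R' < 1"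
  obtains W :: "'a \<Rightarrow> complex" where "continuous_on UNIV W" 
    "\<And>y. norm y \<le> R \<or> R' \<le> norm y \<Longrightarrow> W y = 0"
    "\<And>x \<delta>. 0 < \<delta> \<Longrightarrow> norm x + \<delta> \<le> R \<Longrightarrow>
       (LINT y|lborel. newton_profile DIM('a) ((norm (y - x))\<^sup>2) *\<^sub>R W y) =
       (real (DIM('a) * (DIM('a) + 2)) / \<delta> ^ DIM('a)) *\<^sub>R
         (LINT y|lborel. bump ((1 / \<delta>) *\<^sub>R (y - x)) *\<^sub>R u y)"
proof -
  obtain F F1 F2 where C2F: "pure_C2_on UNIV F F1 F2" and Fin: "\<And>y. norm y \<le> R \<Longrightarrow> F y = u y"
    and F2in: "\<And>y. norm y \<le> R \<Longrightarrow> (\<Sum>b\<in>Basis. F2 b y) = 0"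
    and Fout: "\<And>b y. R' \<le> norm y \<Longrightarrow> F y = 0 \<and> F1 b y = 0 \<and> F2 b y = 0"
    using harmonic_cutoff[OF assms] by blast
  define W where "W y = (\<Sum>b\<in>Basis. F2 b y)" for y
  show thesis
  proof (rule that[of W])
    show "continuous_on UNIV W" unfolding W_def using pure_C2_onD(3)[OF C2F] by (intro continuous_intros)
    show W0: "W y = 0" if "norm y \<le> R \<or> R' \<le> norm y" for y
      using that F2in Fout by (auto simp: W_def)
    fix x :: 'a and \<delta> :: real
    assume \<delta>: "0 < \<delta>" "norm x + \<delta> \<le> R"
    obtain \<psi> \<psi>1 \<psi>2 where \<psi>: "pure_C2_on UNIV \<psi> \<psi>1 \<psi>2"
      "\<And>y. \<delta> \<le> norm (y - x) \<Longrightarrow> \<psi> y = newton_profile DIM('a) ((norm (y - x))\<^sup>2)"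
      "\<And>y. (\<Sum>b\<in>Basis. \<psi>2 b y) = 
         real (DIM('a) * (DIM('a) + 2)) / \<delta> ^ DIM('a) * bump ((1 / \<delta>) *\<^sub>R (y - x))"
      using truncated_newton_kernel[OF \<delta>(1), of x] by blast
    have far: "\<delta> \<le> norm (y - x)" if "\<not> norm y \<le> R" for y
      using that \<delta>(2) norm_triangle_ineq2[of y x] by linarith
    have "(LINT y|lborel. newton_profile DIM('a) ((norm (y - x))\<^sup>2) *\<^sub>R W y) = (LINT y|lborel. \<psi> y *\<^sub>R W y)"
    proof (rule Bochner_Integration.integral_cong[OF refl])
      fix y
      show "newton_profile DIM('a) ((norm (y - x))\<^sup>2) *\<^sub>R W y = \<psi> y *\<^sub>R W y"
        by (cases "norm y \<le> R") (use W0[of y] \<psi>(2)[OF far, of y] in auto)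
    qed
    also have "\<dots> = (LINT y|lborel. (\<Sum>b\<in>Basis. \<psi>2 b y) *\<^sub>R F y)"
      unfolding W_def
      by (rule green_identity[OF C2F \<psi>(1), of "cball 0 R'"]) (auto simp: Fout)
    also have "\<dots> = (LINT y|lborel. (real (DIM('a) * (DIM('a) + 2)) / \<delta> ^ DIM('a)) *\<^sub>R 
        (bump ((1 / \<delta>) *\<^sub>R (y - x)) *\<^sub>R u y))"
    proof (rule Bochner_Integration.integral_cong[OF refl])
      fix y
      have "bump ((1 / \<delta>) *\<^sub>R (y - x)) *\<^sub>R F y = bump ((1 / \<delta>) *\<^sub>R (y - x)) *\<^sub>R u y"
      proof (cases "norm y \<le> R")
        case False
        then have "bump ((1 / \<delta>) *\<^sub>R (y - x)) = 0" 
          using far[of y] \<delta> by (intro bump_scaled_eq_0) (simp_all add: dist_norm norm_minus_commute)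
        then show ?thesis by simp
      qed (simp add: Fin)
      then show "(\<Sum>b\<in>Basis. \<psi>2 b y) *\<^sub>R F y = (real (DIM('a) * (DIM('a) + 2)) / \<delta> ^ DIM('a)) *\<^sub>R 
        (bump ((1 / \<delta>) *\<^sub>R (y - x)) *\<^sub>R u y)"
        unfolding \<psi>(3) by (metis scaleR_scaleR)
    qed
    also have "\<dots> = (real (DIM('a) * (DIM('a) + 2)) / \<delta> ^ DIM('a)) *\<^sub>R
         (LINT y|lborel. bump ((1 / \<delta>) *\<^sub>R (y - x)) *\<^sub>R u y)" 
      by (rule integral_scaleR_right)
    finally show "(LINT y|lborel. newton_profile DIM('a) ((norm (y - x))\<^sup>2) *\<^sub>R W y) =
       (real (DIM('a) * (DIM('a) + 2)) / \<delta> ^ DIM('a)) *\<^sub>R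
         (LINT y|lborel. bump ((1 / \<delta>) *\<^sub>R (y - x)) *\<^sub>R u y)" .
  qed
qed

text \<open>The potential of \<open>W\<close> at \<open>x\<close> is a weighted mean of \<open>u\<close> over balls of every small radius. Letting the radius
  tend to zero shows that it is a multiple of \<open>u(x)\<close>, and then the means themselves are known.\<close>
lemma newton_representation_and_mean_value:
  fixes u :: "'a::euclidean_space \<Rightarrow> complex"
  assumes u: "harmonic_on (ball 0 1) u" and R: "0 < R" "R < R'" "R' < 1"
  obtains W :: "'a \<Rightarrow> complex" where "continuous_on UNIV W" 
    "\<And>y. norm y \<le> R \<or> R' \<le> norm y \<Longrightarrow> W y = 0"
    "\<And>x. norm x < R \<Longrightarrow> (LINT y|lborel. newton_profile DIM('a) ((norm (y - x))\<^sup>2) *\<^sub>R W y) =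
       (real (DIM('a) * (DIM('a) + 2)) * bump_mass TYPE('a)) *\<^sub>R u x"
    "\<And>x \<delta>. 0 < \<delta> \<Longrightarrow> norm x + \<delta> \<le> R \<Longrightarrow>
       (LINT y|lborel. bump ((1 / \<delta>) *\<^sub>R (y - x)) *\<^sub>R u y) = (\<delta> ^ DIM('a) * bump_mass TYPE('a)) *\<^sub>R u x"
proof -
  obtain W :: "'a \<Rightarrow> complex" where W: "continuous_on UNIV W" 
    "\<And>y. norm y \<le> R \<or> R' \<le> norm y \<Longrightarrow> W y = 0"
    "\<And>x \<delta>. 0 < \<delta> \<Longrightarrow> norm x + \<delta> \<le> R \<Longrightarrow>
       (LINT y|lborel. newton_profile DIM('a) ((norm (y - x))\<^sup>2) *\<^sub>R W y) =
       (real (DIM('a) * (DIM('a) + 2)) / \<delta> ^ DIM('a)) *\<^sub>R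
         (LINT y|lborel. bump ((1 / \<delta>) *\<^sub>R (y - x)) *\<^sub>R u y)"
    using newton_potential_identity[OF assms] by blast
  define N where "N x = (LINT y|lborel. newton_profile DIM('a) ((norm (y - x))\<^sup>2) *\<^sub>R W y)" for x
  have cu: "continuous_on (ball 0 1) u"
    by (rule harmonic_on_imp_pure_C2_on[OF u]) (rule pure_C2_onD)
  define n where "n = real (DIM('a) * (DIM('a) + 2))"
  have n: "n > 0" by (simp only: n_def of_nat_0_less_iff) (simp add: DIM_positive)
  have sub: "cball x \<delta> \<subseteq> ball 0 1" if "norm x + \<delta> \<le> R" for x :: 'a and \<delta>
    using that R by (intro cball_subset_unit_ball) auto
  have scaled: "N x = n *\<^sub>R (LINT z|lborel. bump z *\<^sub>R u (x + \<delta> *\<^sub>R z))"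
    if "0 < \<delta>" "norm x + \<delta> \<le> R" for x \<delta>
  proof -
    have c: "continuous_on UNIV (\<lambda>y. bump ((1 / \<delta>) *\<^sub>R (y - x)) *\<^sub>R u y)"
      by (rule integrable_bump_scaleR(2)[OF cu _ that(1) sub[OF that(2)]]) simp
    have "(LINT y|lborel. bump ((1 / \<delta>) *\<^sub>R (y - x)) *\<^sub>R u y) = 
       \<delta> ^ DIM('a) *\<^sub>R (LINT z|lborel. bump ((1 / \<delta>) *\<^sub>R (x + \<delta> *\<^sub>R z - x)) *\<^sub>R u (x + \<delta> *\<^sub>R z))"
      by (rule integral_affine[OF borel_measurable_continuous_onI[OF c] that(1)])
    then show ?thesis using W(3)[OF that] that by (simp add: N_def n_def)
  qed
  have lim: "N x = (n * bump_mass TYPE('a)) *\<^sub>R u x" if "norm x < R" for x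
  proof -
    define \<delta> where "\<delta> = R - norm x"
    have \<delta>: "\<delta> > 0" "norm x + \<delta> \<le> R" using that by (auto simp: \<delta>_def)
    have dj: "0 < \<delta> / real (Suc j)" "\<delta> / real (Suc j) \<le> \<delta>" for j
      using \<delta> by (auto simp: divide_le_eq mult_le_cancel_left1)
    have "(\<lambda>j. LINT z|lborel. bump z *\<^sub>R u (x + (\<delta> / real (Suc j)) *\<^sub>R z)) \<longlonglongrightarrow> (LINT z|lborel. bump (z::'a)) *\<^sub>R u x"
      by (rule weighted_mean_tendsto[OF cu _ sub[OF \<delta>(2)] \<delta>(1)]) (auto intro: bump_eq_0 continuous_intros)
    then have "(\<lambda>j. n *\<^sub>R (LINT z|lborel. bump z *\<^sub>R u (x + (\<delta> / real (Suc j)) *\<^sub>R z))) \<longlonglongrightarrow> n *\<^sub>R ((LINT z|lborel. bump (z::'a)) *\<^sub>R u x)"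
      by (intro tendsto_intros)
    moreover have "n *\<^sub>R (LINT z|lborel. bump z *\<^sub>R u (x + (\<delta> / real (Suc j)) *\<^sub>R z)) = N x" for j
      using scaled[of "\<delta> / real (Suc j)" x] dj[of j] \<delta> by simp
    ultimately show ?thesis using LIMSEQ_unique[OF tendsto_const] by (simp add: bump_mass_def)
  qed
  show thesis
  proof (rule that[OF W(1,2)])
    show "(LINT y|lborel. newton_profile DIM('a) ((norm (y - x))\<^sup>2) *\<^sub>R W y) =
       (real (DIM('a) * (DIM('a) + 2)) * bump_mass TYPE('a)) *\<^sub>R u x" if "norm x < R" for x
      using lim[OF that] by (simp add: N_def n_def)
    fix x :: 'a and \<delta> :: real
    assume d: "0 < \<delta>" "norm x + \<delta> \<le> R"
    then have "(n / \<delta> ^ DIM('a)) *\<^sub>R (LINT y|lborel. bump ((1 / \<delta>) *\<^sub>R (y - x)) *\<^sub>R u y) = (n * bump_mass TYPE('a)) *\<^sub>R u x"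
      using W(3)[OF d] lim[of x] by (simp add: N_def n_def)
    then have "(\<delta> ^ DIM('a) / n) *\<^sub>R (n / \<delta> ^ DIM('a)) *\<^sub>R (LINT y|lborel. bump ((1 / \<delta>) *\<^sub>R (y - x)) *\<^sub>R u y) 
      = (\<delta> ^ DIM('a) / n) *\<^sub>R (n * bump_mass TYPE('a)) *\<^sub>R u x"
      by simp
    then show "(LINT y|lborel. bump ((1 / \<delta>) *\<^sub>R (y - x)) *\<^sub>R u y) = (\<delta> ^ DIM('a) * bump_mass TYPE('a)) *\<^sub>R u x"
      using n d by simp
  qed auto
qed

section \<open>The power series of the Newtonian kernel along a ray\<close>

text \<open>The coefficients (up to scaling, Gegenbauer polynomials) of the power series in \<open>r\<close> of \<open>Q\<close> to the power \<open>-n/2\<close>, where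
  \<open>Q = c - 2 b r + a r\<^sup>2\<close>. This power \<open>H\<close> satisfies \<open>Q H' = -(n/2) Q' H\<close>, which is the recursion.\<close>
fun power_profile_coeff :: "nat \<Rightarrow> real \<Rightarrow> real \<Rightarrow> real \<Rightarrow> nat \<Rightarrow> real" where
  "power_profile_coeff n a b c 0 = c powr (- real n / 2)"
| "power_profile_coeff n a b c (Suc 0) = real n * b / c * power_profile_coeff n a b c 0"
| "power_profile_coeff n a b c (Suc (Suc k)) =
     ((2 * (real k + 1) + real n) * b * power_profile_coeff n a b c (Suc k)
      - (real k + real n) * a * power_profile_coeff n a b c k) / (c * (real k + 2))"

text \<open>The coefficients of \<open>F = g(Q)\<close> for the Newtonian profile \<open>g\<close> and the same \<open>Q\<close>, obtained from \<open>F' = H Q'\<close>.\<close>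
fun newton_coeff :: "nat \<Rightarrow> real \<Rightarrow> real \<Rightarrow> real \<Rightarrow> nat \<Rightarrow> real" where
  "newton_coeff n a b c 0 = newton_profile n c"
| "newton_coeff n a b c (Suc 0) = - 2 * b * power_profile_coeff n a b c 0"
| "newton_coeff n a b c (Suc (Suc k)) =
     (2 * a * power_profile_coeff n a b c k - 2 * b * power_profile_coeff n a b c (Suc k)) / (real k + 2)"

definition newton_profile_complex :: "nat \<Rightarrow> complex \<Rightarrow> complex" where
  "newton_profile_complex n z = 
     (if n = 2 then Ln z else z powr of_real (1 - n / 2) / of_real (1 - n / 2))"

lemma newton_profile_complex_of_real:
  "s > 0 \<Longrightarrow> newton_profile_complex n (of_real s) = of_real (newton_profile n s)"
  unfolding newton_profile_complex_def newton_profile_def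
  using powr_of_real[of s "1 - real n / 2"] by (simp add: Ln_of_real)

lemma has_derivative_newton_profile_complex:
  assumes "z \<notin> \<real>\<^sub>\<le>\<^sub>0"
  shows "(newton_profile_complex n has_field_derivative z powr of_real (- real n / 2)) (at z)"
proof (cases "n = 2")
  case True
  have "newton_profile_complex 2 = Ln" by (simp add: newton_profile_complex_def fun_eq_iff)
  moreover have "z \<noteq> 0" using assms by auto
  ultimately show ?thesis using has_field_derivative_Ln[OF assms] 
    by (simp add: True powr_minus)
next
  case False
  then have n: "1 - real n / 2 \<noteq> 0" by auto
  have "((\<lambda>z. z powr of_real (1 - n / 2) / of_real (1 - n / 2)) has_field_derivative
      (of_real (1 - n / 2) * z powr (of_real (1 - n / 2) - 1)) / of_real (1 - n / 2)) (at z)"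
    by (intro DERIV_cdivide has_field_derivative_powr assms)
  moreover have "of_real (1 - n / 2) \<noteq> (0::complex)" using n of_real_eq_0_iff by blast
  moreover have "newton_profile_complex n = (\<lambda>z. z powr of_real (1 - n / 2) / of_real (1 - n / 2))"
    using False by (simp add: newton_profile_complex_def fun_eq_iff)
  ultimately show ?thesis by simp
qed

lemma norm_diff_scaleR_square:
  fixes x y :: "'a::real_inner"
  shows "(norm (y - r *\<^sub>R x))\<^sup>2 = (norm y)\<^sup>2 - 2 * (x \<bullet> y) * r + (norm x)\<^sup>2 * r\<^sup>2"
  unfolding power2_norm_eq_inner
  by (simp add: inner_diff_left inner_diff_right inner_commute power2_eq_square algebra_simps)

text \<open>The squared distance from \<open>y\<close> to \<open>r x\<close>, extended from real to complex \<open>r\<close>.\<close>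
definition complex_dist_square :: "'a::real_inner \<Rightarrow> 'a \<Rightarrow> complex \<Rightarrow> complex" where
  "complex_dist_square x y r = 
     of_real ((norm y)\<^sup>2) - of_real (2 * (x \<bullet> y)) * r + of_real ((norm x)\<^sup>2) * r\<^sup>2"

lemma complex_dist_square_of_real:
  "complex_dist_square x y (of_real r) = of_real ((norm (y - r *\<^sub>R x))\<^sup>2)"
  unfolding complex_dist_square_def norm_diff_scaleR_square by simp

text \<open>If the value is real, then \<open>r\<close> is real or \<open>x \<bullet> y = |x|\<^sup>2 Re r\<close>. The value is \<open>|y - r x|\<^sup>2\<close> in the first case and
  \<open>|y|\<^sup>2 - |x|\<^sup>2 |r|\<^sup>2\<close> in the second one, and both are positive. So the principal branches of the logarithm
  and of the powers can be composed with this function.\<close>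
lemma complex_dist_square_notin_nonpos_Reals:
  assumes x: "norm x \<le> 1" and r: "cmod r < norm y"
  shows "complex_dist_square x y r \<notin> \<real>\<^sub>\<le>\<^sub>0"
proof
  assume "complex_dist_square x y r \<in> \<real>\<^sub>\<le>\<^sub>0"
  then have re: "Re (complex_dist_square x y r) \<le> 0" and im: "Im (complex_dist_square x y r) = 0"
    by (auto simp: complex_nonpos_Reals_iff)
  define \<alpha> \<beta> where "\<alpha> = Re r" and "\<beta> = Im r"
  have r2: "\<alpha>\<^sup>2 + \<beta>\<^sup>2 < (norm y)\<^sup>2"
    using power_strict_mono[OF r, of 2] by (simp add: cmod_power2 \<alpha>_def \<beta>_def)
  have re': "(norm y)\<^sup>2 - 2 * (x \<bullet> y) * \<alpha> + (norm x)\<^sup>2 * (\<alpha>\<^sup>2 - \<beta>\<^sup>2) \<le> 0"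
    using re by (simp add: complex_dist_square_def \<alpha>_def \<beta>_def Re_power2)
  have im': "\<beta> * (x \<bullet> y - (norm x)\<^sup>2 * \<alpha>) = 0"
    using im by (auto simp: complex_dist_square_def \<alpha>_def \<beta>_def Im_power2 algebra_simps)
  show False
  proof (cases "\<beta> = 0")
    case True
    then have "(norm (y - \<alpha> *\<^sub>R x))\<^sup>2 \<le> 0" unfolding norm_diff_scaleR_square using re' by simp
    then have "norm y = \<bar>\<alpha>\<bar> * norm x" by simp
    also have "\<dots> \<le> \<bar>\<alpha>\<bar> * 1" using x by (intro mult_left_mono) auto
    also have "\<dots> \<le> cmod r" unfolding \<alpha>_def using abs_Re_le_cmod by simp
    finally show False using r by simp
  next
    case False
    then have b: "x \<bullet> y = (norm x)\<^sup>2 * \<alpha>" using im' by simp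
    have "(norm x)\<^sup>2 * (\<alpha>\<^sup>2 + \<beta>\<^sup>2) \<le> 1 * (\<alpha>\<^sup>2 + \<beta>\<^sup>2)"
      using x by (intro mult_right_mono) (auto simp: power_le_one)
    then show False using re' r2 by (simp add: b power2_eq_square algebra_simps)
  qed
qed

lemma fps_nth_quadratic_mult:
  fixes g :: "'a::comm_ring_1 fps"
  shows "fps_nth ((fps_const A - fps_const B * fps_X + fps_const D * fps_X ^ 2) * g) k =
    A * fps_nth g k - B * (if k = 0 then 0 else fps_nth g (k - 1)) + D * (if k < 2 then 0 else fps_nth g (k - 2))"
  by (simp add: ring_distribs mult.assoc fps_X_power_mult_nth)

lemma fps_nth_linear_mult:
  fixes g :: "'a::comm_ring_1 fps"
  shows "fps_nth ((fps_const A + fps_const B * fps_X) * g) k =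
    A * fps_nth g k + B * (if k = 0 then 0 else fps_nth g (k - 1))"
  by (simp add: ring_distribs mult.assoc)

text \<open>Comparison of coefficients in \<open>Q H' = -(n/2) Q' H\<close> and \<open>F' = H Q'\<close>.\<close>
lemma recursion_imp_fps_nth:
  fixes h q f :: "complex fps"
  assumes q: "q = fps_const (of_real c) - fps_const (of_real (2 * b)) * fps_X + fps_const (of_real a) * fps_X ^ 2"
    and c: "c \<noteq> 0"
    and h0: "fps_nth h 0 = of_real (c powr (- real n / 2))"
    and hq: "q * fps_deriv h = fps_const (of_real (- real n / 2)) * fps_deriv q * h"
    and f0: "fps_nth f 0 = of_real (newton_profile n c)"
    and fq: "fps_deriv f = h * fps_deriv q"
  shows "fps_nth h k = of_real (power_profile_coeff n a b c k)"
    and "fps_nth f k = of_real (newton_coeff n a b c k)"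
proof -
  have q': "fps_deriv q = fps_const (of_real (- 2 * b)) + fps_const (of_real (2 * a)) * fps_X"
    unfolding q by (rule fps_ext) (auto simp: fps_X_nth fps_X_power_nth)
  have 1: "of_real c * fps_nth (fps_deriv h) k - of_real (2 * b) * (if k = 0 then 0 else fps_nth (fps_deriv h) (k - 1))
     + of_real a * (if k < 2 then 0 else fps_nth (fps_deriv h) (k - 2)) = 
     of_real (- real n / 2) * (of_real (- 2 * b) * fps_nth h k + of_real (2 * a) * (if k = 0 then 0 else fps_nth h (k - 1)))" for k
    using arg_cong[OF hq, of "\<lambda>F. fps_nth F k"]
    unfolding mult.assoc q' unfolding q fps_nth_quadratic_mult fps_mult_left_const_nth fps_nth_linear_mult .
  have 2: "fps_nth (fps_deriv f) k = of_real (- 2 * b) * fps_nth h k + of_real (2 * a) * (if k = 0 then 0 else fps_nth h (k - 1))" for k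
    unfolding fq q' mult.commute[of h] fps_nth_linear_mult ..
  have rec0: "of_real c * fps_nth h (Suc 0) = of_real (n * b) * fps_nth h 0"
    using 1[of 0] by simp
  have rec: "of_real c * (of_nat k + 2) * fps_nth h (Suc (Suc k)) = 
     (2 * (of_nat k + 1) + of_nat n) * of_real b * fps_nth h (Suc k) - (of_nat k + of_nat n) * of_real a * fps_nth h k" for k
  proof (cases k)
    case 0 then show ?thesis using 1[of "Suc k"] by (simp add: algebra_simps)
  next
    case (Suc j)
    then show ?thesis using 1[of "Suc k"] by (simp add: algebra_simps)
  qed
  show H: "fps_nth h k = of_real (power_profile_coeff n a b c k)" for k
  proof (induction k rule: less_induct)
    case (less k)
    show ?case
    proof (cases k)
      case 0
      then show ?thesis using h0 by simp
    next
      case k: (Suc j)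
      show ?thesis
      proof (cases j)
        case 0
        then show ?thesis using k rec0 h0 c by (simp add: field_simps)
      next
        case (Suc i)
        have i: "of_nat i + 2 \<noteq> (0::complex)" using of_nat_eq_0_iff[of "i + 2", where 'a=complex] by (simp add: add.commute)
        have "of_real c * (of_nat i + 2) * fps_nth h (Suc (Suc i)) = 
          of_real ((2 * (real i + 1) + real n) * b * power_profile_coeff n a b c (Suc i)
           - (real i + real n) * a * power_profile_coeff n a b c i)"
          unfolding rec using less[of i] less[of j] k Suc by simp
        also have "\<dots> = of_real (c * (real i + 2) * power_profile_coeff n a b c k)"
          using k Suc c by simp
        also have "\<dots> = of_real c * (of_nat i + 2) * of_real (power_profile_coeff n a b c k)" by simp
        finally show ?thesis using k Suc c i by (simp del: power_profile_coeff.simps)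
      qed
    qed
  qed
  show "fps_nth f k = of_real (newton_coeff n a b c k)"
  proof (cases k)
    case 0 then show ?thesis using f0 by simp
  next
    case (Suc j)
    show ?thesis
    proof (cases j)
      case 0
      then show ?thesis using 2[of 0] Suc H by simp
    next
      case (Suc i)
      have "fps_nth f k * of_nat k = of_real (- 2 * b) * fps_nth h j + of_real (2 * a) * fps_nth h i"
        using 2[of j] \<open>k = Suc j\<close> Suc by (simp add: mult.commute)
      moreover have "of_nat k \<noteq> (0::complex)" unfolding \<open>k = Suc j\<close> by (rule of_nat_neq_0)
      ultimately have "fps_nth f k = (of_real (- 2 * b) * fps_nth h j + of_real (2 * a) * fps_nth h i) / of_nat k"
        by (simp add: field_simps)
      then show ?thesis using \<open>k = Suc j\<close> Suc H by (simp add: add.commute)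
    qed
  qed
qed

lemma newton_profile_power_series:
  fixes x y :: "'a::euclidean_space" and n :: nat
  assumes x: "norm x \<le> 1" and y: "R \<le> norm y" and R: "0 < R"
  defines "F \<equiv> \<lambda>r. newton_profile_complex n (complex_dist_square x y r)"
  shows "F holomorphic_on ball 0 R"
    and "(deriv ^^ k) F 0 / fact k = of_real (newton_coeff n ((norm x)\<^sup>2) (x \<bullet> y) ((norm y)\<^sup>2) k)"
proof -
  define Q where "Q = complex_dist_square x y"
  \<comment> \<open>the derivative of \<open>Q\<close>\<close>
  define Q' where "Q' r = - of_real (2 * (x \<bullet> y)) + of_real (2 * (norm x)\<^sup>2) * r" for r :: complex
  define s where "s = complex_of_real (- real n / 2)"
  define H where "H r = Q r powr s" for r
  have Qn: "Q r \<notin> \<real>\<^sub>\<le>\<^sub>0" if "r \<in> ball 0 R" for r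
    unfolding Q_def using that y by (intro complex_dist_square_notin_nonpos_Reals x) auto
  have dQ: "(Q has_field_derivative Q' r) (at r)" for r
    unfolding Q_def complex_dist_square_def Q'_def by (auto intro!: derivative_eq_intros)
  have dF: "(F has_field_derivative H r * Q' r) (at r)" if "r \<in> ball 0 R" for r
    unfolding F_def H_def s_def Q_def[symmetric]
    by (rule DERIV_chain2[OF has_derivative_newton_profile_complex[OF Qn[OF that]] dQ])
  have dH: "(H has_field_derivative s * Q r powr (s - 1) * Q' r) (at r)" if "r \<in> ball 0 R" for r
    unfolding H_def by (rule DERIV_chain2[OF has_field_derivative_powr[OF Qn[OF that]] dQ])
  show holF: "F holomorphic_on ball 0 R"
    using dF field_differentiable_def holomorphic_onI field_differentiable_at_within by metis
  have holH: "H holomorphic_on ball 0 R"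
    using dH field_differentiable_def holomorphic_onI field_differentiable_at_within by metis
  define q where "q = fps_const (of_real ((norm y)\<^sup>2)) - fps_const (of_real (2 * (x \<bullet> y))) * fps_X 
     + fps_const (complex_of_real ((norm x)\<^sup>2)) * fps_X ^ 2"
  have eQ: "Q has_fps_expansion q"
    unfolding Q_def complex_dist_square_def q_def by (intro fps_expansion_intros)
  have eF: "F has_fps_expansion fps_expansion F 0" and eH: "H has_fps_expansion fps_expansion H 0"
    using holF holH R by (auto intro!: has_fps_expansion_fps_expansion[of "ball 0 R"])
  have ev: "eventually (\<lambda>r. r \<in> ball 0 R) (nhds (0::complex))" 
    using R by (intro eventually_nhds_in_open) auto
  have "eventually (\<lambda>r. Q r * deriv H r = s * deriv Q r * H r) (nhds 0)"
    using ev
  proof eventually_elim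
    case (elim r)
    have "Q r \<noteq> 0" using Qn[OF elim] by auto
    then have "Q r powr s = Q r * Q r powr (s - 1)" by (simp add: powr_diff)
    then show ?case using DERIV_imp_deriv[OF dH[OF elim]] DERIV_imp_deriv[OF dQ] by (simp add: H_def)
  qed
  from has_fps_expansion_cong[OF this refl, THEN iffD1, OF has_fps_expansion_mult[OF eQ has_fps_expansion_deriv[OF eH]]]
  have "(\<lambda>r. s * deriv Q r * H r) has_fps_expansion q * fps_deriv (fps_expansion H 0)" .
  moreover have "(\<lambda>r. s * deriv Q r * H r) has_fps_expansion fps_const s * fps_deriv q * fps_expansion H 0"
    by (intro fps_expansion_intros eQ eH)
  ultimately have hq: "q * fps_deriv (fps_expansion H 0) = fps_const s * fps_deriv q * fps_expansion H 0"
    by (rule fps_expansion_unique_complex)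
  have "eventually (\<lambda>r. H r * deriv Q r = deriv F r) (nhds 0)"
    using ev
  proof eventually_elim
    case (elim r)
    then show ?case using DERIV_imp_deriv[OF dF[OF elim]] DERIV_imp_deriv[OF dQ] by simp
  qed
  from has_fps_expansion_cong[OF this refl, THEN iffD1, OF has_fps_expansion_mult[OF eH has_fps_expansion_deriv[OF eQ]]]
  have "deriv F has_fps_expansion fps_expansion H 0 * fps_deriv q" .
  then have fq: "fps_deriv (fps_expansion F 0) = fps_expansion H 0 * fps_deriv q"
    using fps_expansion_unique_complex[OF has_fps_expansion_deriv[OF eF]] by blast
  have y0: "(norm y)\<^sup>2 > 0" using y R by auto
  have Q0: "Q 0 = of_real ((norm y)\<^sup>2)" by (simp add: Q_def complex_dist_square_def)
  have "fps_nth (fps_expansion F 0) k = of_real (newton_coeff n ((norm x)\<^sup>2) (x \<bullet> y) ((norm y)\<^sup>2) k)"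
  proof (rule recursion_imp_fps_nth(2)[OF q_def _ _ _ _ fq])
    show "fps_nth (fps_expansion H 0) 0 = of_real (((norm y)\<^sup>2) powr (- real n / 2))"
      using has_fps_expansion_imp_0_eq_fps_nth_0[OF eH, symmetric] powr_of_real[of "(norm y)\<^sup>2" "- real n / 2"] 
      by (simp add: H_def Q0 s_def)
    show "fps_nth (fps_expansion F 0) 0 = of_real (newton_profile n ((norm y)\<^sup>2))"
      using has_fps_expansion_imp_0_eq_fps_nth_0[OF eF, symmetric] newton_profile_complex_of_real[OF y0] Q0
      by (simp add: F_def Q_def)
    show "q * fps_deriv (fps_expansion H 0) = fps_const (of_real (- real n / 2)) * fps_deriv q * fps_expansion H 0"
      using hq by (simp add: s_def)
  qed (use y0 in auto)
  then show "(deriv ^^ k) F 0 / fact k = of_real (newton_coeff n ((norm x)\<^sup>2) (x \<bullet> y) ((norm y)\<^sup>2) k)"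
    by (simp add: fps_expansion_def)
qed

text \<open>Cauchy's inequality on the circle of radius \<open>\<rho>\<close>; the constant is uniform because the complexified
  kernel is continuous on a compact set of triples \<open>(r, x, y)\<close>.\<close>
lemma newton_coeff_bound:
  assumes R: "0 < \<rho>" "\<rho> < R"
  obtains M where "M > 0" 
    "\<And>(x::'a::euclidean_space) y k. norm x \<le> 1 \<Longrightarrow> R \<le> norm y \<Longrightarrow> norm y \<le> R' \<Longrightarrow>
      \<bar>newton_coeff n ((norm x)\<^sup>2) (x \<bullet> y) ((norm y)\<^sup>2) k\<bar> \<le> M / \<rho> ^ k"
    "\<And>(x::'a::euclidean_space) y r. norm x \<le> 1 \<Longrightarrow> R \<le> norm y \<Longrightarrow> norm y \<le> R' \<Longrightarrow> \<bar>r\<bar> < \<rho> \<Longrightarrow>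
      (\<lambda>k. newton_coeff n ((norm x)\<^sup>2) (x \<bullet> y) ((norm y)\<^sup>2) k * r ^ k) sums 
        newton_profile n ((norm (y - r *\<^sub>R x))\<^sup>2)"
proof -
  define K where "K = cball (0::complex) \<rho> \<times> (cball (0::'a) 1 \<times> (cball (0::'a) R' \<inter> {y. R \<le> norm y}))"
  define G where "G z = newton_profile_complex n (complex_dist_square (fst (snd z)) (snd (snd z)) (fst z))" 
    for z :: "complex \<times> 'a \<times> 'a"
  have "compact K" unfolding K_def
    by (intro compact_Times compact_Int_closed compact_cball closed_Collect_le continuous_intros)
  moreover have "continuous_on K G"
    unfolding G_def
  proof (rule continuous_on_compose2[where t="- \<real>\<^sub>\<le>\<^sub>0" and g="newton_profile_complex n"])
    show "continuous_on (- \<real>\<^sub>\<le>\<^sub>0) (newton_profile_complex n)"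
      by (intro continuous_at_imp_continuous_on ballI DERIV_isCont[OF has_derivative_newton_profile_complex]) auto
    show "continuous_on K (\<lambda>z. complex_dist_square (fst (snd z)) (snd (snd z)) (fst z))"
      unfolding complex_dist_square_def by (intro continuous_intros)
    show "(\<lambda>z. complex_dist_square (fst (snd z)) (snd (snd z)) (fst z)) ` K \<subseteq> - \<real>\<^sub>\<le>\<^sub>0"
    proof (intro image_subsetI)
      fix z assume "z \<in> K"
      then have "norm (fst (snd z)) \<le> 1" "cmod (fst z) < norm (snd (snd z))" using R by (auto simp: K_def)
      then show "complex_dist_square (fst (snd z)) (snd (snd z)) (fst z) \<in> - \<real>\<^sub>\<le>\<^sub>0"
        using complex_dist_square_notin_nonpos_Reals by simp
    qed
  qed
  ultimately have "bounded (G ` K)" by (intro compact_imp_bounded compact_continuous_image)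
  then obtain M0 where "\<forall>z\<in>G ` K. norm z \<le> M0" using bounded_iff by blast
  then have M0: "\<And>z. z \<in> K \<Longrightarrow> cmod (G z) \<le> max 1 M0" by (meson image_eqI le_max_iff_disj)
  show thesis
  proof (rule that[of "max 1 M0"])
    fix x y :: 'a and k
    assume x: "norm x \<le> 1" and y: "R \<le> norm y" "norm y \<le> R'"
    define F where "F = (\<lambda>r. newton_profile_complex n (complex_dist_square x y r))"
    have R0: "0 < R" using R by simp
    have hol: "F holomorphic_on ball 0 R" 
      and co: "(deriv ^^ k) F 0 / fact k = of_real (newton_coeff n ((norm x)\<^sup>2) (x \<bullet> y) ((norm y)\<^sup>2) k)" for k
      unfolding F_def by (rule newton_profile_power_series[OF x y(1) R0])+
    have sub: "cball 0 \<rho> \<subseteq> ball (0::complex) R" using R by auto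
    have "norm ((deriv ^^ k) F 0) \<le> fact k * max 1 M0 / \<rho> ^ k"
    proof (rule Cauchy_inequality)
      show "F holomorphic_on ball 0 \<rho>" using hol R by (auto intro: holomorphic_on_subset)
      show "continuous_on (cball 0 \<rho>) F" 
        using holomorphic_on_imp_continuous_on[OF hol] sub continuous_on_subset by blast
      show "norm (F z) \<le> max 1 M0" if "norm (0 - z) = \<rho>" for z
        using M0[of "(z, x, y)"] that x y by (simp add: G_def F_def K_def)
    qed (use R in auto)
    then have "norm ((deriv ^^ k) F 0 / fact k) \<le> max 1 M0 / \<rho> ^ k"
      using R by (simp add: norm_divide field_simps)
    then show "\<bar>newton_coeff n ((norm x)\<^sup>2) (x \<bullet> y) ((norm y)\<^sup>2) k\<bar> \<le> max 1 M0 / \<rho> ^ k"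
      unfolding co norm_of_real .
    fix r :: real assume r: "\<bar>r\<bar> < \<rho>"
    have "(\<lambda>k. (deriv ^^ k) F 0 / fact k * (of_real r - 0) ^ k) sums F (of_real r)"
      by (rule holomorphic_power_series[OF hol]) (use r R in auto)
    moreover have "F (of_real r) = of_real (newton_profile n ((norm (y - r *\<^sub>R x))\<^sup>2))"
    proof -
      have "\<bar>r\<bar> * norm x \<le> \<bar>r\<bar> * 1" using x by (intro mult_left_mono) auto
      then have "norm (r *\<^sub>R x) < norm y" using r R y by simp
      then have "y - r *\<^sub>R x \<noteq> 0" by auto
      then show ?thesis
        unfolding F_def complex_dist_square_of_real by (intro newton_profile_complex_of_real) simp
    qed
    ultimately have "(\<lambda>k. complex_of_real (newton_coeff n ((norm x)\<^sup>2) (x \<bullet> y) ((norm y)\<^sup>2) k * r ^ k)) sums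
      of_real (newton_profile n ((norm (y - r *\<^sub>R x))\<^sup>2))"
      unfolding co by simp
    then show "(\<lambda>k. newton_coeff n ((norm x)\<^sup>2) (x \<bullet> y) ((norm y)\<^sup>2) k * r ^ k) sums 
        newton_profile n ((norm (y - r *\<^sub>R x))\<^sup>2)"
      by (subst (asm) sums_of_real_iff)
  qed auto
qed

section \<open>The homogeneous expansion of a harmonic function\<close>

text \<open>Integrating such a kernel in \<open>y\<close> against a fixed density leaves a polynomial in \<open>x\<close>. The functions of \<open>y\<close>
  may be singular at the origin, where the densities vanish.\<close>
inductive separated :: "('a::euclidean_space \<Rightarrow> 'a \<Rightarrow> real) \<Rightarrow> bool" where
  product: "real_polynomial_function p \<Longrightarrow> continuous_on (- {0}) h \<Longrightarrow> separated (\<lambda>x y. p x * h y)"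
| add: "separated P \<Longrightarrow> separated P' \<Longrightarrow> separated (\<lambda>x y. P x y + P' x y)"

lemma separated_mult_product:
  assumes "separated P" "real_polynomial_function p" "continuous_on (- {0}) h"
  shows "separated (\<lambda>x y. P x y * (p x * h y))"
  using assms(1)
proof induction
  case (product p' h')
  have "separated (\<lambda>x y. (p' x * p x) * (h' y * h y))"
    using product assms by (intro separated.product continuous_intros) auto
  then show ?case by (simp add: mult_ac)
next
  case (add P P')
  then have "separated (\<lambda>x y. P x y * (p x * h y) + P' x y * (p x * h y))" by (intro separated.add)
  then show ?case by (simp add: distrib_right)
qed

lemma separated_mult:
  assumes "separated P" "separated P'"
  shows "separated (\<lambda>x y. P x y * P' x y)"
  using assms(2)
proof induction
  case (product p h) then show ?case by (rule separated_mult_product[OF assms(1)])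
next
  case (add P1 P2)
  then have "separated (\<lambda>x y. P x y * P1 x y + P x y * P2 x y)" by (intro separated.add)
  then show ?case by (simp add: distrib_left)
qed

lemma separated_fun_left: "real_polynomial_function p \<Longrightarrow> separated (\<lambda>x y. p x)"
  using separated.product[of p "\<lambda>_. 1"] by simp

lemma separated_fun_right: "continuous_on (- {0}) h \<Longrightarrow> separated (\<lambda>x y. h y)"
  using separated.product[of "\<lambda>_. 1" h] by (simp add: real_polynomial_function.intros(2))

lemma separated_sum:
  "finite I \<Longrightarrow> (\<And>i. i \<in> I \<Longrightarrow> separated (P i)) \<Longrightarrow> separated (\<lambda>x y. \<Sum>i\<in>I. P i x y)"
proof (induction I rule: finite_induct)
  case empty
  show ?case using separated_fun_right[of "\<lambda>_. 0"] by simp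
next
  case (insert i I)
  then have "separated (\<lambda>x y. P i x y + (\<Sum>i\<in>I. P i x y))" by (intro separated.add) auto
  then show ?case using insert by simp
qed

lemma separated_inner: "separated (\<lambda>x y::'a::euclidean_space. x \<bullet> y)"
proof -
  have "separated (\<lambda>x y::'a. \<Sum>b\<in>Basis. (x \<bullet> b) * (y \<bullet> b))"
    by (intro separated_sum separated.product finite_Basis continuous_intros real_polynomial_function.intros(1)
        bounded_linear_inner_left)
  moreover have "(\<lambda>x y::'a. \<Sum>b\<in>Basis. (x \<bullet> b) * (y \<bullet> b)) = (\<lambda>x y. x \<bullet> y)"
    by (intro ext) (rule euclidean_inner[symmetric])
  ultimately show ?thesis by simp
qed

lemma separated_norm_square: "separated (\<lambda>x y::'a::euclidean_space. (norm x)\<^sup>2)"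
proof -
  have "real_polynomial_function (\<lambda>x::'a. \<Sum>b\<in>Basis. (x \<bullet> b) * (x \<bullet> b))"
    by (intro real_polynomial_function_sum finite_Basis real_polynomial_function.intros(4) real_polynomial_function.intros(1)
        bounded_linear_inner_left)
  moreover have "(\<lambda>x::'a. \<Sum>b\<in>Basis. (x \<bullet> b) * (x \<bullet> b)) = (\<lambda>x. (norm x)\<^sup>2)"
    by (intro ext) (simp add: power2_norm_eq_inner euclidean_inner[symmetric])
  ultimately show ?thesis using separated_fun_left by metis
qed

lemma separated_diff:
  assumes "separated P" "separated P'"
  shows "separated (\<lambda>x y. P x y - P' x y)"
proof -
  have "separated (\<lambda>x y. P x y + P' x y * (-1))"
    using assms by (intro separated.add separated_mult separated_fun_right continuous_intros)
  then show ?thesis by simp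
qed

lemma separated_power_profile_coeff:
  "separated (\<lambda>x y::'a::euclidean_space. power_profile_coeff n ((norm x)\<^sup>2) (x \<bullet> y) ((norm y)\<^sup>2) k)"
proof (induction k rule: less_induct)
  case (less k)
  show ?case
  proof (cases k)
    case 0
    then show ?thesis by (auto intro!: separated_fun_right continuous_intros)
  next
    case k: (Suc j)
    show ?thesis
    proof (cases j)
      case 0
      have "separated (\<lambda>x y::'a. (x \<bullet> y) * (real n / (norm y)\<^sup>2 * ((norm y)\<^sup>2) powr (- real n / 2)))"
        by (intro separated_mult separated_inner separated_fun_right continuous_intros) auto
      then show ?thesis using k 0 by (simp add: mult_ac)
    next
      case (Suc i)
      let ?h = "\<lambda>k (x::'a) y. power_profile_coeff n ((norm x)\<^sup>2) (x \<bullet> y) ((norm y)\<^sup>2) k"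
      have "separated (\<lambda>x y. ((2 * (real i + 1) + real n) * (x \<bullet> y) * ?h (Suc i) x y - 
          (real i + real n) * (norm x)\<^sup>2 * ?h i x y) * inverse ((norm y)\<^sup>2 * (real i + 2)))"
        by (intro separated_mult separated_diff separated_inner separated_norm_square less)
          (use k Suc in \<open>auto intro!: separated_fun_right continuous_intros\<close>)
      then show ?thesis using k Suc by (simp add: divide_inverse)
    qed
  qed
qed

lemma separated_newton_coeff:
  "separated (\<lambda>x y::'a::euclidean_space. newton_coeff n ((norm x)\<^sup>2) (x \<bullet> y) ((norm y)\<^sup>2) k)"
proof (cases k)
  case 0
  have "continuous_on (- {0::'a}) (\<lambda>y. newton_profile n ((norm y)\<^sup>2))"
    unfolding newton_profile_def by (cases "n = 2") (auto intro!: continuous_intros)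
  then show ?thesis using 0 by (simp add: separated_fun_right)
next
  case k: (Suc j)
  let ?h = "\<lambda>k (x::'a) y. power_profile_coeff n ((norm x)\<^sup>2) (x \<bullet> y) ((norm y)\<^sup>2) k"
  show ?thesis
  proof (cases j)
    case 0
    have "separated (\<lambda>x y. (-2) * (x \<bullet> y) * ?h 0 x y)"
      by (intro separated_mult separated_inner separated_power_profile_coeff)
        (auto intro!: separated_fun_right continuous_intros)
    then show ?thesis using k 0 by simp
  next
    case (Suc i)
    have "separated (\<lambda>x y. (2 * (norm x)\<^sup>2 * ?h i x y - 2 * (x \<bullet> y) * ?h (Suc i) x y) * inverse (real i + 2))"
      by (intro separated_mult separated_diff separated_inner separated_norm_square separated_power_profile_coeff)
        (auto intro!: separated_fun_right continuous_intros)
    then show ?thesis using k Suc by (simp add: divide_inverse)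
  qed
qed

lemma integral_separated:
  fixes W :: "'a::euclidean_space \<Rightarrow> 'b::euclidean_space"
  assumes "separated P" and W: "continuous_on UNIV W" 
    and supp: "\<And>y. norm y \<le> R \<or> R' \<le> norm y \<Longrightarrow> W y = 0" and R: "R > 0"
  shows "integrable lborel (\<lambda>y. P x y *\<^sub>R W y)"
    and "polynomial_function (\<lambda>x. LINT y|lborel. P x y *\<^sub>R W y)"
proof -
  have "(\<forall>x. integrable lborel (\<lambda>y. P x y *\<^sub>R W y)) \<and> polynomial_function (\<lambda>x. LINT y|lborel. P x y *\<^sub>R W y)"
    using assms(1)
  proof induction
    case (product p h)
    let ?K = "cball (0::'a) R' \<inter> {y. R \<le> norm y}"
    have K: "compact ?K" by (intro compact_Int_closed compact_cball closed_Collect_le continuous_intros)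
    have "continuous_on UNIV (\<lambda>y. h y *\<^sub>R W y)"
      by (rule continuous_on_UNIV_extend_zero[where S="- {0}" and K="?K"])
        (use product R supp K in \<open>auto intro!: continuous_intros compact_imp_closed continuous_on_subset[OF W]\<close>)
    then have i: "integrable lborel (\<lambda>y. h y *\<^sub>R W y)"
      by (rule integrable_compact_support[OF _ K]) (use supp in auto)
    have "integrable lborel (\<lambda>y. (p x * h y) *\<^sub>R W y)" for x
      using integrable_scaleR_right[of "p x", OF i] by (simp only: scaleR_scaleR)
    moreover have "(LINT y|lborel. (p x * h y) *\<^sub>R W y) = p x *\<^sub>R (LINT y|lborel. h y *\<^sub>R W y)" for x
      by (subst integral_scaleR_right[symmetric]) simp
    moreover have "polynomial_function p" using product by (simp add: real_polynomial_function_eq)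
    ultimately show ?case by (auto intro!: polynomial_function_mult)
  next
    case (add P P')
    then show ?case by (auto simp: scaleR_add_left)
  qed
  then show "integrable lborel (\<lambda>y. P x y *\<^sub>R W y)"
    "polynomial_function (\<lambda>x. LINT y|lborel. P x y *\<^sub>R W y)" by auto
qed

lemma power_profile_coeff_homogeneous:
  "power_profile_coeff n (t\<^sup>2 * a) (t * b) c k = t ^ k * power_profile_coeff n a b c k"
proof (induction k rule: less_induct)
  case (less k)
  show ?case
  proof (cases k)
    case k: (Suc j)
    show ?thesis
    proof (cases j)
      case (Suc i)
      then show ?thesis using k less[of i] less[of j]
        by (simp add: field_simps power2_eq_square)
    qed (use k in simp)
  qed simp
qed

lemma newton_coeff_homogeneous:
  "newton_coeff n (t\<^sup>2 * a) (t * b) c k = t ^ k * newton_coeff n a b c k"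
proof (cases k)
  case k: (Suc j)
  show ?thesis
  proof (cases j)
    case (Suc i)
    show ?thesis unfolding k Suc newton_coeff.simps power_profile_coeff_homogeneous
      by (simp add: field_simps power2_eq_square del: power_profile_coeff.simps)
  qed (use k in \<open>simp\<close>)
qed simp

text \<open>The Newtonian representation with the power series of the kernel inserted.\<close>
lemma local_homogeneous_expansion:
  fixes u :: "'a::euclidean_space \<Rightarrow> complex"
  assumes u: "harmonic_on (ball 0 1) u" and R: "0 < R" "R < 1"
  obtains U :: "nat \<Rightarrow> 'a \<Rightarrow> complex" where "\<And>k. polynomial_function (U k)" 
    "\<And>k t x. U k (t *\<^sub>R x) = t ^ k *\<^sub>R U k x"
    "\<And>\<rho>. 0 < \<rho> \<Longrightarrow> \<rho> < R \<Longrightarrow> \<exists>M. \<forall>k x. norm x \<le> 1 \<longrightarrow> norm (U k x) \<le> M / \<rho> ^ k"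
    "\<And>x. norm x < R \<Longrightarrow> (\<lambda>k. U k x) sums u x"
proof -
  define R' where "R' = (R + 1) / 2"
  have R': "R < R'" "R' < 1" using R by (auto simp: R'_def)
  define n where "n = DIM('a)"
  define \<kappa> where "\<kappa> = real (n * (n + 2)) * bump_mass TYPE('a)"
  have n: "n > 0" by (simp add: n_def)
  then have "real (n * (n + 2)) > 0" by (simp only: of_nat_0_less_iff) simp
  then have \<kappa>: "\<kappa> > 0" unfolding \<kappa>_def using bump_mass_pos by (intro mult_pos_pos)
  obtain W :: "'a \<Rightarrow> complex" where W: "continuous_on UNIV W" 
    "\<And>y. norm y \<le> R \<or> R' \<le> norm y \<Longrightarrow> W y = 0"
    "\<And>x. norm x < R \<Longrightarrow> (LINT y|lborel. newton_profile n ((norm (y - x))\<^sup>2) *\<^sub>R W y) = \<kappa> *\<^sub>R u x"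
    by (rule newton_representation_and_mean_value[OF u R(1) R', folded n_def, folded \<kappa>_def]) (rule that)
  have iW: "integrable lborel W"
    by (rule integrable_compact_support[OF W(1), of "cball 0 R'"]) (use W(2) in auto)
  define P where "P k x y = newton_coeff n ((norm x)\<^sup>2) (x \<bullet> y) ((norm y)\<^sup>2) k" for k and x y :: 'a
  have sep: "separated (P k)" for k unfolding P_def[abs_def] by (rule separated_newton_coeff)
  have iPW: "integrable lborel (\<lambda>y. P k x y *\<^sub>R W y)" for k x
    by (rule integral_separated(1)[OF sep W(1,2) R(1)]) auto
  have Phom: "P k (t *\<^sub>R x) y = t ^ k * P k x y" for k t x y
    unfolding P_def using newton_coeff_homogeneous[of n t "(norm x)\<^sup>2" "x \<bullet> y"] 
    by (simp add: power_mult_distrib)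
  define U where "U k x = (1 / \<kappa>) *\<^sub>R (LINT y|lborel. P k x y *\<^sub>R W y)" for k x
  have Uhom: "U k (t *\<^sub>R x) = t ^ k *\<^sub>R U k x" for k t x
  proof -
    have "(LINT y|lborel. P k (t *\<^sub>R x) y *\<^sub>R W y) = (LINT y|lborel. t ^ k *\<^sub>R (P k x y *\<^sub>R W y))"
      by (simp add: Phom)
    also have "\<dots> = t ^ k *\<^sub>R (LINT y|lborel. P k x y *\<^sub>R W y)" by (rule integral_scaleR_right)
    finally show ?thesis by (simp add: U_def)
  qed
  have bound: "\<exists>M. \<forall>k x. norm x \<le> 1 \<longrightarrow> norm (U k x) \<le> M / \<rho> ^ k" if \<rho>: "0 < \<rho>" "\<rho> < R" for \<rho>
  proof -
    obtain M where M: "M > 0" 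
      "\<And>(x::'a) y k. norm x \<le> 1 \<Longrightarrow> R \<le> norm y \<Longrightarrow> norm y \<le> R' \<Longrightarrow> \<bar>P k x y\<bar> \<le> M / \<rho> ^ k"
      by (rule newton_coeff_bound[OF \<rho>, of R' n, where 'a='a, folded P_def]) (rule that)
    have "norm (U k x) \<le> ((1 / \<kappa>) * (M * (LINT y|lborel. norm (W y)))) / \<rho> ^ k" if x: "norm x \<le> 1" for k x
    proof -
      have "norm (LINT y|lborel. P k x y *\<^sub>R W y) \<le> (LINT y|lborel. (M / \<rho> ^ k) * norm (W y))"
      proof (rule order_trans[OF integral_norm_bound integral_mono])
        show "norm (P k x y *\<^sub>R W y) \<le> (M / \<rho> ^ k) * norm (W y)" for y
        proof (cases "W y = 0")
          case False
          then have "R \<le> norm y" "norm y \<le> R'" using W(2)[of y] by linarith+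
          then show ?thesis using M(2)[OF x, of y k] by (simp only: norm_scaleR) (intro mult_right_mono, auto)
        qed simp
      qed (use integrable_norm[OF iPW] iPW iW in auto)
      also have "\<dots> = (M / \<rho> ^ k) * (LINT y|lborel. norm (W y))" by simp
      finally show ?thesis using \<kappa> \<rho> by (simp add: U_def field_simps)
    qed
    then show ?thesis by blast
  qed
  have sums1: "(\<lambda>k. r ^ k *\<^sub>R U k x) sums u (r *\<^sub>R x)" if x: "norm x \<le> 1" and r: "0 \<le> r" "r < R" for r x
  proof -
    define \<rho> where "\<rho> = (r + R) / 2"
    have \<rho>: "0 < \<rho>" "\<rho> < R" "r < \<rho>" using r R by (auto simp: \<rho>_def)
    obtain M where M: "M > 0" 
      "\<And>(x::'a) y k. norm x \<le> 1 \<Longrightarrow> R \<le> norm y \<Longrightarrow> norm y \<le> R' \<Longrightarrow> \<bar>P k x y\<bar> \<le> M / \<rho> ^ k"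
      "\<And>(x::'a) y r. norm x \<le> 1 \<Longrightarrow> R \<le> norm y \<Longrightarrow> norm y \<le> R' \<Longrightarrow> \<bar>r\<bar> < \<rho> \<Longrightarrow> 
         (\<lambda>k. P k x y * r ^ k) sums newton_profile n ((norm (y - r *\<^sub>R x))\<^sup>2)"
      by (rule newton_coeff_bound[OF \<rho>(1,2), of R' n, where 'a='a, folded P_def]) (rule that)
    define f where "f k y = (r ^ k * P k x y) *\<^sub>R W y" for k y
    have fb: "norm (f k y) \<le> (M * norm (W y)) * (r / \<rho>) ^ k" for k y
    proof (cases "W y = 0")
      case False
      then have y: "R \<le> norm y" "norm y \<le> R'" using W(2)[of y] by linarith+
      have "norm (f k y) = r ^ k * \<bar>P k x y\<bar> * norm (W y)" using r by (simp add: f_def abs_mult)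
      also have "\<dots> \<le> r ^ k * (M / \<rho> ^ k) * norm (W y)"
        using M(2)[OF x y] r by (intro mult_right_mono mult_left_mono) auto
      finally show ?thesis by (simp add: power_divide mult_ac)
    qed (simp add: f_def)
    have if': "integrable lborel (f k)" for k
    proof -
      have "f k = (\<lambda>y. r ^ k *\<^sub>R (P k x y *\<^sub>R W y))" by (auto simp: f_def)
      then show ?thesis by (simp only:) (rule integrable_scaleR_right, rule iPW)
    qed
    have intf: "(LINT y|lborel. f k y) = \<kappa> *\<^sub>R (r ^ k *\<^sub>R U k x)" for k
    proof -
      have "(LINT y|lborel. f k y) = (LINT y|lborel. r ^ k *\<^sub>R (P k x y *\<^sub>R W y))" by (simp add: f_def)
      also have "\<dots> = r ^ k *\<^sub>R (LINT y|lborel. P k x y *\<^sub>R W y)" by (rule integral_scaleR_right)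
      finally show ?thesis using \<kappa> by (simp add: U_def)
    qed
    have "(\<lambda>k. LINT y|lborel. f k y) sums (LINT y|lborel. (\<Sum>k. f k y))"
      by (rule sums_integral_geometric[OF if' _ fb]) (use iW \<rho> r in auto)
    also have "(LINT y|lborel. (\<Sum>k. f k y)) = (LINT y|lborel. newton_profile n ((norm (y - r *\<^sub>R x))\<^sup>2) *\<^sub>R W y)"
    proof (rule Bochner_Integration.integral_cong[OF refl])
      fix y
      show "(\<Sum>k. f k y) = newton_profile n ((norm (y - r *\<^sub>R x))\<^sup>2) *\<^sub>R W y"
      proof (cases "W y = 0")
        case False
        then have y: "R \<le> norm y" "norm y \<le> R'" using W(2)[of y] by linarith+
        have "(\<lambda>k. (P k x y * r ^ k) *\<^sub>R W y) sums (newton_profile n ((norm (y - r *\<^sub>R x))\<^sup>2) *\<^sub>R W y)"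
          by (rule sums_scaleR_left[OF M(3)[OF x y]]) (use r \<rho> in auto)
        then show ?thesis by (simp add: f_def sums_iff mult.commute)
      qed (simp add: f_def)
    qed
    also have "\<dots> = \<kappa> *\<^sub>R u (r *\<^sub>R x)"
    proof (rule W(3))
      have "norm (r *\<^sub>R x) \<le> r * 1" using x r by (simp add: mult_left_le)
      then show "norm (r *\<^sub>R x) < R" using r by simp
    qed
    finally have "(\<lambda>k. (1 / \<kappa>) *\<^sub>R \<kappa> *\<^sub>R (r ^ k *\<^sub>R U k x)) sums ((1 / \<kappa>) *\<^sub>R \<kappa> *\<^sub>R u (r *\<^sub>R x))"
      unfolding intf by (rule sums_scaleR_right)
    moreover have "(1 / \<kappa>) *\<^sub>R \<kappa> *\<^sub>R z = z" for z :: complex using \<kappa> by simp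
    ultimately show ?thesis by (simp only:)
  qed
  show thesis
  proof (rule that[of U])
    show "polynomial_function (U k)" for k
      unfolding U_def[abs_def]
      by (intro polynomial_function_cmul integral_separated(2)[OF sep W(1,2) R(1)]) auto
    show "(\<lambda>k. U k x) sums u x" if "norm x < R" for x
    proof -
      define r where "r = (norm x + R) / 2"
      have r: "0 < r" "norm x < r" "r < R" using that R by (simp_all add: r_def add_nonneg_pos)
      have "(\<lambda>k. r ^ k *\<^sub>R U k ((1 / r) *\<^sub>R x)) sums u (r *\<^sub>R ((1 / r) *\<^sub>R x))"
        by (rule sums1) (use r in \<open>auto simp: divide_le_eq\<close>)
      moreover have "r ^ k *\<^sub>R U k ((1 / r) *\<^sub>R x) = U k x" for k
        using Uhom[of k r "(1 / r) *\<^sub>R x"] r by simp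
      ultimately show ?thesis using r by simp
    qed
  qed (use Uhom bound in auto)
qed

text \<open>The identity theorem: the zeros in \<open>(0, r0)\<close> accumulate at the centre.\<close>
lemma powser_eq_0_imp_coeff_eq_0:
  fixes a :: "nat \<Rightarrow> complex"
  assumes "0 < r0" and 0: "\<And>r. 0 < r \<Longrightarrow> r < r0 \<Longrightarrow> (\<lambda>k. r ^ k *\<^sub>R a k) sums 0"
  shows "a k = 0"
proof -
  define f where "f z = (\<Sum>k. a k * z ^ k)" for z
  have sm: "(\<lambda>k. a k * z ^ k) sums f z" if z: "z \<in> ball 0 r0" for z
  proof -
    define r where "r = (norm z + r0) / 2"
    have r: "0 < r" "norm z < r" "r < r0" using z assms(1) by (simp_all add: r_def add_nonneg_pos)
    have "summable (\<lambda>k. a k * of_real r ^ k)"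
      using sums_summable[OF 0[OF r(1,3)]] by (simp add: scaleR_conv_of_real mult.commute)
    then have "summable (\<lambda>k. a k * z ^ k)" using powser_inside[of a "of_real r" z] r by auto
    then show ?thesis unfolding f_def by (rule summable_sums)
  qed
  have hol: "f holomorphic_on ball 0 r0"
    by (rule power_series_holomorphic[where a=a]) (use sm in simp)
  have f0: "f z = 0" if "z \<in> ball 0 r0" for z
  proof (rule analytic_continuation[OF hol _ _ _ _ _ _ that, where U="of_real ` {0<..<r0}" and \<xi>=0])
    show "0 islimpt complex_of_real ` {0<..<r0}"
      unfolding islimpt_approachable
    proof (intro allI impI)
      fix e :: real assume "e > 0"
      then have "0 < min e r0 / 2" "min e r0 / 2 < r0" "min e r0 / 2 < e" using assms(1) by (auto simp: min_def)
      then obtain t where "0 < t" "t < r0" "t < e" by blast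
      then show "\<exists>x'\<in>complex_of_real ` {0<..<r0}. x' \<noteq> 0 \<and> dist x' 0 < e"
        by (intro bexI[of _ "of_real t"]) auto
    qed
    show "f z = 0" if z: "z \<in> complex_of_real ` {0<..<r0}" for z
    proof -
      obtain r where r: "z = of_real r" "0 < r" "r < r0" using z by auto
      have "(\<lambda>k. a k * z ^ k) sums 0"
        using 0[OF r(2,3)] r(1) by (simp add: scaleR_conv_of_real mult.commute)
      moreover have "(\<lambda>k. a k * z ^ k) sums f z" using r by (intro sm) auto
      ultimately show ?thesis by (rule sums_unique2[symmetric])
    qed
  qed (use assms in auto)
  have sm0: "(\<lambda>k. a k * (z - 0) ^ k) sums f z" if "norm (z - 0) < r0" for z using sm[of z] that by simp
  show "a k = 0"
  proof (cases k)
    case 0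
    have "f 0 = a 0" unfolding f_def by (rule powser_zero)
    then show ?thesis using f0[of 0] assms 0 by simp
  next
    case (Suc j)
    show ?thesis
    proof (rule ccontr)
      assume "a k \<noteq> 0"
      then obtain s where s: "0 < s" "\<And>z. z \<in> cball 0 s - {0} \<Longrightarrow> f z \<noteq> 0"
        using powser_0_nonzero[OF assms(1) sm0, of k] f0[of 0] assms Suc by auto
      have "f (of_real (min s (r0 / 2))) \<noteq> 0" using s assms by (intro s(2)) auto
      moreover have "f (of_real (min s (r0 / 2))) = 0" using s assms by (intro f0) auto
      ultimately show False by simp
    qed
  qed
qed

text \<open>On the ray through \<open>x\<close> both expansions are power series in the radius.\<close>
lemma homogeneous_expansion_unique:
  fixes U V :: "nat \<Rightarrow> 'a::real_normed_vector \<Rightarrow> complex"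
  assumes U: "\<And>k t x. U k (t *\<^sub>R x) = t ^ k *\<^sub>R U k x" "\<And>x. norm x < R \<Longrightarrow> (\<lambda>k. U k x) sums u x"
    and V: "\<And>k t x. V k (t *\<^sub>R x) = t ^ k *\<^sub>R V k x" "\<And>x. norm x < R \<Longrightarrow> (\<lambda>k. V k x) sums u x"
    and "R > 0"
  shows "U = V"
proof (intro ext)
  fix k and x :: 'a
  define r0 where "r0 = R / (1 + norm x)"
  have p: "1 + norm x > 0" using norm_ge_zero[of x] by linarith
  have r0: "r0 > 0" using assms p by (simp add: r0_def)
  have "U k x - V k x = 0"
  proof (rule powser_eq_0_imp_coeff_eq_0[OF r0, of "\<lambda>k. U k x - V k x"])
    fix r assume r: "0 < r" "r < r0"
    have "norm (r *\<^sub>R x) \<le> r * (1 + norm x)" using r by simp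
    also have "\<dots> < R" using r p by (simp add: r0_def less_divide_eq)
    finally have "(\<lambda>k. U k (r *\<^sub>R x) - V k (r *\<^sub>R x)) sums (u (r *\<^sub>R x) - u (r *\<^sub>R x))"
      by (intro sums_diff U V)
    then show "(\<lambda>k. r ^ k *\<^sub>R (U k x - V k x)) sums 0" by (simp add: U V scaleR_diff_right)
  qed
  then show "U k x = V k x" by simp
qed

text \<open>By uniqueness, the expansions that belong to the different radii \<open>R < 1\<close> coincide.\<close>
lemma unit_ball_homogeneous_expansion:
  fixes u :: "'a::euclidean_space \<Rightarrow> complex"
  assumes u: "harmonic_on (ball 0 1) u"
  obtains U :: "nat \<Rightarrow> 'a \<Rightarrow> complex" where "\<And>k. polynomial_function (U k)" 
    "\<And>k t x. U k (t *\<^sub>R x) = t ^ k *\<^sub>R U k x"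
    "\<And>\<rho>. 0 < \<rho> \<Longrightarrow> \<rho> < 1 \<Longrightarrow> \<exists>M. \<forall>k x. norm (U k x) \<le> M * (norm x / \<rho>) ^ k"
    "\<And>x. norm x < 1 \<Longrightarrow> (\<lambda>k. U k x) sums u x"
proof -
  have half: "0 < (1/2::real)" "1/2 < (1::real)" by auto
  obtain U :: "nat \<Rightarrow> 'a \<Rightarrow> complex" where U: "\<And>k. polynomial_function (U k)" 
    "\<And>k t x. U k (t *\<^sub>R x) = t ^ k *\<^sub>R U k x"
    "\<And>x. norm x < 1/2 \<Longrightarrow> (\<lambda>k. U k x) sums u x"
    by (rule local_homogeneous_expansion[OF u half]) blast
  have any: "(\<forall>\<rho>. 0 < \<rho> \<longrightarrow> \<rho> < R \<longrightarrow> (\<exists>M. \<forall>k x. norm x \<le> 1 \<longrightarrow> norm (U k x) \<le> M / \<rho> ^ k)) \<and>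
     (\<forall>x. norm x < R \<longrightarrow> (\<lambda>k. U k x) sums u x)" if R: "1/2 \<le> R" "R < 1" for R
  proof -
    have "0 < R" using R by simp
    then obtain V :: "nat \<Rightarrow> 'a \<Rightarrow> complex" where V: "\<And>k t x. V k (t *\<^sub>R x) = t ^ k *\<^sub>R V k x"
      "\<And>\<rho>. 0 < \<rho> \<Longrightarrow> \<rho> < R \<Longrightarrow> \<exists>M. \<forall>k x. norm x \<le> 1 \<longrightarrow> norm (V k x) \<le> M / \<rho> ^ k"
      "\<And>x. norm x < R \<Longrightarrow> (\<lambda>k. V k x) sums u x"
      by (rule local_homogeneous_expansion[OF u _ R(2)]) blast
    have "U = V"
      by (rule homogeneous_expansion_unique[where R="1/2" and u=u]) (use U V R in auto)
    then show ?thesis using V by blast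
  qed
  show thesis
  proof (rule that[OF U(1,2)])
    show "(\<lambda>k. U k x) sums u x" if "norm x < 1" for x
      using any[of "max (1/2) ((norm x + 1) / 2)"] that by auto
    show "\<exists>M. \<forall>k x. norm (U k x) \<le> M * (norm x / \<rho>) ^ k" if \<rho>: "0 < \<rho>" "\<rho> < 1" for \<rho>
    proof -
      have "\<exists>M. \<forall>k x. norm x \<le> 1 \<longrightarrow> norm (U k x) \<le> M / \<rho> ^ k"
        using any[of "max (1/2) ((\<rho> + 1) / 2)"] \<rho> by (auto simp: less_max_iff_disj)
      then obtain M where M: "\<And>k x. norm x \<le> 1 \<Longrightarrow> norm (U k x) \<le> M / \<rho> ^ k" by blast
      have "norm (U k x) \<le> M * (norm x / \<rho>) ^ k" for k x
      proof -
        have "U k (norm x *\<^sub>R ((1 / norm x) *\<^sub>R x)) = norm x ^ k *\<^sub>R U k ((1 / norm x) *\<^sub>R x)" by (rule U(2))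
        moreover have "norm x *\<^sub>R ((1 / norm x) *\<^sub>R x) = x" by simp
        ultimately have "norm (U k x) = norm x ^ k * norm (U k ((1 / norm x) *\<^sub>R x))" by simp
        also have "\<dots> \<le> norm x ^ k * (M / \<rho> ^ k)" by (intro mult_left_mono M) auto
        finally show ?thesis by (simp add: power_divide mult.commute)
      qed
      then show ?thesis by blast
    qed
  qed
qed

section \<open>Harmonicity of the homogeneous parts\<close>

lemma real_polynomial_function_derivative:
  fixes p :: "'a::euclidean_space \<Rightarrow> real"
  assumes "real_polynomial_function p"
  shows "\<exists>D. (\<forall>b. real_polynomial_function (D b)) \<and>
     (\<forall>x. (p has_derivative (\<lambda>h. \<Sum>b\<in>Basis. (h \<bullet> b) * D b x)) (at x))"
  using assms
proof (induction rule: real_polynomial_function.induct)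
  case (linear f)
  have "f h = (\<Sum>b\<in>Basis. (h \<bullet> b) * f b)" for h
  proof -
    have "f h = f (\<Sum>b\<in>Basis. (h \<bullet> b) *\<^sub>R b)" by (simp add: euclidean_representation)
    also have "\<dots> = (\<Sum>b\<in>Basis. (h \<bullet> b) * f b)"
      using bounded_linear.linear[OF linear] by (simp add: linear_sum linear_cmul)
    finally show ?thesis .
  qed
  then have e: "f = (\<lambda>h. \<Sum>b\<in>Basis. (h \<bullet> b) * f b)" by (rule ext)
  have "(f has_derivative (\<lambda>h. \<Sum>b\<in>Basis. (h \<bullet> b) * f b)) (at x)" for x
    by (rule has_derivative_eq_rhs[OF bounded_linear_imp_has_derivative[OF linear] e])
  then show ?case by (intro exI[of _ "\<lambda>b x. f b"]) auto
next
  case (const c)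
  then show ?case by (intro exI[of _ "\<lambda>b x. 0"]) auto
next
  case (add f g)
  then obtain D E where D: "\<And>b. real_polynomial_function (D b)" 
     "\<And>x. (f has_derivative (\<lambda>h. \<Sum>b\<in>Basis. (h \<bullet> b) * D b x)) (at x)"
     and E: "\<And>b. real_polynomial_function (E b)" 
     "\<And>x. (g has_derivative (\<lambda>h. \<Sum>b\<in>Basis. (h \<bullet> b) * E b x)) (at x)" by blast
  have "((\<lambda>x. f x + g x) has_derivative (\<lambda>h. \<Sum>b\<in>Basis. (h \<bullet> b) * (D b x + E b x))) (at x)" for x
    using has_derivative_add[OF D(2) E(2), of x] by (simp add: distrib_left sum.distrib)
  then show ?case using D E by (intro exI[of _ "\<lambda>b x. D b x + E b x"]) auto
next
  case (mult f g)
  then obtain D E where D: "\<And>b. real_polynomial_function (D b)" 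
     "\<And>x. (f has_derivative (\<lambda>h. \<Sum>b\<in>Basis. (h \<bullet> b) * D b x)) (at x)"
     and E: "\<And>b. real_polynomial_function (E b)" 
     "\<And>x. (g has_derivative (\<lambda>h. \<Sum>b\<in>Basis. (h \<bullet> b) * E b x)) (at x)" by blast
  have "((\<lambda>x. f x * g x) has_derivative (\<lambda>h. \<Sum>b\<in>Basis. (h \<bullet> b) * (f x * E b x + D b x * g x))) (at x)" for x
    using has_derivative_mult[OF D(2) E(2), of x] 
    by (simp add: sum_distrib_left sum_distrib_right distrib_left sum.distrib mult_ac)
  moreover have "real_polynomial_function (\<lambda>x. f x * E b x + D b x * g x)" for b
    by (intro real_polynomial_function.intros(3,4) D E mult.hyps)
  ultimately show ?case by (intro exI[of _ "\<lambda>b x. f x * E b x + D b x * g x"]) auto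
qed

lemma polynomial_function_derivative:
  fixes q :: "'a::euclidean_space \<Rightarrow> complex"
  assumes "polynomial_function q"
  obtains D where "\<And>b. polynomial_function (D b)" 
    "\<And>x. (q has_derivative (\<lambda>h. \<Sum>b\<in>Basis. (h \<bullet> b) *\<^sub>R D b x)) (at x)"
proof -
  have p: "real_polynomial_function (\<lambda>x. Re (q x))" "real_polynomial_function (\<lambda>x. Im (q x))"
    using assms bounded_linear_Re bounded_linear_Im unfolding polynomial_function_def o_def by blast+
  obtain D where D: "\<And>b. real_polynomial_function (D b)" 
     "\<And>x. ((\<lambda>x. Re (q x)) has_derivative (\<lambda>h. \<Sum>b\<in>Basis. (h \<bullet> b) * D b x)) (at x)"
    using real_polynomial_function_derivative[OF p(1)] by blast
  obtain E where E: "\<And>b. real_polynomial_function (E b)" 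
     "\<And>x. ((\<lambda>x. Im (q x)) has_derivative (\<lambda>h. \<Sum>b\<in>Basis. (h \<bullet> b) * E b x)) (at x)" 
    using real_polynomial_function_derivative[OF p(2)] by blast
  show thesis
  proof (rule that[of "\<lambda>b x. D b x *\<^sub>R 1 + E b x *\<^sub>R \<i>"])
    show "polynomial_function (\<lambda>x. D b x *\<^sub>R 1 + E b x *\<^sub>R \<i>)" for b
      using D(1) E(1) unfolding real_polynomial_function_eq
      by (intro polynomial_function_add polynomial_function_mult polynomial_function_const)
    fix x
    have "((\<lambda>x. Re (q x) *\<^sub>R 1 + Im (q x) *\<^sub>R \<i>) has_derivative 
      (\<lambda>h. (\<Sum>b\<in>Basis. (h \<bullet> b) * D b x) *\<^sub>R 1 + (\<Sum>b\<in>Basis. (h \<bullet> b) * E b x) *\<^sub>R \<i>)) (at x)"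
      by (intro has_derivative_add has_derivative_scaleR_left D E)
    moreover have "(\<lambda>x. Re (q x) *\<^sub>R 1 + Im (q x) *\<^sub>R \<i>) = q"
      by (auto simp: fun_eq_iff complex_eq_iff)
    moreover have "(\<lambda>h. (\<Sum>b\<in>Basis. (h \<bullet> b) * D b x) *\<^sub>R 1 + (\<Sum>b\<in>Basis. (h \<bullet> b) * E b x) *\<^sub>R \<i>) =
      (\<lambda>h. \<Sum>b\<in>Basis. (h \<bullet> b) *\<^sub>R (D b x *\<^sub>R 1 + E b x *\<^sub>R \<i>))"
      by (auto simp: fun_eq_iff complex_eq_iff)
    ultimately show "(q has_derivative (\<lambda>h. \<Sum>b\<in>Basis. (h \<bullet> b) *\<^sub>R (D b x *\<^sub>R 1 + E b x *\<^sub>R \<i>))) (at x)"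
      by simp
  qed
qed

text \<open>The linear map \<open>h \<mapsto> (h \<bullet> b) v\<close>. The first two derivatives of a polynomial are sums of such maps.\<close>
definition coord_tensor :: "'a::euclidean_space \<Rightarrow> 'b::real_normed_vector \<Rightarrow> 'a \<Rightarrow>\<^sub>L 'b" where
  "coord_tensor b v = blinfun_scaleR_left v o\<^sub>L blinfun_inner_left b"

lemma coord_tensor_apply [simp]: "blinfun_apply (coord_tensor b v) h = (h \<bullet> b) *\<^sub>R v"
  by (simp add: coord_tensor_def blinfun_compose.rep_eq blinfun_scaleR_left.rep_eq)

lemma bounded_linear_coord_tensor: "bounded_linear (coord_tensor b)"
proof -
  have "bounded_linear (\<lambda>v. blinfun_scaleR_left v o\<^sub>L blinfun_inner_left b)"
    by (intro bounded_linear_intros)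
  then show ?thesis by (simp add: coord_tensor_def[abs_def])
qed

lemma polynomial_harmonic_criterion:
  fixes q :: "'a::euclidean_space \<Rightarrow> complex"
  assumes "polynomial_function q"
  obtains q1 q2 where "pure_C2_on UNIV q q1 q2" "(\<forall>x. (\<Sum>b\<in>Basis. q2 b x) = 0) \<Longrightarrow> harmonic_on UNIV q"
proof -
  obtain D where D: "\<And>b. polynomial_function (D b)" 
    "\<And>x. (q has_derivative (\<lambda>h. \<Sum>b\<in>Basis. (h \<bullet> b) *\<^sub>R D b x)) (at x)"
    using polynomial_function_derivative[OF assms] by blast
  have "\<exists>E. (\<forall>c. polynomial_function (E c)) \<and> 
     (\<forall>x. (D b has_derivative (\<lambda>h. \<Sum>c\<in>Basis. (h \<bullet> c) *\<^sub>R E c x)) (at x))" for b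
    by (rule polynomial_function_derivative[OF D(1)[of b]]) blast
  then obtain E where "\<forall>b. (\<forall>c. polynomial_function (E b c)) \<and> 
     (\<forall>x. (D b has_derivative (\<lambda>h. \<Sum>c\<in>Basis. (h \<bullet> c) *\<^sub>R E b c x)) (at x))"
    using choice[of "\<lambda>b E. (\<forall>c. polynomial_function (E c)) \<and> 
     (\<forall>x. (D b has_derivative (\<lambda>h. \<Sum>c\<in>Basis. (h \<bullet> c) *\<^sub>R E c x)) (at x))"] by blast
  then have E: "\<And>b c. polynomial_function (E b c)" 
     "\<And>b x. (D b has_derivative (\<lambda>h. \<Sum>c\<in>Basis. (h \<bullet> c) *\<^sub>R E b c x)) (at x)" by blast+
  define u' where "u' x = (\<Sum>b\<in>Basis. coord_tensor b (D b x))" for x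
  define u'' where "u'' x = (\<Sum>b\<in>Basis. \<Sum>c\<in>Basis. coord_tensor c (coord_tensor b (E b c x)))" for x
  have u': "(q has_derivative blinfun_apply (u' x)) (at x)" for x
  proof -
    have "blinfun_apply (u' x) = (\<lambda>h. \<Sum>b\<in>Basis. (h \<bullet> b) *\<^sub>R D b x)"
      by (auto simp: fun_eq_iff u'_def blinfun.sum_left)
    then show ?thesis using D(2)[of x] by simp
  qed
  have u'': "(u' has_derivative blinfun_apply (u'' x)) (at x)" for x
  proof -
    have "(u' has_derivative (\<lambda>h. \<Sum>b\<in>Basis. coord_tensor b (\<Sum>c\<in>Basis. (h \<bullet> c) *\<^sub>R E b c x))) (at x)"
      unfolding u'_def[abs_def]
      by (intro has_derivative_sum bounded_linear.has_derivative[OF bounded_linear_coord_tensor] E)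
    moreover have "coord_tensor b (\<Sum>c\<in>Basis. (h \<bullet> c) *\<^sub>R E b c x) = 
        (\<Sum>c\<in>Basis. (h \<bullet> c) *\<^sub>R coord_tensor b (E b c x))" for b h
      by (simp add: linear_sum[OF bounded_linear.linear[OF bounded_linear_coord_tensor]]
          linear_cmul[OF bounded_linear.linear[OF bounded_linear_coord_tensor]])
    moreover have "blinfun_apply (u'' x) = (\<lambda>h. \<Sum>b\<in>Basis. \<Sum>c\<in>Basis. (h \<bullet> c) *\<^sub>R coord_tensor b (E b c x))"
      by (auto simp: fun_eq_iff u''_def blinfun.sum_left)
    ultimately show ?thesis by simp
  qed
  have cE: "continuous_on UNIV (E b c)" for b c using continuous_on_polymonial_function[OF E(1)] .
  have cu'': "continuous_on UNIV u''"
    unfolding u''_def[abs_def]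
    by (intro continuous_on_sum bounded_linear.continuous_on[OF bounded_linear_coord_tensor] cE)
  have diag: "blinfun_apply (blinfun_apply (u'' x) b) b = E b b x" if "b \<in> Basis" for b x
  proof -
    have "blinfun_apply (blinfun_apply (u'' x) b) b = 
       (\<Sum>b'\<in>Basis. \<Sum>c\<in>Basis. (b \<bullet> c) *\<^sub>R (b \<bullet> b') *\<^sub>R E b' c x)"
      by (simp add: u''_def blinfun.sum_left blinfun.scaleR_left)
    also have "\<dots> = (\<Sum>b'\<in>Basis. \<Sum>c\<in>Basis. if c = b then (if b' = b then E b b x else 0) else 0)"
      using that by (intro sum.cong refl) (auto simp: inner_Basis)
    also have "\<dots> = E b b x" using that by simp
    finally show ?thesis .
  qed
  show thesis
  proof (rule that[of D "\<lambda>b. E b b"])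
    have 1: "(\<Sum>c\<in>Basis. (b \<bullet> c) *\<^sub>R f c) = f b" if "b \<in> Basis" for b :: 'a and f :: "'a \<Rightarrow> complex"
    proof -
      have "(\<Sum>c\<in>Basis. (b \<bullet> c) *\<^sub>R f c) = (\<Sum>c\<in>Basis. if c = b then f b else 0)"
        using that by (intro sum.cong refl) (auto simp: inner_Basis)
      then show ?thesis using that by simp
    qed
    show "pure_C2_on UNIV q D (\<lambda>b. E b b)"
      unfolding pure_C2_on_def
    proof (intro conjI ballI cE)
      show "continuous_on UNIV q" "\<And>b. continuous_on UNIV (D b)"
        using continuous_on_polymonial_function assms D(1) by blast+
      fix b x :: 'a assume b: "b \<in> Basis"
      show "((\<lambda>\<tau>. q (x + \<tau> *\<^sub>R b)) has_vector_derivative D b x) (at 0)"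
        using has_derivative_imp_line_derivative[OF D(2), of x b] 1[OF b] by simp
      show "((\<lambda>\<tau>. D b (x + \<tau> *\<^sub>R b)) has_vector_derivative E b b x) (at 0)"
        using has_derivative_imp_line_derivative[OF E(2), of b x b] 1[OF b] by simp
    qed
    show "harmonic_on UNIV q" if "\<forall>x. (\<Sum>b\<in>Basis. E b b x) = 0"
      unfolding harmonic_on_def
      by (rule exI[of _ u'], rule exI[of _ u'']) (use u' u'' cu'' diag that in auto)
  qed
qed

lemma bump_cube_pure_C2_on:
  fixes x :: "'a::euclidean_space"
  assumes "\<delta> > 0"
  obtains \<psi>1 \<psi>2 where "pure_C2_on UNIV (\<lambda>y. bump ((1 / \<delta>) *\<^sub>R (y - x)) ^ 3) \<psi>1 \<psi>2"
    "\<And>b y. \<delta> < dist x y \<Longrightarrow> \<psi>1 b y = 0 \<and> \<psi>2 b y = 0"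
proof -
  define e where "e s = 1 - s * (1 / \<delta>\<^sup>2)" for s :: real
  define G G1 G2 where "G s = max 0 (e s) ^ 3" and "G1 s = 3 * (max 0 (e s))\<^sup>2 * - (1 / \<delta>\<^sup>2)"
    and "G2 s = 6 * max 0 (e s) * - (1 / \<delta>\<^sup>2) * - (1 / \<delta>\<^sup>2)" for s
  have de: "(e has_real_derivative - (1 / \<delta>\<^sup>2)) (at s)" for s
    unfolding e_def
    by (rule DERIV_cong[OF DERIV_diff[OF DERIV_const DERIV_cmult_right[OF DERIV_ident]]]) simp
  have dG: "(G has_real_derivative G1 s) (at s)" for s
    unfolding G_def[abs_def] G1_def by (rule DERIV_chain2[OF has_derivative_max_0_cube(1) de])
  have dG1: "(G1 has_real_derivative G2 s) (at s)" for s
    unfolding G1_def[abs_def] G2_def by (rule DERIV_cmult_right[OF DERIV_chain2[OF has_derivative_max_0_cube(2) de]])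
  have cG2: "continuous_on UNIV G2"
    unfolding G2_def[abs_def] e_def using assms by (intro continuous_intros) auto
  have "G ((norm (y - x))\<^sup>2) = bump ((1 / \<delta>) *\<^sub>R (y - x)) ^ 3" for y
    by (simp add: G_def e_def bump_def power_divide)
  moreover have "G1 ((norm (y - x))\<^sup>2) = 0" "G2 ((norm (y - x))\<^sup>2) = 0" if "\<delta> < dist x y" for y
  proof -
    have "\<delta>\<^sup>2 \<le> (norm (y - x))\<^sup>2" using that assms 
      by (intro power_mono) (auto simp: dist_norm norm_minus_commute)
    then have "e ((norm (y - x))\<^sup>2) \<le> 0" using assms by (simp add: e_def)
    then show "G1 ((norm (y - x))\<^sup>2) = 0" "G2 ((norm (y - x))\<^sup>2) = 0" by (simp_all add: G1_def G2_def max_def)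
  qed
  ultimately show thesis
    using that[of "\<lambda>b y. 2 * ((y - x) \<bullet> b) * G1 ((norm (y - x))\<^sup>2)"
       "\<lambda>b y. 4 * ((y - x) \<bullet> b)\<^sup>2 * G2 ((norm (y - x))\<^sup>2) + 2 * G1 ((norm (y - x))\<^sup>2)"]
      pure_C2_on_radial[OF dG dG1 cG2, of UNIV x] by simp
qed

text \<open>For small \<open>r\<close> the function \<open>y \<mapsto> u(r y)\<close> is harmonic near the support of \<open>\<psi>\<close>, so it is orthogonal to the Laplacian
  of \<open>\<psi>\<close>. This pairing is a power series in \<open>r\<close> whose \<open>k\<close>-th coefficient is the pairing with \<open>U k\<close>.\<close>
lemma homogeneous_part_weakly_harmonic:
  fixes u :: "'a::euclidean_space \<Rightarrow> complex"
  assumes u: "harmonic_on (ball 0 1) u"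
    and U: "\<And>k. continuous_on UNIV (U k)" "\<And>k t x. U k (t *\<^sub>R x) = t ^ k *\<^sub>R U k x"
    and bnd: "\<And>k x. norm (U k x) \<le> M * (norm x / \<rho>) ^ k" and \<rho>: "0 < \<rho>" "\<rho> < 1"
    and sums: "\<And>x. norm x < 1 \<Longrightarrow> (\<lambda>k. U k x) sums u x"
    and \<psi>: "pure_C2_on UNIV \<psi> \<psi>1 \<psi>2" "\<And>y. \<delta> < dist x y \<Longrightarrow> \<psi> y = 0"
      "\<And>b y. \<delta> < dist x y \<Longrightarrow> \<psi>1 b y = 0 \<and> \<psi>2 b y = 0" and \<delta>: "\<delta> > 0"
  shows "(LINT y|lborel. (\<Sum>b\<in>Basis. \<psi>2 b y) *\<^sub>R U k y) = 0"
proof -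
  define L where "L y = (\<Sum>b\<in>Basis. \<psi>2 b y)" for y
  have cL: "continuous_on UNIV L" 
    unfolding L_def[abs_def] using pure_C2_onD(3)[OF \<psi>(1)] by (intro continuous_intros)
  have L0: "L y = 0" if "\<delta> < dist x y" for y using \<psi>(3)[OF that] by (simp add: L_def)
  define s where "s = norm x + \<delta>"
  have s: "s > 0" using \<delta> by (simp add: s_def add_nonneg_pos)
  have ns: "norm y \<le> s" if "L y \<noteq> 0" for y
  proof -
    have "dist x y \<le> \<delta>" using L0[of y] that by force
    then show ?thesis using norm_le_norm_add_dist[of y x] by (simp add: s_def)
  qed
  have iLU: "integrable lborel (\<lambda>y. L y *\<^sub>R U k y)" for k
    by (rule integrable_compact_support[of _ "cball x \<delta>"]) (use L0 in \<open>auto intro!: continuous_intros cL U\<close>)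
  have iL: "integrable lborel L"
    by (rule integrable_compact_support[OF cL, of "cball x \<delta>"]) (use L0 in auto)
  have weak: "(LINT y|lborel. L y *\<^sub>R u (r *\<^sub>R y)) = 0" if r: "0 < r" "r * s < 1" for r
  proof -
    obtain R where R: "r * s < R" "R < 1" using r(2) dense by blast
    have R0: "0 < R" using R r s by (meson less_trans mult_pos_pos)
    obtain R' where R': "R < R'" "R' < 1" using R(2) dense by blast
    obtain F F1 F2 where F: "pure_C2_on UNIV F F1 F2" "\<And>y. norm y \<le> R \<Longrightarrow> F y = u y"
      "\<And>y. norm y \<le> R \<Longrightarrow> (\<Sum>b\<in>Basis. F2 b y) = 0"
      by (rule harmonic_cutoff[OF u R0 R']) (rule that)
    have C2: "pure_C2_on UNIV (\<lambda>y. F (r *\<^sub>R y)) (\<lambda>b y. r *\<^sub>R F1 b (r *\<^sub>R y)) (\<lambda>b y. r *\<^sub>R r *\<^sub>R F2 b (r *\<^sub>R y))"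
    proof -
      have line: "((\<lambda>\<tau>. f (r *\<^sub>R (y + \<tau> *\<^sub>R b))) has_vector_derivative r *\<^sub>R f') (at 0)" 
        if "((\<lambda>\<tau>. f (r *\<^sub>R y + \<tau> *\<^sub>R b)) has_vector_derivative f') (at 0)" for f :: "'a \<Rightarrow> complex" and f' b y
      proof -
        have "((\<lambda>\<tau>. f (r *\<^sub>R y + \<tau> *\<^sub>R b)) \<circ> (\<lambda>\<tau>. r * \<tau>) has_vector_derivative r *\<^sub>R f') (at 0)"
          by (rule vector_diff_chain_at) (use that in \<open>auto intro!: derivative_eq_intros\<close>)
        then show ?thesis by (simp add: o_def algebra_simps)
      qed
      have c: "continuous_on UNIV (\<lambda>y. f (r *\<^sub>R y))" if "continuous_on UNIV f" for f :: "'a \<Rightarrow> complex"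
        by (rule continuous_on_compose2[OF that]) (auto intro!: continuous_intros)
      show ?thesis unfolding pure_C2_on_def
      proof (intro conjI ballI continuous_on_scaleR continuous_on_const c pure_C2_onD(1-3)[OF F(1)])
        fix b y :: 'a assume b: "b \<in> Basis"
        show "((\<lambda>\<tau>. F (r *\<^sub>R (y + \<tau> *\<^sub>R b))) has_vector_derivative r *\<^sub>R F1 b (r *\<^sub>R y)) (at 0)"
          by (rule line[OF pure_C2_onD(4)[OF F(1) b UNIV_I]])
        show "((\<lambda>\<tau>. r *\<^sub>R F1 b (r *\<^sub>R (y + \<tau> *\<^sub>R b))) has_vector_derivative r *\<^sub>R r *\<^sub>R F2 b (r *\<^sub>R y)) (at 0)"
          by (rule bounded_linear.has_vector_derivative[OF bounded_linear_scaleR_right line[OF pure_C2_onD(5)[OF F(1) b UNIV_I]]])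
      qed
    qed
    have in_R: "norm (r *\<^sub>R y) \<le> R" if "norm y \<le> s" for y
    proof -
      have "norm (r *\<^sub>R y) \<le> r * s" using that r by simp
      then show ?thesis using R by simp
    qed
    have "(LINT y|lborel. L y *\<^sub>R u (r *\<^sub>R y)) = (LINT y|lborel. L y *\<^sub>R F (r *\<^sub>R y))"
    proof (rule Bochner_Integration.integral_cong[OF refl])
      show "L y *\<^sub>R u (r *\<^sub>R y) = L y *\<^sub>R F (r *\<^sub>R y)" for y
        using ns[of y] F(2)[OF in_R, of y] by (cases "L y = 0") auto
    qed
    also have "\<dots> = (LINT y|lborel. \<psi> y *\<^sub>R (\<Sum>b\<in>Basis. r *\<^sub>R r *\<^sub>R F2 b (r *\<^sub>R y)))"
      unfolding L_def by (rule green_identity[OF C2 \<psi>(1), of "cball x \<delta>", symmetric]) (use \<psi> in auto)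
    also have "\<dots> = (LINT y|(lborel :: 'a measure). 0)"
    proof (rule Bochner_Integration.integral_cong[OF refl])
      fix y
      show "\<psi> y *\<^sub>R (\<Sum>b\<in>Basis. r *\<^sub>R r *\<^sub>R F2 b (r *\<^sub>R y)) = 0"
      proof (cases "\<delta> < dist x y")
        case False
        then have "norm y \<le> s" using norm_le_norm_add_dist[of y x] by (simp add: s_def)
        then have "(\<Sum>b\<in>Basis. F2 b (r *\<^sub>R y)) = 0" by (intro F(3) in_R)
        then show ?thesis by (simp flip: scaleR_sum_right)
      qed (simp add: \<psi>(2))
    qed
    finally show ?thesis by simp
  qed
  have "(\<lambda>k. r ^ k *\<^sub>R (LINT y|lborel. L y *\<^sub>R U k y)) sums 0" if r: "0 < r" "r < \<rho> / s" for r
  proof -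
    have rs: "r * s < \<rho>" using r s by (simp add: less_divide_eq)
    define f where "f k y = r ^ k *\<^sub>R (L y *\<^sub>R U k y)" for k y
    have "norm (U 0 0) \<le> M" using bnd[of 0 0] by simp
    then have M: "M \<ge> 0" using norm_ge_zero order_trans by blast
    have fb: "norm (f k y) \<le> (M * \<bar>L y\<bar>) * (r * s / \<rho>) ^ k" for k y
    proof (cases "L y = 0")
      case False
      have "norm (f k y) = r ^ k * (\<bar>L y\<bar> * norm (U k y))" using r by (simp add: f_def abs_mult)
      also have "\<dots> \<le> r ^ k * (\<bar>L y\<bar> * (M * (norm y / \<rho>) ^ k))"
        using r by (intro mult_left_mono bnd) auto
      also have "\<dots> \<le> r ^ k * (\<bar>L y\<bar> * (M * (s / \<rho>) ^ k))"
        using r \<rho> M ns[OF False] by (intro mult_left_mono power_mono divide_right_mono) auto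
      also have "\<dots> = (M * \<bar>L y\<bar>) * (r * s / \<rho>) ^ k" by (simp add: power_mult_distrib power_divide mult_ac)
      finally show ?thesis .
    qed (simp add: f_def)
    have if': "integrable lborel (f k)" for k
      unfolding f_def[abs_def] by (rule integrable_scaleR_right) (rule iLU)
    have "(\<lambda>k. LINT y|lborel. f k y) sums (LINT y|lborel. (\<Sum>k. f k y))"
      by (rule sums_integral_geometric[OF if' _ fb]) (use iL \<rho> r s rs in auto)
    also have "(LINT y|lborel. (\<Sum>k. f k y)) = (LINT y|lborel. L y *\<^sub>R u (r *\<^sub>R y))"
    proof (rule Bochner_Integration.integral_cong[OF refl])
      fix y
      show "(\<Sum>k. f k y) = L y *\<^sub>R u (r *\<^sub>R y)"
      proof (cases "L y = 0")
        case False
        have "norm (r *\<^sub>R y) \<le> r * s" using ns[OF False] r by simp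
        then have "(\<lambda>k. L y *\<^sub>R U k (r *\<^sub>R y)) sums (L y *\<^sub>R u (r *\<^sub>R y))"
          using rs \<rho> by (intro sums_scaleR_right sums) auto
        then show ?thesis by (simp add: f_def sums_iff U(2) mult.commute)
      qed (simp add: f_def)
    qed
    also have "\<dots> = 0" using weak r rs \<rho> by auto
    also have "(\<lambda>k. LINT y|lborel. f k y) = (\<lambda>k. r ^ k *\<^sub>R (LINT y|lborel. L y *\<^sub>R U k y))"
      unfolding f_def by (intro ext integral_scaleR_right)
    finally show ?thesis .
  qed
  then have "(LINT y|lborel. L y *\<^sub>R U k y) = 0"
    using powser_eq_0_imp_coeff_eq_0[of "\<rho> / s" "\<lambda>k. LINT y|lborel. L y *\<^sub>R U k y" k] \<rho> s by simp
  then show ?thesis by (simp add: L_def)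
qed

text \<open>Green's identity moves the Laplacian in the previous lemma to \<open>U k\<close>; testing with bumps that concentrate
  at a point shows that it vanishes there.\<close>
lemma homogeneous_part_harmonic:
  fixes u :: "'a::euclidean_space \<Rightarrow> complex"
  assumes u: "harmonic_on (ball 0 1) u"
    and U: "\<And>k. polynomial_function (U k)" "\<And>k t x. U k (t *\<^sub>R x) = t ^ k *\<^sub>R U k x"
    and bnd: "\<And>k x. norm (U k x) \<le> M * (norm x / \<rho>) ^ k" and \<rho>: "0 < \<rho>" "\<rho> < 1"
    and sums: "\<And>x. norm x < 1 \<Longrightarrow> (\<lambda>k. U k x) sums u x"
  shows "harmonic_on UNIV (U k)"
proof -
  obtain q1 q2 where q: "pure_C2_on UNIV (U k) q1 q2" 
    and crit: "(\<forall>x. (\<Sum>b\<in>Basis. q2 b x) = 0) \<Longrightarrow> harmonic_on UNIV (U k)"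
    by (rule polynomial_harmonic_criterion[OF U(1)[of k]]) (rule that)
  define Q where "Q y = (\<Sum>b\<in>Basis. q2 b y)" for y
  have cQ: "continuous_on UNIV Q"
    unfolding Q_def[abs_def] using pure_C2_onD(3)[OF q] by (intro continuous_intros)
  have cU: "continuous_on UNIV (U k)" for k using continuous_on_polymonial_function[OF U(1)] .
  define w where "w z = bump z ^ 3" for z :: 'a
  have w0: "w z = 0" if "1 < norm z" for z using that bump_eq_0[of z] by (simp add: w_def)
  have cw: "continuous_on UNIV w" unfolding w_def[abs_def] by (intro continuous_intros)
  have z: "(LINT z|lborel. w z *\<^sub>R Q (x + \<delta> *\<^sub>R z)) = 0" if \<delta>: "\<delta> > 0" for x \<delta>
  proof -
    obtain \<psi>1 \<psi>2 where \<psi>: "pure_C2_on UNIV (\<lambda>y. w ((1 / \<delta>) *\<^sub>R (y - x))) \<psi>1 \<psi>2"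
      "\<And>b y. \<delta> < dist x y \<Longrightarrow> \<psi>1 b y = 0 \<and> \<psi>2 b y = 0"
      by (rule bump_cube_pure_C2_on[OF \<delta>, of x, folded w_def]) (rule that)
    have \<psi>0: "w ((1 / \<delta>) *\<^sub>R (y - x)) = 0" if "\<delta> < dist x y" for y
      using that \<delta> by (intro w0) (simp add: dist_norm norm_minus_commute)
    have "(LINT y|lborel. w ((1 / \<delta>) *\<^sub>R (y - x)) *\<^sub>R Q y) = (LINT y|lborel. (\<Sum>b\<in>Basis. \<psi>2 b y) *\<^sub>R U k y)"
      unfolding Q_def by (rule green_identity[OF q \<psi>(1), of "cball x \<delta>"]) (use \<psi>0 \<psi>(2) in auto)
    also have "\<dots> = 0"
      by (rule homogeneous_part_weakly_harmonic[OF u cU U(2) bnd \<rho> sums \<psi>(1) \<psi>0 \<psi>(2) \<delta>])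
    finally have 0: "(LINT y|lborel. w ((1 / \<delta>) *\<^sub>R (y - x)) *\<^sub>R Q y) = 0" .
    have c: "continuous_on UNIV (\<lambda>y. w ((1 / \<delta>) *\<^sub>R (y - x)) *\<^sub>R Q y)"
      unfolding w_def by (intro continuous_intros cQ)
    have "(LINT y|lborel. w ((1 / \<delta>) *\<^sub>R (y - x)) *\<^sub>R Q y) = 
       \<delta> ^ DIM('a) *\<^sub>R (LINT z|lborel. w ((1 / \<delta>) *\<^sub>R (x + \<delta> *\<^sub>R z - x)) *\<^sub>R Q (x + \<delta> *\<^sub>R z))"
      by (rule integral_affine[OF borel_measurable_continuous_onI[OF c] \<delta>])
    then show ?thesis using 0 \<delta> by simp
  qed
  have iw: "integrable lborel w"
    by (rule integrable_compact_support[OF cw, of "cball 0 1"]) (use w0 in auto)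
  have wpos: "(LINT z|lborel. w z) > 0"
  proof -
    have "(LINT z|lborel. (27/64) * indicator (cball 0 (1/2)) (z::'a)) \<le> (LINT z|lborel. w z)"
    proof (rule integral_mono[OF _ iw])
      show "integrable lborel (\<lambda>z::'a. (27/64) * indicator (cball 0 (1/2)) z :: real)"
        by (intro integrable_mult_right integrable_real_indicator)
          (use emeasure_bounded_finite[OF bounded_cball, of "0::'a" "1/2"] in auto)
      show "(27/64) * indicator (cball 0 (1/2)) z \<le> w z" for z :: 'a
      proof (cases "norm z \<le> 1/2")
        case True
        then have "3/4 \<le> bump z" using power_mono[of "norm z" "1/2" 2] by (simp add: bump_def power2_eq_square)
        then have "(3/4) ^ 3 \<le> w z" unfolding w_def by (intro power_mono) auto
        then show ?thesis by (simp add: indicator_def power3_eq_cube)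
      qed (simp add: w_def)
    qed
    then have "(27/64) * measure lborel (cball (0::'a) (1/2)) \<le> (LINT z|lborel. w z)" by simp
    moreover have "measure lborel (cball (0::'a) (1/2)) > 0"
      using content_cball_pos[of "1/2" "0::'a"] by simp
    ultimately show ?thesis by linarith
  qed
  have "Q x = 0" for x
  proof -
    have "(\<lambda>j. LINT z|lborel. w z *\<^sub>R Q (x + (1 / real (Suc j)) *\<^sub>R z)) \<longlonglongrightarrow> (LINT z|lborel. w z) *\<^sub>R Q x"
      by (rule weighted_mean_tendsto[OF cQ open_UNIV _ _ cw w0]) auto
    then have "(LINT z|lborel. w z) *\<^sub>R Q x = 0" using z[of "1 / real (Suc j)" x for j] by (simp add: LIMSEQ_const_iff)
    then show ?thesis using wpos by simp
  qed
  then show ?thesis by (intro crit) (simp add: Q_def)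
qed

theorem homogeneous_expansion_exists:
  fixes u :: "'a::euclidean_space \<Rightarrow> complex"
  assumes u: "harmonic_on (ball 0 1) u"
  shows "homogeneous_expansion u (homogeneous_part u)"
    and "0 < \<rho> \<Longrightarrow> \<rho> < 1 \<Longrightarrow> \<exists>M. \<forall>k x. norm (homogeneous_part u k x) \<le> M * (norm x / \<rho>) ^ k"
proof -
  obtain U :: "nat \<Rightarrow> 'a \<Rightarrow> complex" where U: "\<And>k. polynomial_function (U k)" 
    "\<And>k t x. U k (t *\<^sub>R x) = t ^ k *\<^sub>R U k x"
    "\<And>\<rho>. 0 < \<rho> \<Longrightarrow> \<rho> < 1 \<Longrightarrow> \<exists>M. \<forall>k x. norm (U k x) \<le> M * (norm x / \<rho>) ^ k"
    "\<And>x. norm x < 1 \<Longrightarrow> (\<lambda>k. U k x) sums u x"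
    by (rule unit_ball_homogeneous_expansion[OF u]) (rule that)
  obtain M where M: "\<And>k x. norm (U k x) \<le> M * (norm x / (1/2)) ^ k"
    using U(3)[of "1/2"] by auto
  have "harmonic_on UNIV (U k)" for k
    by (rule homogeneous_part_harmonic[OF u U(1,2) M _ _ U(4)]) auto
  then have ex: "homogeneous_expansion u U"
    unfolding homogeneous_expansion_def homogeneous_harmonic_polynomial_def using U by auto
  have "V = U" if "homogeneous_expansion u V" for V
  proof (rule homogeneous_expansion_unique[where u=u and R=1])
    show "V k (t *\<^sub>R x) = t ^ k *\<^sub>R V k x" for k t x
      using that unfolding homogeneous_expansion_def homogeneous_harmonic_polynomial_def by blast
    show "(\<lambda>k. V k x) sums u x" if "norm x < 1" for x
      using \<open>homogeneous_expansion u V\<close> that unfolding homogeneous_expansion_def by simp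
  qed (use U in auto)
  then have "homogeneous_part u = U"
    unfolding homogeneous_part_def using ex by (intro the_equality)
  then show "homogeneous_expansion u (homogeneous_part u)"
    "0 < \<rho> \<Longrightarrow> \<rho> < 1 \<Longrightarrow> \<exists>M. \<forall>k x. norm (homogeneous_part u k x) \<le> M * (norm x / \<rho>) ^ k"
    using ex U(3) by auto
qed

section \<open>Local estimates from the mean value property\<close>

text \<open>Unlike harmonicity, this property visibly passes to locally uniform limits. All local
  estimates follow from it.\<close>
definition bump_mean_value :: "('a::euclidean_space \<Rightarrow> complex) \<Rightarrow> bool" where
  "bump_mean_value f \<longleftrightarrow> continuous_on (ball 0 1) f \<and>
     (\<forall>x \<delta>. 0 < \<delta> \<longrightarrow> norm x + \<delta> < 1 \<longrightarrow>
       (LINT y|lborel. bump ((1 / \<delta>) *\<^sub>R (y - x)) *\<^sub>R f y) = (\<delta> ^ DIM('a) * bump_mass TYPE('a)) *\<^sub>R f x)"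

lemma harmonic_imp_bump_mean_value:
  assumes "harmonic_on (ball 0 1) u"
  shows "bump_mean_value (u :: 'a::euclidean_space \<Rightarrow> complex)"
  unfolding bump_mean_value_def
proof (intro conjI allI impI)
  show "continuous_on (ball 0 1) u"
    by (rule harmonic_on_imp_pure_C2_on[OF assms]) (rule pure_C2_onD)
  fix x :: 'a and \<delta> :: real
  assume \<delta>: "0 < \<delta>" "norm x + \<delta> < 1"
  have R: "0 < norm x + \<delta>" "norm x + \<delta> < (norm x + \<delta> + 1) / 2" "(norm x + \<delta> + 1) / 2 < 1"
    using \<delta> by (simp_all add: add_nonneg_pos)
  show "(LINT y|lborel. bump ((1 / \<delta>) *\<^sub>R (y - x)) *\<^sub>R u y) = (\<delta> ^ DIM('a) * bump_mass TYPE('a)) *\<^sub>R u x"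
    by (rule newton_representation_and_mean_value[OF assms R]) (use \<delta> in auto)
qed

lemma continuous_on_norm_powr:
  assumes "continuous_on S f" "p > 0"
  shows "continuous_on S (\<lambda>x. norm (f x) powr p)"
  using assms by (intro continuous_on_powr' continuous_intros) auto

lemma set_integrable_norm_powr:
  fixes f :: "'a::euclidean_space \<Rightarrow> complex"
  assumes "continuous_on (ball 0 1) f" "norm x + \<delta> < 1" "p > 0"
  shows "set_integrable lborel (cball x \<delta>) (\<lambda>y. norm (f y) powr p)"
  unfolding set_integrable_def
  by (intro borel_integrable_compact compact_cball continuous_on_norm_powr 
      continuous_on_subset[OF assms(1)] cball_subset_unit_ball assms)

lemma norm_le_mean_norm:
  fixes f :: "'a::euclidean_space \<Rightarrow> complex"
  assumes f: "bump_mean_value f" and \<delta>: "0 < \<delta>" "norm x + \<delta> < 1"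
  shows "norm (f x) * (\<delta> ^ DIM('a) * bump_mass TYPE('a)) \<le> (LINT y:cball x \<delta>|lborel. norm (f y))"
proof -
  have c: "continuous_on (ball 0 1) f" using f by (simp add: bump_mean_value_def)
  have sub: "cball x \<delta> \<subseteq> ball 0 1" using \<delta> by (intro cball_subset_unit_ball)
  have "norm (f x) * (\<delta> ^ DIM('a) * bump_mass TYPE('a)) = norm ((\<delta> ^ DIM('a) * bump_mass TYPE('a)) *\<^sub>R f x)"
    using \<delta> bump_mass_pos[where 'a='a] by (simp add: mult_ac)
  also have "\<dots> = norm (LINT y|lborel. bump ((1 / \<delta>) *\<^sub>R (y - x)) *\<^sub>R f y)"
    using f \<delta> by (simp add: bump_mean_value_def)
  also have "\<dots> \<le> (LINT y|lborel. norm (bump ((1 / \<delta>) *\<^sub>R (y - x)) *\<^sub>R f y))" by (rule integral_norm_bound)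
  also have "\<dots> \<le> (LINT y:cball x \<delta>|lborel. norm (f y))"
    unfolding set_lebesgue_integral_def
  proof (rule integral_mono)
    show "integrable lborel (\<lambda>y. norm (bump ((1 / \<delta>) *\<^sub>R (y - x)) *\<^sub>R f y))"
      by (intro integrable_norm integrable_bump_scaleR(1)[OF c _ \<delta>(1) sub]) auto
    show "integrable lborel (\<lambda>y. indicator (cball x \<delta>) y *\<^sub>R norm (f y))"
      by (intro borel_integrable_compact compact_cball continuous_on_norm continuous_on_subset[OF c sub])
    show "norm (bump ((1 / \<delta>) *\<^sub>R (y - x)) *\<^sub>R f y) \<le> indicator (cball x \<delta>) y *\<^sub>R norm (f y)" for y
    proof (cases "y \<in> cball x \<delta>")
      case True
      then show ?thesis using bump_le_1[of "(1 / \<delta>) *\<^sub>R (y - x)"] by (simp add: mult_left_le_one_le)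
    next
      case False
      then have "bump ((1 / \<delta>) *\<^sub>R (y - x)) = 0"
        using \<delta> by (intro bump_scaled_eq_0) auto
      then show ?thesis by simp
    qed
  qed
  finally show ?thesis .
qed

lemma set_integral_mono_set:
  fixes f :: "'a \<Rightarrow> real"
  assumes "set_integrable M B f" "A \<in> sets M" "A \<subseteq> B" "\<And>x. x \<in> B \<Longrightarrow> 0 \<le> f x"
  shows "(LINT x:A|M. f x) \<le> (LINT x:B|M. f x)"
  unfolding set_lebesgue_integral_def
proof (rule integral_mono)
  show "integrable M (\<lambda>x. indicator A x *\<^sub>R f x)"
    using set_integrable_subset[OF assms(1-3)] by (simp add: set_integrable_def)
  show "integrable M (\<lambda>x. indicator B x *\<^sub>R f x)" using assms(1) by (simp add: set_integrable_def)
  show "indicator A x *\<^sub>R f x \<le> indicator B x *\<^sub>R f x" for x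
    using assms(3,4) by (auto simp: indicator_def)
qed

lemma cball_subset_cball_dist:
  fixes x y :: "'a::real_normed_vector"
  assumes "dist x y + r \<le> \<delta>"
  shows "cball y r \<subseteq> cball x \<delta>"
proof
  fix z assume "z \<in> cball y r"
  then show "z \<in> cball x \<delta>" using assms dist_triangle[of x z y] by simp
qed

text \<open>The argument of Hardy and Littlewood. Let \<open>M\<close> be the maximum of \<open>(\<delta> - |x - y|)\<^sup>n |f(y)|\<^sup>p\<close>, attained at \<open>y0\<close>,
  which has distance \<open>d\<close> from the boundary of the ball. Within \<open>d/2\<close> of \<open>y0\<close> the maximality bounds \<open>|f|\<^sup>p\<close> by
  \<open>M (2/d)\<^sup>n\<close>; splitting \<open>|f| = |f|\<^sup>1\<^sup>-\<^sup>p |f|\<^sup>p\<close> in the mean value inequality at \<open>y0\<close> then bounds \<open>M\<close> by a multiple of the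
  integral of \<open>|f|\<^sup>p\<close>.\<close>
lemma norm_powr_sub_mean_value:
  fixes f :: "'a::euclidean_space \<Rightarrow> complex"
  assumes f: "bump_mean_value f" and \<delta>: "0 < \<delta>" "norm x + \<delta> < 1" and p: "0 < p" "p \<le> 1"
  shows "norm (f x) powr p * \<delta> ^ DIM('a) \<le> 
    2 powr (real DIM('a) / p) / bump_mass TYPE('a) * (LINT y:cball x \<delta>|lborel. norm (f y) powr p)"
proof -
  define n where "n = DIM('a)"
  define m where "m = bump_mass TYPE('a)"
  have m: "m > 0" using bump_mass_pos by (simp add: m_def)
  define I where "I = (LINT y:cball x \<delta>|lborel. norm (f y) powr p)"
  have c: "continuous_on (ball 0 1) f" using f by (simp add: bump_mean_value_def)
  have sub: "cball x \<delta> \<subseteq> ball 0 1" using \<delta> by (intro cball_subset_unit_ball)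
  have I0: "I \<ge> 0" unfolding I_def set_lebesgue_integral_def by (intro Bochner_Integration.integral_nonneg) auto
  \<comment> \<open>the factor vanishes on the sphere, which keeps the maximum away from it\<close>
  define g where "g y = (\<delta> - dist x y) ^ n * norm (f y) powr p" for y
  have "continuous_on (cball x \<delta>) g" unfolding g_def[abs_def]
    by (intro continuous_intros continuous_on_norm_powr continuous_on_subset[OF c sub] p)
  then obtain y0 where y0: "y0 \<in> cball x \<delta>" and max: "\<And>y. y \<in> cball x \<delta> \<Longrightarrow> g y \<le> g y0"
    using continuous_attains_sup[of "cball x \<delta>" g] \<delta> by auto
  define d where "d = \<delta> - dist x y0"
  have d0: "d \<ge> 0" using y0 by (simp add: d_def)
  have gx: "norm (f x) powr p * \<delta> ^ n \<le> g y0" using max[of x] \<delta> by (simp add: g_def mult.commute)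
  have "g y0 \<le> 2 powr (n / p) / m * I"
  proof (cases "g y0 = 0")
    case True then show ?thesis using I0 m by simp
  next
    case False
    then have d: "d > 0" and f0: "f y0 \<noteq> 0" using d0 by (auto simp: g_def d_def order_le_less n_def zero_power)
    define A where "A = norm (f y0) powr p"
    have A: "A > 0" using f0 by (simp add: A_def)
    have gA: "g y0 = d ^ n * A" by (simp add: g_def d_def A_def)
    have fy0: "norm (f y0) = A powr (1 / p)" using p f0 by (simp add: A_def powr_powr)
    have sub2: "cball y0 (d / 2) \<subseteq> cball x \<delta>" by (rule cball_subset_cball_dist) (use d in \<open>simp add: d_def field_simps\<close>)
    have near: "norm (f z) \<le> (2 ^ n * A) powr (1 / p - 1) * norm (f z) powr p" if z: "z \<in> cball y0 (d / 2)" for z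
    proof (cases "f z = 0")
      case fz: False
      have "d / 2 \<le> \<delta> - dist x z" using z dist_triangle[of x z y0] by (simp add: d_def)
      then have "(d / 2) ^ n * norm (f z) powr p \<le> g z"
        unfolding g_def using d by (intro mult_right_mono power_mono) auto
      also have "\<dots> \<le> d ^ n * A" using max[of z] z sub2 gA by auto
      finally have "norm (f z) powr p \<le> 2 ^ n * A" using d by (simp add: power_divide field_simps)
      then have "(norm (f z) powr p) powr (1 / p - 1) \<le> (2 ^ n * A) powr (1 / p - 1)"
        using p by (intro powr_mono2) auto
      then have "norm (f z) powr (p * (1 / p - 1)) * norm (f z) powr p \<le> (2 ^ n * A) powr (1 / p - 1) * norm (f z) powr p"
        by (intro mult_right_mono) (auto simp: powr_powr)
      moreover have "norm (f z) powr (p * (1 / p - 1)) * norm (f z) powr p = norm (f z)"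
      proof -
        have "p * (1 / p - 1) + p = 1" using p by (simp add: field_simps)
        then show ?thesis using fz by (simp add: powr_add[symmetric])
      qed
      ultimately show ?thesis by simp
    qed simp
    have nd: "norm y0 + d / 2 < 1"
    proof -
      have "norm y0 \<le> norm x + dist x y0" by (rule norm_le_norm_add_dist)
      then show ?thesis using d \<delta> by (simp add: d_def field_simps)
    qed
    have "norm (f y0) * ((d / 2) ^ n * m) \<le> (LINT y:cball y0 (d / 2)|lborel. norm (f y))"
      unfolding n_def m_def by (rule norm_le_mean_norm[OF f _ nd]) (use d in simp)
    also have "\<dots> \<le> (LINT y:cball y0 (d / 2)|lborel. (2 ^ n * A) powr (1 / p - 1) * norm (f y) powr p)"
    proof (rule set_integral_mono)
      show "set_integrable lborel (cball y0 (d / 2)) (\<lambda>y. norm (f y))"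
        unfolding set_integrable_def using sub2 sub
        by (intro borel_integrable_compact compact_cball continuous_on_norm continuous_on_subset[OF c]) auto
      show "set_integrable lborel (cball y0 (d / 2)) (\<lambda>y. (2 ^ n * A) powr (1 / p - 1) * norm (f y) powr p)"
        by (intro set_integrable_mult_right set_integrable_norm_powr c nd p) 
    qed (use near in auto)
    also have "\<dots> = (2 ^ n * A) powr (1 / p - 1) * (LINT y:cball y0 (d / 2)|lborel. norm (f y) powr p)"
      by (rule set_integral_mult_right)
    also have "\<dots> \<le> (2 ^ n * A) powr (1 / p - 1) * I"
      unfolding I_def
      by (intro mult_left_mono set_integral_mono_set set_integrable_norm_powr c \<delta> p sub2) auto
    finally have *: "norm (f y0) * ((d / 2) ^ n * m) \<le> (2 ^ n * A) powr (1 / p - 1) * I" .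
    have "A powr (1 / p) = A powr (1 / p - 1) * A"
      using A by (simp add: powr_diff)
    moreover have "(2 ^ n * A) powr (1 / p - 1) = (2 ^ n) powr (1 / p - 1) * A powr (1 / p - 1)"
      using A by (simp add: powr_mult)
    ultimately have "A powr (1 / p - 1) * (A * ((d / 2) ^ n * m)) \<le> A powr (1 / p - 1) * ((2 ^ n) powr (1 / p - 1) * I)"
      using * fy0 by (simp add: mult_ac)
    then have "A * ((d / 2) ^ n * m) \<le> (2 ^ n) powr (1 / p - 1) * I"
      using A by (simp add: mult_le_cancel_left_pos)
    then have "d ^ n * A \<le> 2 ^ n * (2 ^ n) powr (1 / p - 1) / m * I"
      using m by (simp add: power_divide field_simps)
    also have "2 ^ n * (2 ^ n) powr (1 / p - 1) = (2 :: real) powr (n / p)"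
    proof -
      have "(2::real) ^ n = 2 powr n" by (simp add: powr_realpow)
      then have "(2::real) ^ n * (2 ^ n) powr (1 / p - 1) = 2 powr n * (2 powr n) powr (1 / p - 1)" by simp
      also have "\<dots> = 2 powr (n + n * (1 / p - 1))" by (simp add: powr_powr powr_add)
      also have "real n + n * (1 / p - 1) = n / p" by (simp add: algebra_simps)
      finally show ?thesis .
    qed
    finally show ?thesis using gA by simp
  qed
  then show ?thesis using gx unfolding n_def m_def I_def by linarith
qed

lemma bump_lipschitz: "\<bar>bump a - bump b\<bar> \<le> 2 * norm (a - b)"
proof -
  have e: "bump z = 1 - (min 1 (norm z))\<^sup>2" for z :: 'a
  proof (cases "norm z \<le> 1")
    case True
    then show ?thesis by (simp add: bump_def max_def power_le_one)
  qed (simp add: bump_eq_0)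
  define s t where "s = min 1 (norm a)" and "t = min 1 (norm b)"
  have st: "0 \<le> s" "s \<le> 1" "0 \<le> t" "t \<le> 1" by (auto simp: s_def t_def)
  have "\<bar>bump a - bump b\<bar> = \<bar>t - s\<bar> * \<bar>t + s\<bar>"
    unfolding e s_def[symmetric] t_def[symmetric] abs_mult[symmetric] by (simp add: power2_eq_square algebra_simps)
  also have "\<dots> \<le> \<bar>norm a - norm b\<bar> * 2"
    using st by (intro mult_mono) (auto simp: s_def t_def min_def)
  also have "\<dots> \<le> norm (a - b) * 2" by (intro mult_right_mono norm_triangle_ineq3) auto
  finally show ?thesis by simp
qed

text \<open>The two values are means of \<open>f\<close> with weights that differ by at most \<open>2 |x - x'| / \<rho>\<close>.\<close>
lemma bump_mean_value_lipschitz: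
  fixes f :: "'a::euclidean_space \<Rightarrow> complex"
  assumes f: "bump_mean_value f" and \<rho>: "0 < \<rho>" "norm x + 2 * \<rho> < 1" and x': "dist x x' \<le> \<rho>"
    and B: "\<And>y. y \<in> cball x (2 * \<rho>) \<Longrightarrow> norm (f y) \<le> B"
  shows "norm (f x' - f x) \<le> 
    (2 ^ Suc DIM('a) * unit_ball_vol (real DIM('a)) / bump_mass TYPE('a)) * B * dist x x' / \<rho>"
proof -
  define m where "m = bump_mass TYPE('a)"
  have m: "m > 0" using bump_mass_pos by (simp add: m_def)
  have c: "continuous_on (ball 0 1) f" using f by (simp add: bump_mean_value_def)
  have B0: "B \<ge> 0" by (rule order_trans[OF norm_ge_zero B[of x]]) (use \<rho> in auto)
  have nx': "norm x' + \<rho> < 1"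
  proof -
    have "norm x' \<le> norm x + dist x x'" by (rule norm_le_norm_add_dist)
    then show ?thesis using x' \<rho> by simp
  qed
  have nx: "norm x + \<rho> < 1" using \<rho> by simp
  let ?b = "\<lambda>x y. bump ((1 / \<rho>) *\<^sub>R (y - x))"
  have i: "integrable lborel (\<lambda>y. ?b x y *\<^sub>R f y)" if "norm x + \<rho> < 1" for x
    by (rule integrable_bump_scaleR(1)[OF c _ \<rho>(1)]) (use cball_subset_unit_ball[OF that] in auto)
  have vol: "measure lborel (cball x (2 * \<rho>)) = unit_ball_vol (real DIM('a)) * (2 * \<rho>) ^ DIM('a)"
    using \<rho> by (simp add: content_cball)
  have "norm (f x' - f x) * (\<rho> ^ DIM('a) * m) = norm ((\<rho> ^ DIM('a) * m) *\<^sub>R f x' - (\<rho> ^ DIM('a) * m) *\<^sub>R f x)"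
    using \<rho> m by (simp flip: scaleR_diff_right)
  also have "\<dots> = norm ((LINT y|lborel. ?b x' y *\<^sub>R f y) - (LINT y|lborel. ?b x y *\<^sub>R f y))"
    using f nx nx' \<rho> by (simp add: bump_mean_value_def m_def)
  also have "\<dots> = norm (LINT y|lborel. ?b x' y *\<^sub>R f y - ?b x y *\<^sub>R f y)"
    by (subst Bochner_Integration.integral_diff[OF i[OF nx'] i[OF nx]]) (rule refl)
  also have "\<dots> \<le> (LINT y|lborel. norm (?b x' y *\<^sub>R f y - ?b x y *\<^sub>R f y))" by (rule integral_norm_bound)
  also have "\<dots> \<le> (LINT y|lborel. (2 * dist x x' / \<rho> * B) * indicator (cball x (2 * \<rho>)) y)"
  proof (rule integral_mono)
    show "integrable lborel (\<lambda>y. norm (?b x' y *\<^sub>R f y - ?b x y *\<^sub>R f y))"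
      by (intro integrable_norm Bochner_Integration.integrable_diff i nx nx')
    show "integrable lborel (\<lambda>y. (2 * dist x x' / \<rho> * B) * indicator (cball x (2 * \<rho>)) y)"
      by (intro integrable_mult_right integrable_real_indicator)
        (use emeasure_bounded_finite[OF bounded_cball, of x "2 * \<rho>"] in auto)
    show "norm (?b x' y *\<^sub>R f y - ?b x y *\<^sub>R f y) \<le> (2 * dist x x' / \<rho> * B) * indicator (cball x (2 * \<rho>)) y" for y
    proof (cases "y \<in> cball x (2 * \<rho>)")
      case True
      have "\<bar>?b x' y - ?b x y\<bar> \<le> 2 * norm ((1 / \<rho>) *\<^sub>R (y - x') - (1 / \<rho>) *\<^sub>R (y - x))" by (rule bump_lipschitz)
      also have "\<dots> = 2 * dist x x' / \<rho>" using \<rho> by (simp add: dist_norm flip: scaleR_diff_right)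
      finally have "\<bar>?b x' y - ?b x y\<bar> * norm (f y) \<le> (2 * dist x x' / \<rho>) * B"
        using B[OF True] \<rho> by (intro mult_mono) auto
      then show ?thesis using True by (simp flip: scaleR_diff_left)
    next
      case False
      then have "\<rho> \<le> norm (y - x)" "\<rho> \<le> norm (y - x')"
        using x' \<rho> dist_triangle[of x y x'] by (auto simp: dist_norm norm_minus_commute)
      then have "?b x y = 0" "?b x' y = 0" using \<rho> by (auto intro!: bump_eq_0)
      then show ?thesis using False by simp
    qed
  qed
  also have "\<dots> = (2 * dist x x' / \<rho> * B) * (unit_ball_vol (real DIM('a)) * (2 * \<rho>) ^ DIM('a))"
    using vol by simp
  finally have "norm (f x' - f x) * (\<rho> ^ DIM('a) * m) \<le> 
     ((2 ^ Suc DIM('a) * unit_ball_vol (real DIM('a)) / m) * B * dist x x' / \<rho>) * (\<rho> ^ DIM('a) * m)"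
    using m by (simp add: power_mult_distrib field_simps)
  moreover have "0 < \<rho> ^ DIM('a) * m" using \<rho> m by simp
  ultimately show ?thesis unfolding m_def by (rule mult_right_le_imp_le)
qed

section \<open>Coefficient multipliers of homogeneous harmonic series\<close>

definition harmonic_series :: "(nat \<Rightarrow> 'a::euclidean_space \<Rightarrow> complex) \<Rightarrow> bool" where
  "harmonic_series U \<longleftrightarrow> (\<forall>k. homogeneous_harmonic_polynomial k (U k)) \<and>
     (\<forall>\<rho>. 0 < \<rho> \<longrightarrow> \<rho> < 1 \<longrightarrow> (\<exists>M. \<forall>k x. norm (U k x) \<le> M * (norm x / \<rho>) ^ k))"

definition series_sum :: "(nat \<Rightarrow> 'a \<Rightarrow> complex) \<Rightarrow> 'a \<Rightarrow> complex" where
  "series_sum U x = (\<Sum>k. U k x)"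

text \<open>Multiplication by a coefficient sequence of subexponential growth preserves the geometric bounds
  for all radii below 1.\<close>
definition tame :: "(nat \<Rightarrow> real) \<Rightarrow> bool" where
  "tame c \<longleftrightarrow> (\<forall>r. 0 < r \<longrightarrow> r < 1 \<longrightarrow> (\<exists>M. \<forall>k. \<bar>c k\<bar> * r ^ k \<le> M))"

lemma harmonic_seriesD:
  assumes "harmonic_series U"
  shows "harmonic_on UNIV (U k)" "U k (t *\<^sub>R x) = t ^ k *\<^sub>R U k x" "continuous_on S (U k)"
    "0 < \<rho> \<Longrightarrow> \<rho> < 1 \<Longrightarrow> \<exists>M. \<forall>k x. norm (U k x) \<le> M * (norm x / \<rho>) ^ k"
  using assms continuous_on_polymonial_function 
  unfolding harmonic_series_def homogeneous_harmonic_polynomial_def by blast+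

lemma tame_mult:
  assumes "tame c" "tame d"
  shows "tame (\<lambda>k. c k * d k)"
  unfolding tame_def
proof (intro allI impI)
  fix r :: real assume r: "0 < r" "r < 1"
  \<comment> \<open>the radius is split as \<open>r = sqrt r * sqrt r\<close> between the two sequences\<close>
  then have s: "0 < sqrt r" "sqrt r < 1" by auto
  obtain M where M: "\<And>k. \<bar>c k\<bar> * sqrt r ^ k \<le> M" using assms(1) s unfolding tame_def by blast
  obtain N where N: "\<And>k. \<bar>d k\<bar> * sqrt r ^ k \<le> N" using assms(2) s unfolding tame_def by blast
  have "\<bar>c k * d k\<bar> * r ^ k \<le> M * N" for k
  proof -
    have "0 \<le> \<bar>c k\<bar> * sqrt r ^ k" using s by auto
    then have "(\<bar>c k\<bar> * sqrt r ^ k) * (\<bar>d k\<bar> * sqrt r ^ k) \<le> M * N"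
      by (intro mult_mono M N order_trans[OF _ M[of k]]) (use s in auto)
    moreover have "sqrt r ^ k * sqrt r ^ k = r ^ k" using r by (simp flip: power_mult_distrib)
    ultimately show ?thesis by (simp add: abs_mult mult_ac)
  qed
  then show "\<exists>M. \<forall>k. \<bar>c k * d k\<bar> * r ^ k \<le> M" by blast
qed

definition pochhammer_ratio :: "real \<Rightarrow> real \<Rightarrow> nat \<Rightarrow> real" where
  "pochhammer_ratio a b k = pochhammer a k / pochhammer b k"

lemma pochhammer_ratio_pos: "0 < a \<Longrightarrow> 0 < b \<Longrightarrow> 0 < pochhammer_ratio a b k"
  by (simp add: pochhammer_ratio_def pochhammer_pos)

lemma pochhammer_ratio_mult:
  "0 < b \<Longrightarrow> pochhammer_ratio a b k * pochhammer_ratio b c k = pochhammer_ratio a c k"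
  using pochhammer_pos[of b k] by (simp add: pochhammer_ratio_def)

lemma pochhammer_ratio_Suc: 
  assumes "0 < (b::real)"
  shows "pochhammer_ratio (b + 1) b k = (b + k) / b"
proof -
  have "pochhammer (b + 1) k * b = (b + k) * pochhammer b k"
    using pochhammer_rec[of b k] pochhammer_rec'[of b k] by (simp add: mult.commute)
  then show ?thesis using assms pochhammer_pos[of b k] 
    by (simp add: pochhammer_ratio_def field_simps)
qed

text \<open>The quotient of consecutive terms tends to 1.\<close>
lemma tame_pochhammer_ratio:
  assumes "0 < a" "0 < b"
  shows "tame (pochhammer_ratio a b)"
  unfolding tame_def
proof (intro allI impI)
  fix r :: real assume r: "0 < r" "r < 1"
  have step: "pochhammer_ratio a b (Suc k) = pochhammer_ratio a b k * ((a + k) / (b + k))" for k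
    by (simp add: pochhammer_ratio_def pochhammer_Suc)
  have "((\<lambda>k. (a + real k) / (b + real k) * r) \<longlongrightarrow> r) sequentially"
    by real_asymp
  then have "eventually (\<lambda>k. (a + real k) / (b + real k) * r < 1) sequentially"
    by (rule order_tendstoD(2)[OF _ r(2)])
  then obtain K where K: "\<And>k. k \<ge> K \<Longrightarrow> (a + real k) / (b + real k) * r < 1"
    unfolding eventually_sequentially by blast
  define t where "t k = pochhammer_ratio a b k * r ^ k" for k
  have t0: "t k \<ge> 0" for k using pochhammer_ratio_pos[OF assms, of k] r by (simp add: t_def)
  have "t k \<le> t K" if "k \<ge> K" for k
    using that
  proof (induction k rule: dec_induct)
    case (step k)
    have "t (Suc k) = t k * ((a + real k) / (b + real k) * r)"
      using \<open>\<And>k. pochhammer_ratio a b (Suc k) = pochhammer_ratio a b k * ((a + k) / (b + k))\<close>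
      by (simp add: t_def)
    also have "\<dots> \<le> t k * 1" using K[OF step(1)] t0 by (intro mult_left_mono) auto
    finally show ?case using step by simp
  qed simp
  moreover have "t k \<le> Max (t ` {..K})" if "k \<le> K" for k using that by (intro Max_ge) auto
  ultimately have "t k \<le> Max (t ` {..K})" for k by (meson linear order_refl order_trans)
  then show "\<exists>M. \<forall>k. \<bar>pochhammer_ratio a b k\<bar> * r ^ k \<le> M"
    using pochhammer_ratio_pos[OF assms, THEN less_imp_le]
    by (intro exI[of _ "Max (t ` {..K})"] allI) (simp add: abs_of_nonneg flip: t_def)
qed

lemma harmonic_on_subset:
  assumes "harmonic_on S u" "T \<subseteq> S"
  shows "harmonic_on T u"
proof -
  obtain u' :: "'a \<Rightarrow> 'a \<Rightarrow>\<^sub>L complex" and u'' :: "'a \<Rightarrow> 'a \<Rightarrow>\<^sub>L 'a \<Rightarrow>\<^sub>L complex" where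
    "\<forall>x\<in>S. (u has_derivative blinfun_apply (u' x)) (at x)"
    "\<forall>x\<in>S. (u' has_derivative blinfun_apply (u'' x)) (at x)"
    "continuous_on S u''"
    "\<forall>x\<in>S. (\<Sum>b\<in>Basis. blinfun_apply (blinfun_apply (u'' x) b) b) = 0"
    using assms unfolding harmonic_on_def by blast
  then show ?thesis using assms(2) continuous_on_subset unfolding harmonic_on_def
    by (intro exI[of _ u'] exI[of _ u'']) blast
qed

lemma harmonic_on_scaleR:
  assumes "harmonic_on S u"
  shows "harmonic_on S (\<lambda>x. c *\<^sub>R u x)"
proof -
  obtain u' :: "'a \<Rightarrow> 'a \<Rightarrow>\<^sub>L complex" and u'' :: "'a \<Rightarrow> 'a \<Rightarrow>\<^sub>L 'a \<Rightarrow>\<^sub>L complex" where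
    u: "\<forall>x\<in>S. (u has_derivative blinfun_apply (u' x)) (at x)"
    "\<forall>x\<in>S. (u' has_derivative blinfun_apply (u'' x)) (at x)"
    "continuous_on S u''"
    "\<forall>x\<in>S. (\<Sum>b\<in>Basis. blinfun_apply (blinfun_apply (u'' x) b) b) = 0"
    using assms unfolding harmonic_on_def by blast
  have "((\<lambda>x. c *\<^sub>R u x) has_derivative blinfun_apply (c *\<^sub>R u' x)) (at x)" if "x \<in> S" for x
    using has_derivative_scaleR_right[of u "blinfun_apply (u' x)" "at x" c] u(1) that 
    by (simp add: scaleR_blinfun.rep_eq)
  moreover have "((\<lambda>x. c *\<^sub>R u' x) has_derivative blinfun_apply (c *\<^sub>R u'' x)) (at x)" if "x \<in> S" for x
    using has_derivative_scaleR_right[of u' "blinfun_apply (u'' x)" "at x" c] u(2) that 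
    by (simp add: scaleR_blinfun.rep_eq)
  moreover have "continuous_on S (\<lambda>x. c *\<^sub>R u'' x)" using u(3) by (intro continuous_intros)
  moreover have "(\<Sum>b\<in>Basis. blinfun_apply (blinfun_apply (c *\<^sub>R u'' x) b) b) = 0" if "x \<in> S" for x
    using u(4) that by (simp add: scaleR_blinfun.rep_eq flip: scaleR_sum_right)
  ultimately show ?thesis unfolding harmonic_on_def
    by (intro exI[of _ "\<lambda>x. c *\<^sub>R u' x"] exI[of _ "\<lambda>x. c *\<^sub>R u'' x"]) blast
qed

text \<open>Half of the room between \<open>\<rho>\<close> and 1, on a logarithmic scale, is given to the multiplier.\<close>
lemma harmonic_series_multiplier:
  assumes U: "harmonic_series U" and c: "tame c"
  shows "harmonic_series (\<lambda>k x. c k *\<^sub>R U k x)"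
  unfolding harmonic_series_def
proof (intro conjI allI impI)
  fix k
  show "homogeneous_harmonic_polynomial k (\<lambda>x. c k *\<^sub>R U k x)"
    using U unfolding harmonic_series_def homogeneous_harmonic_polynomial_def
    by (auto intro!: harmonic_on_scaleR simp: scaleR_left_commute)
next
  fix \<rho> :: real assume \<rho>: "0 < \<rho>" "\<rho> < 1"
  then have s: "0 < sqrt \<rho>" "sqrt \<rho> < 1" by auto
  obtain M where M: "\<And>k x. norm (U k x) \<le> M * (norm x / sqrt \<rho>) ^ k" 
    using harmonic_seriesD(4)[OF U s] by blast
  obtain N where N: "\<And>k. \<bar>c k\<bar> * sqrt \<rho> ^ k \<le> N" using c s unfolding tame_def by blast
  have "norm (U 0 0) \<le> M" using M[of 0 0] by simp
  then have M0: "M \<ge> 0" using norm_ge_zero order_trans by blast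
  have "norm (c k *\<^sub>R U k x) \<le> (N * M) * (norm x / \<rho>) ^ k" for k x
  proof -
    have "\<bar>c k\<bar> \<le> N / sqrt \<rho> ^ k" using N[of k] s by (simp add: pos_le_divide_eq)
    then have "norm (c k *\<^sub>R U k x) \<le> (N / sqrt \<rho> ^ k) * (M * (norm x / sqrt \<rho>) ^ k)"
      unfolding norm_scaleR using M[of k x] by (intro mult_mono) (auto intro: order_trans[OF abs_ge_zero])
    also have "\<dots> = (N * M) * (norm x / \<rho>) ^ k"
    proof -
      have "sqrt \<rho> ^ k * sqrt \<rho> ^ k = \<rho> ^ k" using \<rho> by (simp flip: power_mult_distrib)
      then show ?thesis by (simp add: power_divide mult_ac)
    qed
    finally show ?thesis .
  qed
  then show "\<exists>M. \<forall>k x. norm (c k *\<^sub>R U k x) \<le> M * (norm x / \<rho>) ^ k" by blast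
qed

lemma harmonic_series_summable:
  assumes U: "harmonic_series U" and x: "norm x < 1"
  shows "summable (\<lambda>k. norm (U k x))"
proof -
  define \<rho> where "\<rho> = (norm x + 1) / 2"
  have \<rho>: "0 < \<rho>" "\<rho> < 1" "norm x < \<rho>" using x by (simp_all add: \<rho>_def add_nonneg_pos)
  obtain M where M: "\<And>k x. norm (U k x) \<le> M * (norm x / \<rho>) ^ k"
    using harmonic_seriesD(4)[OF U \<rho>(1,2)] by blast
  have "summable (\<lambda>k. M * (norm x / \<rho>) ^ k)"
    using \<rho> by (intro summable_mult summable_geometric) auto
  then show ?thesis by (rule summable_comparison_test') (use M in auto)
qed

lemma series_sum_bump_mean_value:
  fixes U :: "nat \<Rightarrow> 'a::euclidean_space \<Rightarrow> complex"
  assumes U: "harmonic_series U"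
  shows "bump_mean_value (series_sum U)"
proof -
  have unif: "\<exists>M r. 0 \<le> r \<and> r < 1 \<and> 0 \<le> M \<and> (\<forall>k y. norm y \<le> R \<longrightarrow> norm (U k y) \<le> M * r ^ k)" if R: "0 \<le> R" "R < 1" for R
  proof -
    define \<rho> where "\<rho> = (R + 1) / 2"
    have \<rho>: "0 < \<rho>" "\<rho> < 1" "R < \<rho>" using R by (auto simp: \<rho>_def)
    obtain M where M: "\<And>k x. norm (U k x) \<le> M * (norm x / \<rho>) ^ k"
      using harmonic_seriesD(4)[OF U \<rho>(1,2)] by blast
    have "norm (U 0 0) \<le> M" using M[of 0 0] by simp
    then have M0: "M \<ge> 0" using norm_ge_zero order_trans by blast
    have "norm (U k y) \<le> M * (R / \<rho>) ^ k" if "norm y \<le> R" for k y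
      by (rule order_trans[OF M]) (use that \<rho> M0 in \<open>intro mult_left_mono power_mono divide_right_mono, auto\<close>)
    then show ?thesis using R \<rho> M0 by (intro exI[of _ M] exI[of _ "R / \<rho>"]) auto
  qed
  have mv: "bump_mean_value (U k)" for k
    by (intro harmonic_imp_bump_mean_value harmonic_on_subset[OF harmonic_seriesD(1)[OF U, of k]]) auto
  have cont: "continuous_on (ball 0 1) (series_sum U)"
  proof (intro continuous_at_imp_continuous_on ballI)
    fix x :: 'a assume x: "x \<in> ball 0 1"
    define R where "R = (norm x + 1) / 2"
    have R: "0 \<le> R" "R < 1" "norm x < R" using x by (auto simp: R_def)
    obtain M r where Mr: "0 \<le> r" "r < 1" "0 \<le> M" "\<And>k y. norm y \<le> R \<Longrightarrow> norm (U k y) \<le> M * r ^ k"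
      using unif[OF R(1,2)] by blast
    have "uniform_limit (cball 0 R) (\<lambda>n x. \<Sum>k<n. U k x) (\<lambda>x. \<Sum>k. U k x) sequentially"
      by (rule Weierstrass_m_test[where M="\<lambda>k. M * r ^ k"]) 
        (use Mr in \<open>auto intro!: summable_mult summable_geometric\<close>)
    then have "continuous_on (cball 0 R) (\<lambda>x. \<Sum>k. U k x)"
      by (rule uniform_limit_theorem[rotated])
        (auto intro!: always_eventually continuous_on_sum harmonic_seriesD(3)[OF U])
    then have "continuous_on (ball 0 R) (series_sum U)"
      unfolding series_sum_def[abs_def] by (rule continuous_on_subset) auto
    then show "isCont (series_sum U) x" using R by (simp add: continuous_on_eq_continuous_at)
  qed
  show ?thesis unfolding bump_mean_value_def
  proof (intro conjI allI impI cont)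
    fix x :: 'a and \<delta> :: real assume \<delta>: "0 < \<delta>" "norm x + \<delta> < 1"
    define R where "R = norm x + \<delta>"
    have R: "0 \<le> R" "R < 1" using \<delta> by (auto simp: R_def)
    obtain M r where Mr: "0 \<le> r" "r < 1" "0 \<le> M" "\<And>k y. norm y \<le> R \<Longrightarrow> norm (U k y) \<le> M * r ^ k"
      using unif[OF R] by blast
    let ?b = "\<lambda>y. bump ((1 / \<delta>) *\<^sub>R (y - x))"
    have sub: "cball x \<delta> \<subseteq> ball 0 1" using \<delta> by (intro cball_subset_unit_ball)
    have b0: "?b y = 0 \<or> norm y \<le> R" for y
    proof (cases "dist x y \<le> \<delta>")
      case True
      then have "norm y \<le> R" using norm_le_norm_add_dist[of y x] by (simp add: R_def)
      then show ?thesis ..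
    next
      case False
      then show ?thesis using \<delta> by (simp add: bump_scaled_eq_0)
    qed
    have ib: "integrable lborel ?b"
      by (rule integrable_compact_support[of _ "cball x \<delta>"])
        (use \<delta> in \<open>auto intro!: continuous_intros bump_scaled_eq_0\<close>)
    have i: "integrable lborel (\<lambda>y. ?b y *\<^sub>R U k y)" for k
      by (rule integrable_bump_scaleR(1)[OF harmonic_seriesD(3)[OF U] _ \<delta>(1) sub]) simp
    have bb: "norm (?b y *\<^sub>R U k y) \<le> (M * ?b y) * r ^ k" for k y
    proof (cases "?b y = 0")
      case False
      then have "?b y * norm (U k y) \<le> ?b y * (M * r ^ k)" using b0[of y] by (intro mult_left_mono Mr(4)) auto
      then show ?thesis by (simp add: mult_ac)
    qed simp
    have "(\<lambda>k. LINT y|lborel. ?b y *\<^sub>R U k y) sums (LINT y|lborel. (\<Sum>k. ?b y *\<^sub>R U k y))"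
      by (rule sums_integral_geometric[OF i _ bb]) (use ib Mr in auto)
    also have "(\<lambda>k. LINT y|lborel. ?b y *\<^sub>R U k y) = (\<lambda>k. (\<delta> ^ DIM('a) * bump_mass TYPE('a)) *\<^sub>R U k x)"
      using mv \<delta> by (auto simp: bump_mean_value_def)
    also have "(LINT y|lborel. (\<Sum>k. ?b y *\<^sub>R U k y)) = (LINT y|lborel. ?b y *\<^sub>R series_sum U y)"
    proof (rule Bochner_Integration.integral_cong[OF refl])
      fix y
      show "(\<Sum>k. ?b y *\<^sub>R U k y) = ?b y *\<^sub>R series_sum U y"
      proof (cases "?b y = 0")
        case False
        then have "norm y < 1" using b0[of y] R by auto
        then have "summable (\<lambda>k. U k y)" by (rule summable_norm_cancel[OF harmonic_series_summable[OF U]])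
        then show ?thesis unfolding series_sum_def by (rule suminf_scaleR_right[symmetric])
      qed simp
    qed
    finally have "(\<lambda>k. (\<delta> ^ DIM('a) * bump_mass TYPE('a)) *\<^sub>R U k x) sums (LINT y|lborel. ?b y *\<^sub>R series_sum U y)" .
    moreover have "summable (\<lambda>k. U k x)" 
      by (rule summable_norm_cancel[OF harmonic_series_summable[OF U]]) (use \<delta> in simp)
    then have "(\<lambda>k. (\<delta> ^ DIM('a) * bump_mass TYPE('a)) *\<^sub>R U k x) sums ((\<delta> ^ DIM('a) * bump_mass TYPE('a)) *\<^sub>R series_sum U x)"
      unfolding series_sum_def by (rule sums_scaleR_right[OF summable_sums])
    ultimately show "(LINT y|lborel. ?b y *\<^sub>R series_sum U y) = (\<delta> ^ DIM('a) * bump_mass TYPE('a)) *\<^sub>R series_sum U x"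
      by (rule sums_unique2)
  qed
qed

section \<open>Multipliers of derivative type\<close>

text \<open>The function \<open>f\<close> is a coefficient multiplier of \<open>v\<close>, and \<open>N\<close> counts the powers of the distance to the
  boundary that its local estimate costs.\<close>
definition locally_controlled ::
    "real \<Rightarrow> real \<Rightarrow> real \<Rightarrow> ('a::euclidean_space \<Rightarrow> complex) \<Rightarrow> ('a \<Rightarrow> complex) \<Rightarrow> bool" where
  "locally_controlled p N C v f \<longleftrightarrow> (\<forall>x \<delta>. 0 < \<delta> \<longrightarrow> norm x + \<delta> < 1 \<longrightarrow>
     norm (f x) \<le> C * \<delta> powr (- N) * (LINT y:cball x \<delta>|lborel. norm (v y) powr p) powr (1 / p))"

lemma bump_mean_value_locally_controlled:
  fixes v :: "'a::euclidean_space \<Rightarrow> complex"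
  assumes v: "bump_mean_value v" and p: "0 < p" "p \<le> 1"
  shows "locally_controlled p (real DIM('a) / p) ((2 powr (real DIM('a) / p) / bump_mass TYPE('a)) powr (1 / p)) v v"
  unfolding locally_controlled_def
proof (intro allI impI)
  fix x :: 'a and \<delta> :: real assume \<delta>: "0 < \<delta>" "norm x + \<delta> < 1"
  define I where "I = (LINT y:cball x \<delta>|lborel. norm (v y) powr p)"
  define c where "c = 2 powr (real DIM('a) / p) / bump_mass TYPE('a)"
  have c: "c \<ge> 0" using bump_mass_pos[where 'a='a] by (simp add: c_def)
  have I: "I \<ge> 0" unfolding I_def set_lebesgue_integral_def by (intro Bochner_Integration.integral_nonneg) auto
  have "norm (v x) powr p * \<delta> ^ DIM('a) \<le> c * I"
    unfolding c_def I_def by (rule norm_powr_sub_mean_value[OF v \<delta> p])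
  then have "norm (v x) powr p \<le> (c * I) * \<delta> powr (- real DIM('a))"
    using \<delta> by (simp add: powr_minus powr_realpow field_simps)
  then have "(norm (v x) powr p) powr (1 / p) \<le> ((c * I) * \<delta> powr (- real DIM('a))) powr (1 / p)"
    using p by (intro powr_mono2) auto
  then show "norm (v x) \<le> c powr (1 / p) * \<delta> powr (- (real DIM('a) / p)) * I powr (1 / p)"
    using p c I by (simp add: powr_powr powr_mult mult_ac)
qed

text \<open>The sum is the derivative of \<open>r \<mapsto> series_sum U (r x)\<close> at \<open>r = 1\<close>, a limit of difference quotients to which
  the Lipschitz estimate applies.\<close>
lemma norm_radial_derivative_le:
  fixes U :: "nat \<Rightarrow> 'a::euclidean_space \<Rightarrow> complex"
  assumes U: "harmonic_series U" and \<rho>: "0 < \<rho>" "norm x + 2 * \<rho> < 1"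
    and B: "\<And>y. y \<in> cball x (2 * \<rho>) \<Longrightarrow> norm (series_sum U y) \<le> B"
  shows "norm (\<Sum>k. real k *\<^sub>R U k x) \<le> 
    (2 ^ Suc DIM('a) * unit_ball_vol (real DIM('a)) / bump_mass TYPE('a)) * B / \<rho>"
    and "summable (\<lambda>k. real k *\<^sub>R U k x)"
proof -
  define L where "L = 2 ^ Suc DIM('a) * unit_ball_vol (real DIM('a)) / bump_mass TYPE('a)"
  have L: "L \<ge> 0" using bump_mass_pos[where 'a='a] by (simp add: L_def)
  have B0: "B \<ge> 0" by (rule order_trans[OF norm_ge_zero B[of x]]) (use \<rho> in auto)
  have x1: "norm x < 1" using \<rho> by simp
  \<comment> \<open>a factor \<open>R > 1\<close> for which \<open>R x\<close> is still in the ball, so that the series converges beyond \<open>r = 1\<close>\<close>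
  define R where "R = 2 / (1 + norm x)"
  have p1: "1 + norm x > 0" by (simp add: add_pos_nonneg)
  have R: "R > 1" using x1 p1 by (simp add: R_def less_divide_eq)
  have "R * norm x < 1" using x1 p1 by (simp add: R_def divide_less_eq)
  then have "norm (R *\<^sub>R x) < 1" using R by simp
  then have "summable (\<lambda>k. norm (U k (R *\<^sub>R x)))" by (rule harmonic_series_summable[OF U])
  then have "summable (\<lambda>k. U k (R *\<^sub>R x))" by (rule summable_norm_cancel)
  then have sR: "summable (\<lambda>k. U k x * of_real R ^ k)"
    by (simp add: harmonic_seriesD(2)[OF U] scaleR_conv_of_real mult.commute)
  define F where "F z = (\<Sum>k. U k x * z ^ k)" for z :: complex
  define S where "S = (\<Sum>k. diffs (\<lambda>k. U k x) k * 1 ^ k)"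
  have dF: "(F has_field_derivative S) (at 1)"
    unfolding F_def[abs_def] S_def by (rule termdiffs_strong[OF sR]) (use R in simp)
  have "summable (\<lambda>k. diffs (\<lambda>k. U k x) k * 1 ^ k)"
    by (rule termdiff_converges[of _ R]) (use R sR powser_inside in \<open>auto intro: powser_inside[OF sR]\<close>)
  then have "(\<lambda>k. of_nat k * U k x * 1 ^ (k - Suc 0)) sums S" unfolding S_def by (rule diffs_equiv)
  then have S: "(\<lambda>k. real k *\<^sub>R U k x) sums S" by (simp add: scaleR_conv_of_real)
  then show "summable (\<lambda>k. real k *\<^sub>R U k x)" by (rule sums_summable)
  have Fr: "F (of_real r) = series_sum U (r *\<^sub>R x)" for r
    by (simp add: F_def series_sum_def harmonic_seriesD(2)[OF U] scaleR_conv_of_real mult.commute)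
  define h where "h j = \<rho> * inverse (real (Suc j))" for j
  have h: "0 < h j" "h j \<le> \<rho>" for j
  proof -
    show "0 < h j" using \<rho> by (simp add: h_def)
    have "inverse (real (Suc j)) \<le> 1" by (simp add: inverse_le_1_iff)
    then show "h j \<le> \<rho>" using \<rho> mult_left_mono[of "inverse (real (Suc j))" 1 \<rho>] by (simp add: h_def)
  qed
  have "h \<longlonglongrightarrow> \<rho> * 0" unfolding h_def[abs_def] by (intro tendsto_intros LIMSEQ_inverse_real_of_nat)
  then have "(\<lambda>j. complex_of_real (h j)) \<longlonglongrightarrow> of_real 0" by (intro tendsto_of_real) simp
  then have "filterlim (\<lambda>j. complex_of_real (h j)) (at 0) sequentially"
    using h by (auto simp: filterlim_at intro!: always_eventually) (metis less_irrefl)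
  then have lim: "(\<lambda>j. (F (1 + of_real (h j)) - F 1) / of_real (h j)) \<longlonglongrightarrow> S"
    using dF unfolding DERIV_def by (rule filterlim_compose[rotated])
  have "norm S \<le> L * B / \<rho>"
  proof (rule tendsto_upperbound[OF tendsto_norm[OF lim]])
    show "\<forall>\<^sub>F j in sequentially. norm ((F (1 + of_real (h j)) - F 1) / of_real (h j)) \<le> L * B / \<rho>"
    proof (intro always_eventually allI)
      fix j
      have d: "dist x ((1 + h j) *\<^sub>R x) = h j * norm x"
        using h[of j] by (simp add: dist_norm algebra_simps)
      have "h j * norm x \<le> h j * 1" using h[of j] x1 by (intro mult_left_mono) auto
      then have d1: "dist x ((1 + h j) *\<^sub>R x) \<le> h j" unfolding d by simp
      have "F (1 + of_real (h j)) - F 1 = series_sum U ((1 + h j) *\<^sub>R x) - series_sum U x"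
        using Fr[of "1 + h j"] Fr[of 1] by simp
      also have "norm \<dots> \<le> L * B * dist x ((1 + h j) *\<^sub>R x) / \<rho>"
        unfolding L_def
        by (rule bump_mean_value_lipschitz[OF series_sum_bump_mean_value[OF U] \<rho> order_trans[OF d1 h(2)] B])
      also have "\<dots> \<le> L * B * h j / \<rho>"
        using d1 L B0 \<rho> by (intro divide_right_mono mult_left_mono) auto
      finally show "norm ((F (1 + of_real (h j)) - F 1) / of_real (h j)) \<le> L * B / \<rho>"
        using h[of j] \<rho> by (simp add: norm_divide field_simps)
    qed
  qed simp
  then show "norm (\<Sum>k. real k *\<^sub>R U k x) \<le> 
    (2 ^ Suc DIM('a) * unit_ball_vol (real DIM('a)) / bump_mass TYPE('a)) * B / \<rho>"
    using S by (simp add: L_def sums_iff)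
qed

text \<open>The multiplier \<open>(b + 1)\<^sub>k / (b)\<^sub>k = 1 + k/b\<close> adds a multiple of the radial derivative. That derivative is
  estimated by the values on a ball of half the radius, where the given control applies.\<close>
lemma locally_controlled_raise:
  fixes b N :: real
  assumes b: "b > 0"
  obtains K where "K \<ge> 0" 
    "\<And>(U :: nat \<Rightarrow> 'a::euclidean_space \<Rightarrow> complex) v p C. harmonic_series U \<Longrightarrow> continuous_on (ball 0 1) v \<Longrightarrow>
       p > 0 \<Longrightarrow> C \<ge> 0 \<Longrightarrow> locally_controlled p N C v (series_sum U) \<Longrightarrow>
       locally_controlled p (N + 1) (K * C) v (series_sum (\<lambda>k x. pochhammer_ratio (b + 1) b k *\<^sub>R U k x))"
proof -
  define L where "L = 2 ^ Suc DIM('a) * unit_ball_vol (real DIM('a)) / bump_mass TYPE('a)"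
  have L: "L \<ge> 0" using bump_mass_pos[where 'a='a] by (simp add: L_def)
  define K where "K = (1 + 4 * L / b) * (1 / 2) powr (- N)"
  have K: "K \<ge> 0" using L b by (simp add: K_def)
  have "locally_controlled p (N + 1) (K * C) v (series_sum (\<lambda>k x. pochhammer_ratio (b + 1) b k *\<^sub>R U k x))"
    if U: "harmonic_series U" and v: "continuous_on (ball 0 1) v" and p: "p > 0" and C: "C \<ge> 0" 
      and lc: "locally_controlled p N C v (series_sum U)" for U and v :: "'a \<Rightarrow> complex" and p C
    unfolding locally_controlled_def
  proof (intro allI impI)
    fix x :: 'a and \<delta> :: real assume \<delta>: "0 < \<delta>" "norm x + \<delta> < 1"
    define I where "I = (LINT y:cball x \<delta>|lborel. norm (v y) powr p)"
    have \<delta>1: "\<delta> < 1" using \<delta> norm_ge_zero[of x] by linarith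
    define B where "B = C * (\<delta> / 2) powr (- N) * I powr (1 / p)"
    have B0: "B \<ge> 0" using C by (simp add: B_def)
    have B: "norm (series_sum U y) \<le> B" if y: "y \<in> cball x (\<delta> / 2)" for y
    proof -
      have "norm y \<le> norm x + dist x y" by (rule norm_le_norm_add_dist)
      then have ny: "norm y + \<delta> / 2 < 1" using y \<delta> by (simp add: field_simps)
      have sub: "cball y (\<delta> / 2) \<subseteq> cball x \<delta>" using y by (intro cball_subset_cball_dist) (simp add: field_simps)
      have 0: "0 \<le> (LINT z:cball y (\<delta> / 2)|lborel. norm (v z) powr p)"
        unfolding set_lebesgue_integral_def by (intro Bochner_Integration.integral_nonneg) auto
      have "(LINT z:cball y (\<delta> / 2)|lborel. norm (v z) powr p) \<le> I"
        unfolding I_def by (intro set_integral_mono_set set_integrable_norm_powr v \<delta> p sub) auto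
      then have "(LINT z:cball y (\<delta> / 2)|lborel. norm (v z) powr p) powr (1 / p) \<le> I powr (1 / p)"
        using p 0 by (intro powr_mono2) auto
      then have "C * (\<delta> / 2) powr (- N) * (LINT z:cball y (\<delta> / 2)|lborel. norm (v z) powr p) powr (1 / p) \<le> B"
        unfolding B_def using C by (intro mult_left_mono) auto
      moreover have "norm (series_sum U y) \<le> C * (\<delta> / 2) powr (- N) * (LINT z:cball y (\<delta> / 2)|lborel. norm (v z) powr p) powr (1 / p)"
        using lc ny \<delta> unfolding locally_controlled_def by simp
      ultimately show ?thesis by linarith
    qed
    have \<rho>: "0 < \<delta> / 4" "norm x + 2 * (\<delta> / 4) < 1" using \<delta> by auto
    have B': "norm (series_sum U y) \<le> B" if "y \<in> cball x (2 * (\<delta> / 4))" for y using B that by simp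
    note rd = norm_radial_derivative_le[OF U \<rho> B', folded L_def]
    have s0: "(\<lambda>k. U k x) sums series_sum U x"
      unfolding series_sum_def
      by (rule summable_sums[OF summable_norm_cancel[OF harmonic_series_summable[OF U]]]) (use \<delta> in simp)
    have "(\<lambda>k. U k x + (1 / b) *\<^sub>R (real k *\<^sub>R U k x)) sums (series_sum U x + (1 / b) *\<^sub>R (\<Sum>k. real k *\<^sub>R U k x))"
      by (rule sums_add[OF s0 sums_scaleR_right[OF summable_sums[OF rd(2)]]])
    moreover have "U k x + (1 / b) *\<^sub>R (real k *\<^sub>R U k x) = pochhammer_ratio (b + 1) b k *\<^sub>R U k x" for k
    proof -
      have "pochhammer_ratio (b + 1) b k = 1 + (1 / b) * real k"
        unfolding pochhammer_ratio_Suc[OF b] using b by (simp add: field_simps)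
      then show ?thesis by (simp add: scaleR_add_left)
    qed
    ultimately have "series_sum (\<lambda>k x. pochhammer_ratio (b + 1) b k *\<^sub>R U k x) x = 
        series_sum U x + (1 / b) *\<^sub>R (\<Sum>k. real k *\<^sub>R U k x)"
      unfolding series_sum_def[of "\<lambda>k x. pochhammer_ratio (b + 1) b k *\<^sub>R U k x"] by (simp add: sums_iff)
    also have "norm \<dots> \<le> B + (1 / b) * (L * B / (\<delta> / 4))"
    proof (rule order_trans[OF norm_triangle_ineq add_mono])
      show "norm (series_sum U x) \<le> B" using B \<delta> by simp
      show "norm ((1 / b) *\<^sub>R (\<Sum>k. real k *\<^sub>R U k x)) \<le> (1 / b) * (L * B / (\<delta> / 4))"
        using mult_left_mono[OF rd(1), of "1 / b"] b by simp
    qed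
    also have "\<dots> \<le> B / \<delta> + (1 / b) * (L * B / (\<delta> / 4))"
      using B0 \<delta> \<delta>1 by (simp add: le_divide_eq mult_left_le)
    also have "\<dots> = (1 + 4 * L / b) * (B / \<delta>)" using \<delta> b by (simp add: field_simps)
    also have "\<dots> = K * C * \<delta> powr (- (N + 1)) * I powr (1 / p)"
    proof -
      have "(\<delta> / 2) powr (- N) = \<delta> powr (- N) * (1 / 2) powr (- N)"
        using powr_mult[of \<delta> "1/2" "- N"] \<delta> by simp
      moreover have "\<delta> powr (- (N + 1)) = \<delta> powr (- N) / \<delta>"
        using \<delta> powr_diff[of \<delta> "- N" 1] by simp
      ultimately show ?thesis by (simp add: K_def B_def)
    qed
    finally show "norm (series_sum (\<lambda>k x. pochhammer_ratio (b + 1) b k *\<^sub>R U k x) x) \<le> 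
      K * C * \<delta> powr (- (N + 1)) * (LINT y:cball x \<delta>|lborel. norm (v y) powr p) powr (1 / p)"
      unfolding I_def .
  qed
  with K show thesis by (rule that)
qed

lemma locally_controlled_raise_iterate:
  fixes b N :: real
  assumes b: "b > 0"
  shows "\<exists>K\<ge>0. \<forall>(U :: nat \<Rightarrow> 'a::euclidean_space \<Rightarrow> complex) v p C. harmonic_series U \<longrightarrow> continuous_on (ball 0 1) v \<longrightarrow>
       p > 0 \<longrightarrow> C \<ge> 0 \<longrightarrow> locally_controlled p N C v (series_sum U) \<longrightarrow>
       locally_controlled p (N + m) (K * C) v (series_sum (\<lambda>k x. pochhammer_ratio (b + real m) b k *\<^sub>R U k x))"
proof (induction m)
  case 0
  have "pochhammer_ratio b b k = 1" for k using b pochhammer_pos[of b k] by (simp add: pochhammer_ratio_def)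
  then show ?case by (intro exI[of _ 1]) simp
next
  case (Suc m)
  then obtain K where K: "K \<ge> 0" "\<And>(U :: nat \<Rightarrow> 'a \<Rightarrow> complex) v p C. harmonic_series U \<Longrightarrow> continuous_on (ball 0 1) v \<Longrightarrow>
       p > 0 \<Longrightarrow> C \<ge> 0 \<Longrightarrow> locally_controlled p N C v (series_sum U) \<Longrightarrow>
       locally_controlled p (N + m) (K * C) v (series_sum (\<lambda>k x. pochhammer_ratio (b + real m) b k *\<^sub>R U k x))"
    by blast
  have bm: "b + real m > 0" using b by simp
  obtain K' where K': "K' \<ge> 0" "\<And>(U :: nat \<Rightarrow> 'a \<Rightarrow> complex) v p C. harmonic_series U \<Longrightarrow> continuous_on (ball 0 1) v \<Longrightarrow>
       p > 0 \<Longrightarrow> C \<ge> 0 \<Longrightarrow> locally_controlled p (N + m) C v (series_sum U) \<Longrightarrow>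
       locally_controlled p (N + m + 1) (K' * C) v (series_sum (\<lambda>k x. pochhammer_ratio (b + real m + 1) (b + real m) k *\<^sub>R U k x))"
    by (rule locally_controlled_raise[OF bm, of "N + m"]) (rule that)
  have "locally_controlled p (N + Suc m) (K' * K * C) v (series_sum (\<lambda>k x. pochhammer_ratio (b + real (Suc m)) b k *\<^sub>R U k x))"
    if U: "harmonic_series U" and v: "continuous_on (ball 0 1) v" and p: "p > 0" and C: "C \<ge> 0" 
      and lc: "locally_controlled p N C v (series_sum U)" for U and v :: "'a \<Rightarrow> complex" and p C
  proof -
    have "harmonic_series (\<lambda>k x. pochhammer_ratio (b + real m) b k *\<^sub>R U k x)"
      by (intro harmonic_series_multiplier U tame_pochhammer_ratio b bm)
    from K'(2)[OF this v p _ K(2)[OF U v p C lc]] K(1) C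
    have "locally_controlled p (N + m + 1) (K' * (K * C)) v
       (series_sum (\<lambda>k x. pochhammer_ratio (b + real m + 1) (b + real m) k *\<^sub>R pochhammer_ratio (b + real m) b k *\<^sub>R U k x))"
      by simp
    then show ?thesis using pochhammer_ratio_mult[OF bm, of "b + real m + 1" _ b] by (simp add: ac_simps)
  qed
  then show ?case using K(1) K'(1) by (intro exI[of _ "K' * K"]) auto
qed

section \<open>Multipliers of moment type\<close>

text \<open>The density of the Beta distribution with parameters \<open>a\<close> and \<open>b - a\<close>. The mass near 1 is governed by its
  factor \<open>(1 - q)\<close> to the power \<open>b - a - 1\<close>.\<close>
lemma beta_moments:
  fixes a b :: real
  assumes ab: "0 < a" "a < b"
  obtains w :: "real \<Rightarrow> real" and K where "K \<ge> 0" "\<And>q. w q \<ge> 0" "\<And>q. q \<notin> {0..1} \<Longrightarrow> w q = 0"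
    "\<And>k. integrable lebesgue (\<lambda>q. q ^ k * w q)"
    "\<And>k. (LINT q|lebesgue. q ^ k * w q) = pochhammer_ratio a b k"
    "\<And>j. (LINT q|lebesgue. indicator {1 - (1/2) ^ j..1} q * w q) \<le> K * ((1/2) ^ j) powr (b - a)"
proof -
  define c where "c = b - a"
  have c: "c > 0" using ab by (simp add: c_def)
  define g where "g a q = q powr (a - 1) * (1 - q) powr (c - 1)" for a q :: real
  define W where "W = Beta a c"
  have W: "W > 0" unfolding W_def Beta_def using ab c by (intro divide_pos_pos mult_pos_pos Gamma_real_pos) auto
  define w where "w q = indicator {0..1} q * (g a q / W)" for q :: real
  have w0: "w q \<ge> 0" for q using W by (simp add: w_def g_def)
  have gi: "(\<lambda>q. g a' q) absolutely_integrable_on {0..1}" "(LINT q:{0..1}|lebesgue. g a' q) = Beta a' c" 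
    if "a' > 0" for a'
  proof -
    have h: "(g a' has_integral Beta a' c) {0..1}"
      unfolding g_def[abs_def] by (rule has_integral_Beta_real[OF that c])
    show ai: "(\<lambda>q. g a' q) absolutely_integrable_on {0..1}"
      by (rule nonnegative_absolutely_integrable_1[OF has_integral_integrable[OF h]]) (simp add: g_def)
    show "(LINT q:{0..1}|lebesgue. g a' q) = Beta a' c"
      unfolding set_lebesgue_integral_eq_integral(2)[OF ai] using h by (rule integral_unique)
  qed
  have gm: "q ^ k * w q = (1 / W) * (indicator {0..1} q *\<^sub>R g (a + k) q)" for q k
  proof (cases "q \<in> {0<..1}")
    case True
    then have "q ^ k * q powr (a - 1) = q powr (a + k - 1)"
      by (simp add: powr_realpow[symmetric] powr_add[symmetric] algebra_simps)
    then show ?thesis using True by (simp add: w_def g_def)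
  next
    case False
    then show ?thesis by (cases "q = 0") (auto simp: w_def g_def indicator_def)
  qed
  have ak: "a + real k > 0" for k using ab by simp
  have imom: "integrable lebesgue (\<lambda>q. q ^ k * w q)" for k
    unfolding gm using gi(1)[OF ak[of k]] by (auto simp: set_integrable_def)
  have mom: "(LINT q|lebesgue. q ^ k * w q) = pochhammer_ratio a b k" for k
  proof -
    have "(LINT q|lebesgue. q ^ k * w q) = (1 / W) * Beta (a + k) c"
      unfolding gm using gi(2)[OF ak[of k]] by (simp add: set_lebesgue_integral_def)
    moreover have "a \<notin> \<int>\<^sub>\<le>\<^sub>0" "b \<notin> \<int>\<^sub>\<le>\<^sub>0" using ab by auto
    then have "pochhammer_ratio a b k = (Gamma (a + k) / Gamma a) / (Gamma (b + k) / Gamma b)"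
      by (simp add: pochhammer_ratio_def pochhammer_Gamma)
    moreover have "(1 / W) * Beta (a + k) c = (Gamma (a + k) / Gamma a) / (Gamma (b + k) / Gamma b)"
    proof -
      have "Gamma a > 0" "Gamma b > 0" "Gamma c > 0" "Gamma (b + k) > 0" 
        using ab c by (auto intro!: Gamma_real_pos)
      then show ?thesis by (simp add: W_def Beta_def c_def field_simps)
    qed
    ultimately show ?thesis by (simp only:)
  qed
  \<comment> \<open>\<open>M\<close> bounds \<open>q powr (a - 1)\<close> for \<open>q \<ge> 1/2\<close>; the case \<open>j = 0\<close> only uses that the total mass is 1\<close>
  define M where "M = max 1 (2 powr (1 - a))"
  define K where "K = max 1 (M / (W * c))"
  have tail: "(LINT q|lebesgue. indicator {1 - (1/2) ^ j..1} q * w q) \<le> K * ((1/2) ^ j) powr c" for j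
  proof (cases j)
    case 0
    have "(LINT q|lebesgue. indicator {1 - (1/2) ^ j..1} q * w q) = (LINT q|lebesgue. q ^ 0 * w q)"
      by (rule Bochner_Integration.integral_cong) (auto simp: 0 w_def indicator_def)
    also have "\<dots> = 1" unfolding mom by (simp add: pochhammer_ratio_def)
    finally show ?thesis using 0 by (simp add: K_def)
  next
    case (Suc i)
    define h where "h = (1/2 :: real) ^ j"
    have h: "0 < h" "h \<le> 1/2" using power_decreasing[of 1 j "1/2::real"] Suc by (auto simp: h_def)
    have hi: "((\<lambda>q. (1 - q) powr (c - 1)) has_integral (- ((1 - 1) powr c / c) - - ((1 - (1 - h)) powr c / c))) {1 - h..1}"
    proof (rule fundamental_theorem_of_calculus_interior)
      show "continuous_on {1 - h..1} (\<lambda>q. - ((1 - q) powr c / c))"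
        using c by (intro continuous_intros continuous_on_powr') auto
      show "((\<lambda>q. - ((1 - q) powr c / c)) has_vector_derivative (1 - q) powr (c - 1)) (at q)" if "q \<in> {1 - h<..<1}" for q
        unfolding has_real_derivative_iff_has_vector_derivative[symmetric]
        using that c by (auto intro!: derivative_eq_intros)
    qed (use h in auto)
    then have hi': "((\<lambda>q. (1 - q) powr (c - 1)) has_integral (h powr c / c)) {1 - h..1}" by simp
    have ai: "(\<lambda>q. (1 - q) powr (c - 1)) absolutely_integrable_on {1 - h..1}"
      using hi' by (intro nonnegative_absolutely_integrable_1) (auto intro: has_integral_integrable)
    have Iv: "(LINT q:{1 - h..1}|lebesgue. (1 - q) powr (c - 1)) = h powr c / c"
      unfolding set_lebesgue_integral_eq_integral(2)[OF ai] using hi' by (rule integral_unique)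
    have "(LINT q|lebesgue. indicator {1 - h..1} q * w q) \<le> 
       (LINT q|lebesgue. (M / W) * (indicator {1 - h..1} q *\<^sub>R (1 - q) powr (c - 1)))"
    proof (rule integral_mono)
      show "integrable lebesgue (\<lambda>q. indicator {1 - h..1} q * w q)"
        using integrable_mult_indicator[of "{1 - h..1}" lebesgue w] imom[of 0] by simp
      show "integrable lebesgue (\<lambda>q. (M / W) * (indicator {1 - h..1} q *\<^sub>R (1 - q) powr (c - 1)))"
        using ai by (auto simp: set_integrable_def)
      show "indicator {1 - h..1} q * w q \<le> (M / W) * (indicator {1 - h..1} q *\<^sub>R (1 - q) powr (c - 1))" for q
      proof (cases "q \<in> {1 - h..1}")
        case True
        then have q: "1/2 \<le> q" "q \<le> 1" using h by auto
        have "q powr (a - 1) \<le> M"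
        proof (cases "a \<ge> 1")
          case True
          then have "q powr (a - 1) \<le> 1 powr (a - 1)" using q by (intro powr_mono2) auto
          then show ?thesis by (simp add: M_def)
        next
          case False
          then have "q powr (a - 1) \<le> (1/2) powr (a - 1)" using q by (intro powr_mono2') auto
          also have "\<dots> = 2 powr (1 - a)" using powr_minus_divide[of "2::real" "1 - a"] 
            by (simp add: powr_divide powr_minus_divide)
          finally show ?thesis by (simp add: M_def)
        qed
        then have "g a q / W \<le> M * (1 - q) powr (c - 1) / W"
          unfolding g_def using W by (intro divide_right_mono mult_right_mono) auto
        then show ?thesis using True h by (simp add: w_def)
      qed simp
    qed
    also have "\<dots> = (M / W) * (h powr c / c)" using Iv by (simp add: set_lebesgue_integral_def)
    also have "\<dots> = (M / (W * c)) * h powr c" by simp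
    also have "\<dots> \<le> K * h powr c" by (intro mult_right_mono) (auto simp: K_def)
    finally show ?thesis by (simp add: h_def)
  qed
  show thesis
    by (rule that[of K w]) (use w0 imom mom tail in \<open>auto simp: K_def w_def c_def\<close>)
qed

text \<open>The number \<open>A j\<close> stands for the size of \<open>f\<close> where \<open>1 - |x|\<close> is about \<open>2\<^sup>-\<^sup>j\<close>. Adding the sizes over all shells between
  the origin and \<open>x\<close>, rather than keeping only the shell of \<open>x\<close>, makes the bound stable under averages over
  the segment from the origin to \<open>x\<close>.\<close>
definition dyadic_majorant :: "(nat \<Rightarrow> real) \<Rightarrow> ('a::euclidean_space \<Rightarrow> complex) \<Rightarrow> bool" where
  "dyadic_majorant A f \<longleftrightarrow> (\<forall>x. norm x < 1 \<longrightarrow> norm (f x) \<le> (\<Sum>j | 1 - (1/2) ^ j \<le> norm x. A j))"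

lemma finite_dyadic_below: "r < 1 \<Longrightarrow> finite {j. 1 - (1/2) ^ j \<le> (r::real)}"
proof -
  assume r: "r < 1"
  have "(\<lambda>j. (1/2::real) ^ j) \<longlonglongrightarrow> 0" by (rule LIMSEQ_power_zero) simp
  then have "eventually (\<lambda>j. (1/2::real) ^ j < 1 - r) sequentially"
    by (rule order_tendstoD(2)) (use r in simp)
  then obtain J where J: "\<And>j. j \<ge> J \<Longrightarrow> (1/2::real) ^ j < 1 - r" unfolding eventually_sequentially by blast
  have "{j. 1 - (1/2) ^ j \<le> r} \<subseteq> {..J}"
  proof
    fix j assume "j \<in> {j. 1 - (1/2) ^ j \<le> r}"
    then have "\<not> j \<ge> J" using J[of j] by force
    then show "j \<in> {..J}" by simp
  qed
  then show ?thesis using finite_subset by blast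
qed

text \<open>The new series at \<open>x\<close> is the average of the old one over the points \<open>q x\<close>. The term \<open>A j\<close> is present in the bound
  at \<open>q x\<close> only if \<open>q \<ge> 1 - 2\<^sup>-\<^sup>j\<close>, hence it is multiplied by the mass of this interval.\<close>
lemma dyadic_majorant_moment:
  fixes a b :: real
  assumes ab: "0 < a" "a < b"
  obtains K where "K \<ge> 0" "\<And>(U :: nat \<Rightarrow> 'a::euclidean_space \<Rightarrow> complex) A. harmonic_series U \<Longrightarrow> \<forall>j. A j \<ge> 0 \<Longrightarrow>
      dyadic_majorant A (series_sum U) \<Longrightarrow>
      dyadic_majorant (\<lambda>j. K * ((1/2) ^ j) powr (b - a) * A j) (series_sum (\<lambda>k x. pochhammer_ratio a b k *\<^sub>R U k x))"
proof -
  obtain w :: "real \<Rightarrow> real" and K where K: "K \<ge> 0" and w0: "\<And>q. w q \<ge> 0" and wout: "\<And>q. q \<notin> {0..1} \<Longrightarrow> w q = 0"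
    and imom: "\<And>k. integrable lebesgue (\<lambda>q. q ^ k * w q)"
    and mom: "\<And>k. (LINT q|lebesgue. q ^ k * w q) = pochhammer_ratio a b k"
    and tail: "\<And>j. (LINT q|lebesgue. indicator {1 - (1/2) ^ j..1} q * w q) \<le> K * ((1/2) ^ j) powr (b - a)"
    by (rule beta_moments[OF ab]) (rule that)
  have iw: "integrable lebesgue w" using imom[of 0] by simp
  show thesis
  proof (rule that[OF K])
    fix U :: "nat \<Rightarrow> 'a \<Rightarrow> complex" and A
    assume U: "harmonic_series U" and "\<forall>j. A j \<ge> 0" and maj: "dyadic_majorant A (series_sum U)"
    then have A: "\<And>j. A j \<ge> 0" by blast
    show "dyadic_majorant (\<lambda>j. K * ((1/2) ^ j) powr (b - a) * A j) (series_sum (\<lambda>k x. pochhammer_ratio a b k *\<^sub>R U k x))"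
      unfolding dyadic_majorant_def
    proof (intro allI impI)
      fix x :: 'a assume x: "norm x < 1"
      define J where "J = {j. 1 - (1/2) ^ j \<le> norm x}"
      have fJ: "finite J" unfolding J_def by (rule finite_dyadic_below[OF x])
      have sN: "summable (\<lambda>k. norm (U k x))" by (rule harmonic_series_summable[OF U x])
      define f where "f k q = (q ^ k * w q) *\<^sub>R U k x" for k q
      have if': "integrable lebesgue (f k)" for k
        unfolding f_def[abs_def] using imom by (intro integrable_scaleR_left) auto
      have fb: "norm (f k q) \<le> w q * norm (U k x)" for k q
      proof (cases "q \<in> {0..1}")
        case True
        then have "q ^ k \<le> 1" "0 \<le> q ^ k" by (auto simp: power_le_one)
        then have "q ^ k * w q * norm (U k x) \<le> 1 * w q * norm (U k x)"
          using w0[of q] by (intro mult_right_mono) auto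
        then show ?thesis using True w0[of q] by (simp add: f_def abs_mult)
      qed (simp add: f_def wout)
      have s1: "AE q in lebesgue. summable (\<lambda>k. norm (f k q))"
        by (intro AE_I2 summable_comparison_test'[OF summable_mult[OF sN]]) (use fb in auto)
      have s2: "summable (\<lambda>k. LINT q|lebesgue. norm (f k q))"
      proof (rule summable_comparison_test'[OF summable_mult[OF sN, of "LINT q|lebesgue. w q"]])
        fix k
        have "(LINT q|lebesgue. norm (f k q)) \<le> (LINT q|lebesgue. w q * norm (U k x))"
          by (intro integral_mono fb integrable_norm if') (use iw in auto)
        then show "norm (LINT q|lebesgue. norm (f k q)) \<le> (LINT q|lebesgue. w q) * norm (U k x)" by simp
      qed
      have "(\<lambda>k. LINT q|lebesgue. f k q) sums (LINT q|lebesgue. (\<Sum>k. f k q))"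
        by (rule sums_integral[OF if' s1 s2])
      moreover have "(LINT q|lebesgue. f k q) = pochhammer_ratio a b k *\<^sub>R U k x" for k
        unfolding f_def mom[symmetric] using imom by (intro integral_scaleR_left) auto
      ultimately have "series_sum (\<lambda>k x. pochhammer_ratio a b k *\<^sub>R U k x) x = (LINT q|lebesgue. (\<Sum>k. f k q))"
        by (simp add: series_sum_def sums_iff)
      also have "norm \<dots> \<le> (LINT q|lebesgue. norm (\<Sum>k. f k q))" by (rule integral_norm_bound)
      also have "\<dots> \<le> (LINT q|lebesgue. (\<Sum>j\<in>J. A j * (indicator {1 - (1/2) ^ j..1} q * w q)))"
      proof (rule integral_mono)
        show "integrable lebesgue (\<lambda>q. norm (\<Sum>k. f k q))"
          by (intro integrable_norm integrable_suminf[OF if' s1 s2])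
        have "integrable lebesgue (\<lambda>q. indicator {1 - (1/2) ^ j..1} q * w q)" for j
          using integrable_mult_indicator[of "{1 - (1/2) ^ j..1}" lebesgue w] iw by simp
        then show "integrable lebesgue (\<lambda>q. \<Sum>j\<in>J. A j * (indicator {1 - (1/2) ^ j..1} q * w q))"
          by (intro Bochner_Integration.integrable_sum integrable_mult_right)
        fix q
        show "norm (\<Sum>k. f k q) \<le> (\<Sum>j\<in>J. A j * (indicator {1 - (1/2) ^ j..1} q * w q))"
        proof (cases "q \<in> {0..1}")
          case q: True
          have "norm (q *\<^sub>R x) \<le> 1 * norm x" using q by (simp add: mult_right_le_one_le mult_left_le_one_le)
          then have nq: "norm (q *\<^sub>R x) < 1" using x by simp
          have "f k q = w q *\<^sub>R U k (q *\<^sub>R x)" for k by (simp add: f_def harmonic_seriesD(2)[OF U] mult.commute)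
          then have "(\<Sum>k. f k q) = (\<Sum>k. w q *\<^sub>R U k (q *\<^sub>R x))" by simp
          also have "\<dots> = w q *\<^sub>R series_sum U (q *\<^sub>R x)"
            unfolding series_sum_def
            by (rule suminf_scaleR_right[symmetric, OF summable_norm_cancel[OF harmonic_series_summable[OF U nq]]])
          finally have "norm (\<Sum>k. f k q) = w q * norm (series_sum U (q *\<^sub>R x))" using w0[of q] by simp
          also have "\<dots> \<le> w q * (\<Sum>j | 1 - (1/2) ^ j \<le> norm (q *\<^sub>R x). A j)"
          proof (intro mult_left_mono w0)
            show "norm (series_sum U (q *\<^sub>R x)) \<le> (\<Sum>j | 1 - (1/2) ^ j \<le> norm (q *\<^sub>R x). A j)"
              using maj nq unfolding dyadic_majorant_def by blast
          qed
          also have "\<dots> \<le> w q * (\<Sum>j\<in>{j\<in>J. 1 - (1/2) ^ j \<le> q}. A j)"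
          proof (intro mult_left_mono sum_mono2 w0)
            show "{j. 1 - (1/2) ^ j \<le> norm (q *\<^sub>R x)} \<subseteq> {j \<in> J. 1 - (1/2) ^ j \<le> q}"
            proof
              fix j assume "j \<in> {j. 1 - (1/2) ^ j \<le> norm (q *\<^sub>R x)}"
              moreover have "q * norm x \<le> norm x" "q * norm x \<le> q"
                using q x by (auto simp: mult_left_le_one_le mult_left_le)
              ultimately show "j \<in> {j \<in> J. 1 - (1/2) ^ j \<le> q}" using q by (simp add: J_def)
            qed
          qed (use fJ A in auto)
          also have "\<dots> = (\<Sum>j\<in>J. A j * (indicator {1 - (1/2) ^ j..1} q * w q))"
            unfolding sum_distrib_left sum.inter_filter[OF fJ]
            by (intro sum.cong refl) (use q in \<open>auto simp: indicator_def\<close>)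
          finally show ?thesis .
        qed (simp add: f_def wout)
      qed
      also have "\<dots> = (\<Sum>j\<in>J. A j * (LINT q|lebesgue. indicator {1 - (1/2) ^ j..1} q * w q))"
        using integrable_mult_indicator[of "{1 - (1/2) ^ j..1}" lebesgue w for j] iw
        by (subst Bochner_Integration.integral_sum) auto
      also have "\<dots> \<le> (\<Sum>j\<in>J. A j * (K * ((1/2) ^ j) powr (b - a)))"
        by (intro sum_mono mult_left_mono tail A)
      also have "\<dots> = (\<Sum>j\<in>J. K * ((1/2) ^ j) powr (b - a) * A j)" by (simp add: mult_ac)
      finally show "norm (series_sum (\<lambda>k x. pochhammer_ratio a b k *\<^sub>R U k x) x) \<le> 
        (\<Sum>j | 1 - (1/2) ^ j \<le> norm x. K * ((1/2) ^ j) powr (b - a) * A j)" unfolding J_def .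
    qed
  qed
qed

section \<open>Summation over dyadic shells\<close>

text \<open>The two branches of \<open>besov_coeff\<close> lead to four cases. The common factor \<open>(n/2)\<^sub>k\<close> cancels, and \<open>k!\<close> is the
  Pochhammer symbol of 1.\<close>
lemma besov_coeff_quotient:
  assumes n: "n > 0"
  obtains a1 b1 a2 b2 :: real where "0 < a1" "0 < b1" "0 < a2" "0 < b2" "(b1 - a1) + (b2 - a2) = t"
    "\<And>k. besov_coeff n k (s + t) / besov_coeff n k s = pochhammer_ratio b1 a1 k * pochhammer_ratio b2 a2 k"
proof -
  define m where "m = real n / 2"
  have m: "m > 0" using n by (simp add: m_def)
  have pm: "pochhammer m k > 0" for k using m by (rule pochhammer_pos)
  have p1: "pochhammer (1::real) k > 0" for k by (rule pochhammer_pos) simp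
  show thesis
  proof (cases "s > - (1 + m)"; cases "s + t > - (1 + m)")
    assume 1: "s > - (1 + m)" and 2: "s + t > - (1 + m)"
    show thesis
      by (rule that[of "1 + m + s" "1 + m + (s + t)" 1 1])
        (use 1 2 pm p1 in \<open>auto simp: besov_coeff_def pochhammer_ratio_def m_def[symmetric] less_imp_neq[symmetric]\<close>)
  next
    assume 1: "s > - (1 + m)" and 2: "\<not> s + t > - (1 + m)"
    show thesis
      by (rule that[of "1 + m + s" 1 "1 - (m + (s + t))" 1])
        (use 1 2 pm p1 in \<open>auto simp: besov_coeff_def pochhammer_ratio_def m_def[symmetric] less_imp_neq[symmetric] power2_eq_square\<close>)
  next
    assume 1: "\<not> s > - (1 + m)" and 2: "s + t > - (1 + m)"
    show thesis
      by (rule that[of 1 "1 + m + (s + t)" 1 "1 - (m + s)"])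
        (use 1 2 pm p1 in \<open>auto simp: besov_coeff_def pochhammer_ratio_def m_def[symmetric] less_imp_neq[symmetric] power2_eq_square\<close>)
  next
    assume 1: "\<not> s > - (1 + m)" and 2: "\<not> s + t > - (1 + m)"
    show thesis
      by (rule that[of "1 - (m + (s + t))" "1 - (m + s)" 1 1])
        (use 1 2 pm p1 in \<open>auto simp: besov_coeff_def pochhammer_ratio_def m_def[symmetric] less_imp_neq[symmetric]\<close>)
  qed
qed

text \<open>The norm of a sequence with exponent \<open>1/p\<close> is at most its norm with exponent 1.\<close>
lemma sum_powr_inverse_le:
  fixes G :: "'i \<Rightarrow> real"
  assumes "0 < p" "p \<le> 1" "finite F" "\<And>j. j \<in> F \<Longrightarrow> 0 \<le> G j" "(\<Sum>j\<in>F. G j) \<le> S"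
  shows "(\<Sum>j\<in>F. G j powr (1 / p)) \<le> S powr (1 / p)"
proof -
  define T where "T = (\<Sum>j\<in>F. G j)"
  have T: "0 \<le> T" "T \<le> S" using assms by (auto simp: T_def intro: sum_nonneg)
  have "(\<Sum>j\<in>F. G j powr (1 / p)) \<le> (\<Sum>j\<in>F. G j * T powr (1 / p - 1))"
  proof (rule sum_mono)
    fix j assume j: "j \<in> F"
    have "G j \<le> T" unfolding T_def using assms j by (intro member_le_sum) auto
    then have "G j * G j powr (1 / p - 1) \<le> G j * T powr (1 / p - 1)"
      using assms j by (intro mult_left_mono powr_mono2) auto
    moreover have "G j powr (1 / p) = G j * G j powr (1 / p - 1)"
      using assms(4)[OF j] by (cases "G j = 0") (auto simp: powr_diff)
    ultimately show "G j powr (1 / p) \<le> G j * T powr (1 / p - 1)" by simp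
  qed
  also have "\<dots> = T * T powr (1 / p - 1)" by (simp add: T_def sum_distrib_right)
  also have "\<dots> = T powr (1 / p)" using T by (cases "T = 0") (auto simp: powr_diff)
  also have "\<dots> \<le> S powr (1 / p)" using T assms by (intro powr_mono2) auto
  finally show ?thesis .
qed

text \<open>The constants leave enough room to contain every ball of radius \<open>2\<^sup>-\<^sup>j/4\<close> about a point with
  \<open>1 - 2\<^sup>-\<^sup>j \<le> |x| < 1 - 2\<^sup>-\<^sup>j\<^sup>-\<^sup>1\<close>.\<close>
definition dyadic_shell :: "nat \<Rightarrow> 'a::euclidean_space set" where
  "dyadic_shell j = {y. (1/2) ^ j / 4 \<le> 1 - norm y \<and> 1 - norm y \<le> 2 * (1/2) ^ j}"

lemma compact_dyadic_shell: "compact (dyadic_shell j :: 'a::euclidean_space set)"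
proof -
  have "dyadic_shell j = cball (0::'a) (1 - (1/2) ^ j / 4) \<inter> {y. 1 - norm y \<le> 2 * (1/2) ^ j}"
    by (auto simp: dyadic_shell_def)
  moreover have "compact (cball (0::'a) (1 - (1/2) ^ j / 4) \<inter> {y. 1 - norm y \<le> 2 * (1/2) ^ j})"
    by (intro compact_Int_closed compact_cball closed_Collect_le continuous_intros)
  ultimately show ?thesis by simp
qed

lemma dyadic_shell_subset: "dyadic_shell j \<subseteq> ball (0::'a::euclidean_space) 1"
proof
  fix y :: 'a assume "y \<in> dyadic_shell j"
  then have "(1/2) ^ j / 4 \<le> 1 - norm y" by (simp add: dyadic_shell_def)
  moreover have "0 < (1/2::real) ^ j" by simp
  ultimately have "norm y < 1" by linarith
  then show "y \<in> ball 0 1" by simp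
qed

text \<open>The shells with indices \<open>i\<close> and \<open>j \<ge> i + 4\<close> are disjoint.\<close>
lemma sum_indicator_dyadic_shell_le: "finite F \<Longrightarrow> (\<Sum>j\<in>F. indicator (dyadic_shell j) y) \<le> (4::real)"
proof -
  assume F: "finite F"
  define E where "E = {j\<in>F. y \<in> dyadic_shell j}"
  have "(\<Sum>j\<in>F. indicator (dyadic_shell j) y) = (\<Sum>j\<in>E. (1::real))"
    unfolding E_def sum.inter_filter[OF F] by (intro sum.cong) (auto simp: indicator_def)
  also have "\<dots> = real (card E)" by simp
  also have "\<dots> \<le> 4"
  proof (cases "E = {}")
    case False
    have fE: "finite E" using F by (simp add: E_def)
    define i where "i = Min E"
    have i: "i \<in> E" "\<And>j. j \<in> E \<Longrightarrow> i \<le> j" using fE False by (auto simp: i_def)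
    have "E \<subseteq> {i..i + 3}"
    proof
      fix j assume j: "j \<in> E"
      have "j < i + 4"
      proof (rule ccontr)
        assume "\<not> j < i + 4"
        then have "(1/2::real) ^ j \<le> (1/2) ^ (i + 4)" by (intro power_decreasing) auto
        also have "\<dots> = (1/2) ^ i / 16" by (simp add: power_add power_one_over)
        finally have "2 * (1/2::real) ^ j \<le> (1/2) ^ i / 8" by simp
        moreover have "1 - norm y \<le> 2 * (1/2) ^ j" "(1/2) ^ i / 4 \<le> 1 - norm y"
          using i(1) j by (auto simp: E_def dyadic_shell_def)
        ultimately have "(1/2::real) ^ i \<le> 0" by simp
        moreover have "0 < (1/2::real) ^ i" by simp
        ultimately show False by linarith
      qed
      then show "j \<in> {i..i + 3}" using i(2)[OF j] by simp
    qed
    then have "card E \<le> card {i..i + 3}" by (intro card_mono) auto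
    then show ?thesis by simp
  qed simp
  finally show ?thesis .
qed

lemma dyadic_index:
  assumes "0 \<le> r" "r < (1::real)"
  obtains j where "1 - (1/2) ^ j \<le> r" "r < 1 - (1/2) ^ Suc j"
proof -
  have f: "finite {j. 1 - (1/2) ^ j \<le> r}" by (rule finite_dyadic_below[OF assms(2)])
  have ne: "0 \<in> {j. 1 - (1/2) ^ j \<le> r}" using assms by simp
  define j where "j = Max {j. 1 - (1/2) ^ j \<le> r}"
  have "j \<in> {j. 1 - (1/2) ^ j \<le> r}" unfolding j_def by (rule Max_in[OF f]) (use ne in blast)
  moreover have "Suc j \<notin> {j. 1 - (1/2) ^ j \<le> r}"
  proof
    assume "Suc j \<in> {j. 1 - (1/2) ^ j \<le> r}"
    then have "Suc j \<le> j" using f unfolding j_def by (intro Max_ge) auto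
    then show False by simp
  qed
  ultimately show thesis by (intro that[of j]) auto
qed

lemma locally_controlled_imp_dyadic_majorant:
  fixes f v :: "'a::euclidean_space \<Rightarrow> complex"
  assumes lc: "locally_controlled p N C v f" and v: "continuous_on (ball 0 1) v" and C: "C \<ge> 0" and p: "p > 0"
  shows "dyadic_majorant (\<lambda>j. C * ((1/2) ^ j / 4) powr (- N) * 
    (LINT y:dyadic_shell j|lborel. norm (v y) powr p) powr (1 / p)) f"
  unfolding dyadic_majorant_def
proof (intro allI impI)
  fix x :: 'a assume x: "norm x < 1"
  obtain j where j: "1 - (1/2) ^ j \<le> norm x" "norm x < 1 - (1/2) ^ Suc j"
    using dyadic_index[OF norm_ge_zero x] by blast
  \<comment> \<open>the ball of radius \<open>\<delta>\<close> about \<open>x\<close> stays in the \<open>j\<close>-th shell\<close>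
  define \<delta> where "\<delta> = (1/2 :: real) ^ j / 4"
  have \<delta>: "\<delta> > 0" by (simp add: \<delta>_def)
  have j': "1 - 4 * \<delta> \<le> norm x" "norm x < 1 - 2 * \<delta>" using j by (auto simp: \<delta>_def)
  then have nx: "norm x + \<delta> < 1" using \<delta> by simp
  have sub: "cball x \<delta> \<subseteq> dyadic_shell j"
  proof
    fix y assume y: "y \<in> cball x \<delta>"
    have "norm y \<le> norm x + \<delta>" "norm x \<le> norm y + \<delta>"
      using y norm_le_norm_add_dist[of y x] norm_le_norm_add_dist[of x y] by (auto simp: dist_commute)
    then have "\<delta> \<le> 1 - norm y" "1 - norm y \<le> 8 * \<delta>" using j' \<delta> by auto
    then show "y \<in> dyadic_shell j" by (simp add: dyadic_shell_def \<delta>_def)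
  qed
  let ?T = "\<lambda>j. LINT y:dyadic_shell j|lborel. norm (v y) powr p"
  have int: "set_integrable lborel (dyadic_shell j) (\<lambda>y. norm (v y) powr p)" for j
    unfolding set_integrable_def
    by (intro borel_integrable_compact compact_dyadic_shell continuous_on_norm_powr p
        continuous_on_subset[OF v dyadic_shell_subset])
  have "(LINT y:cball x \<delta>|lborel. norm (v y) powr p) \<le> ?T j"
    by (intro set_integral_mono_set int sub) auto
  moreover have "0 \<le> (LINT y:cball x \<delta>|lborel. norm (v y) powr p)"
    unfolding set_lebesgue_integral_def by (intro Bochner_Integration.integral_nonneg) auto
  ultimately have "(LINT y:cball x \<delta>|lborel. norm (v y) powr p) powr (1 / p) \<le> ?T j powr (1 / p)"
    using p by (intro powr_mono2) auto
  then have "C * \<delta> powr (- N) * (LINT y:cball x \<delta>|lborel. norm (v y) powr p) powr (1 / p) \<le> 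
     C * \<delta> powr (- N) * ?T j powr (1 / p)"
    using C by (intro mult_left_mono) auto
  moreover have "norm (f x) \<le> C * \<delta> powr (- N) * (LINT y:cball x \<delta>|lborel. norm (v y) powr p) powr (1 / p)"
    using lc \<delta> nx unfolding locally_controlled_def by blast
  ultimately have "norm (f x) \<le> C * ((1/2) ^ j / 4) powr (- N) * ?T j powr (1 / p)" by (simp add: \<delta>_def)
  also have "\<dots> \<le> (\<Sum>j | 1 - (1/2) ^ j \<le> norm x. C * ((1/2) ^ j / 4) powr (- N) * ?T j powr (1 / p))"
    using j C by (intro member_le_sum finite_dyadic_below x) auto
  finally show "norm (f x) \<le> (\<Sum>j | 1 - (1/2) ^ j \<le> norm x. C * ((1/2) ^ j / 4) powr (- N) * ?T j powr (1 / p))" .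
qed

text \<open>The ratio of \<open>1 - |y|\<^sup>2\<close> and \<open>2\<^sup>-\<^sup>j\<close> lies between 1/4 and 4.\<close>
lemma dyadic_shell_weight:
  fixes y :: "'a::euclidean_space"
  assumes y: "y \<in> dyadic_shell j"
  shows "((1/2) ^ j) powr \<sigma> \<le> 4 powr \<bar>\<sigma>\<bar> * (1 - (norm y)\<^sup>2) powr \<sigma>"
proof -
  define h where "h = (1/2 :: real) ^ j"
  define e where "e = 1 - (norm y)\<^sup>2"
  have h: "h > 0" by (simp add: h_def)
  have y': "h / 4 \<le> 1 - norm y" "1 - norm y \<le> 2 * h" using y by (auto simp: dyadic_shell_def h_def)
  have e: "e = (1 - norm y) * (1 + norm y)" by (simp add: e_def power2_eq_square algebra_simps)
  have ny: "norm y \<le> 1" using y' h by simp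
  have "h / 4 * 1 \<le> e" unfolding e using y' h by (intro mult_mono) auto
  moreover have "e \<le> (2 * h) * 2" unfolding e using y' h ny by (intro mult_mono) auto
  ultimately have eh: "h / 4 \<le> e" "e \<le> 4 * h" by auto
  have e0: "e > 0" using eh h by simp
  show ?thesis
  proof (cases "\<sigma> \<ge> 0")
    case True
    have "h powr \<sigma> \<le> (4 * e) powr \<sigma>" using eh h True by (intro powr_mono2) auto
    also have "\<dots> = 4 powr \<sigma> * e powr \<sigma>" by (rule powr_mult)
    finally show ?thesis unfolding h_def[symmetric] e_def[symmetric] using True by simp
  next
    case False
    have "h powr \<sigma> \<le> (e / 4) powr \<sigma>" using eh e0 False by (intro powr_mono2') auto
    also have "\<dots> = e powr \<sigma> * 4 powr (- \<sigma>)" by (simp add: powr_divide powr_minus_divide)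
    finally show ?thesis unfolding h_def[symmetric] e_def[symmetric] using False by (simp add: mult.commute)
  qed
qed

definition growth_factor :: "nat \<Rightarrow> real \<Rightarrow> real \<Rightarrow> real \<Rightarrow> real" where
  "growth_factor n \<alpha> p r = (if \<alpha> \<le> - real n then 1 else 1 / (1 - r\<^sup>2) powr ((real n + \<alpha>) / p))"

lemma dyadic_power_le_growth_factor:
  assumes r: "0 \<le> r" "r < 1" and j: "1 - (1/2) ^ j \<le> r" and p: "p > 0"
  shows "((1/2) ^ j) powr (- ((real n + \<alpha>) / p)) \<le> 2 powr (\<bar>real n + \<alpha>\<bar> / p) * growth_factor n \<alpha> p r"
proof (cases "\<alpha> \<le> - real n")
  case True
  then have "- ((real n + \<alpha>) / p) \<ge> 0" using p by (simp add: field_simps)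
  then have "((1/2) ^ j) powr (- ((real n + \<alpha>) / p)) \<le> 1 powr (- ((real n + \<alpha>) / p))"
    by (intro powr_mono2) (auto simp: power_le_one)
  also have "\<dots> \<le> 2 powr (\<bar>real n + \<alpha>\<bar> / p)" using p by (simp add: ge_one_powr_ge_zero)
  finally show ?thesis using True by (simp add: growth_factor_def)
next
  case False
  define e where "e = (real n + \<alpha>) / p"
  have e: "e > 0" using False p by (simp add: e_def)
  have q: "1 - r\<^sup>2 > 0" using r by (simp add: abs_square_less_1)
  have "1 - r\<^sup>2 = (1 - r) * (1 + r)" by (simp add: power2_eq_square algebra_simps)
  also have "\<dots> \<le> (1/2) ^ j * 2" using r j by (intro mult_mono) auto
  finally have le: "(1 - r\<^sup>2) / 2 \<le> (1/2) ^ j" by simp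
  have "((1/2) ^ j) powr (- e) \<le> ((1 - r\<^sup>2) / 2) powr (- e)"
    using le q e by (intro powr_mono2') auto
  also have "\<dots> = 2 powr e * (1 / (1 - r\<^sup>2) powr e)"
    by (simp add: powr_divide powr_minus_divide)
  finally show ?thesis using False e p by (simp add: e_def growth_factor_def)
qed

lemma growth_factor_pos: "0 \<le> r \<Longrightarrow> r < 1 \<Longrightarrow> 0 < growth_factor n \<alpha> p r"
  using abs_square_less_1[of r] by (simp add: growth_factor_def)

lemma D_op_eq_series_sum:
  fixes u :: "'a::euclidean_space \<Rightarrow> complex"
  assumes u: "harmonic_on (ball 0 1) u" and ab: "0 < a1" "0 < b1" "0 < a2" "0 < b2"
    and quot: "\<And>k. besov_coeff DIM('a) k (s + t) / besov_coeff DIM('a) k s = 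
      pochhammer_ratio b1 a1 k * pochhammer_ratio b2 a2 k"
  shows "harmonic_series (homogeneous_part u)"
    and "harmonic_series (\<lambda>k x. (pochhammer_ratio b1 a1 k * pochhammer_ratio b2 a2 k) *\<^sub>R homogeneous_part u k x)"
    and "D_op s t u = series_sum (\<lambda>k x. (pochhammer_ratio b1 a1 k * pochhammer_ratio b2 a2 k) *\<^sub>R homogeneous_part u k x)"
proof -
  show hU: "harmonic_series (homogeneous_part u)"
    unfolding harmonic_series_def using homogeneous_expansion_exists[OF u]
    by (auto simp: homogeneous_expansion_def)
  show "harmonic_series (\<lambda>k x. (pochhammer_ratio b1 a1 k * pochhammer_ratio b2 a2 k) *\<^sub>R homogeneous_part u k x)"
    by (intro harmonic_series_multiplier hU tame_mult tame_pochhammer_ratio ab)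
  show "D_op s t u = series_sum (\<lambda>k x. (pochhammer_ratio b1 a1 k * pochhammer_ratio b2 a2 k) *\<^sub>R homogeneous_part u k x)"
    by (auto simp: fun_eq_iff D_op_def series_sum_def quot scaleR_conv_of_real)
qed

lemma continuous_on_D_op:
  fixes u :: "'a::euclidean_space \<Rightarrow> complex"
  assumes u: "harmonic_on (ball 0 1) u"
  shows "continuous_on (ball 0 1) (D_op s t u)"
proof -
  obtain a1 b1 a2 b2 :: real where ab: "0 < a1" "0 < b1" "0 < a2" "0 < b2"
    and quot: "\<And>k. besov_coeff DIM('a) k (s + t) / besov_coeff DIM('a) k s = 
      pochhammer_ratio b1 a1 k * pochhammer_ratio b2 a2 k"
    by (rule besov_coeff_quotient[OF DIM_positive]) (rule that)
  show ?thesis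
    unfolding D_op_eq_series_sum(3)[OF u ab quot]
    using series_sum_bump_mean_value[OF D_op_eq_series_sum(2)[OF u ab quot]] by (simp add: bump_mean_value_def)
qed

text \<open>Here the constants of all multiplier estimates are combined. The exponent of \<open>2\<^sup>-\<^sup>j\<close> in the \<open>j\<close>-th summand
  collects \<open>\<tau>1 + \<tau>2 = m1 + m2 + t\<close> from the averages, \<open>-(n/p + m1 + m2)\<close> from the local estimates, and
  \<open>-(\<alpha> + p t)/p\<close> from the weight in the integral; it equals \<open>-(n + \<alpha>)/p\<close>.\<close>
lemma pointwise_estimate:
  fixes p \<alpha> s t :: real
  assumes p: "0 < p" "p \<le> 1"
  shows "\<exists>C>0. \<forall>(u :: 'a::euclidean_space \<Rightarrow> complex) S x. harmonic_on (ball 0 1) u \<longrightarrow> 0 \<le> S \<longrightarrow>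
     (\<integral>\<^sup>+ y. ennreal (indicator (ball 0 1) y * ((1 - (norm y)\<^sup>2) powr (\<alpha> + p * t) * norm (D_op s t u y) powr p)) \<partial>lborel) \<le> ennreal S \<longrightarrow>
     norm x < 1 \<longrightarrow> norm (u x) \<le> C * S powr (1 / p) * growth_factor DIM('a) \<alpha> p (norm x)"
proof -
  define n where "n = DIM('a)"
  have n: "n > 0" by (simp add: n_def)
  define \<sigma> where "\<sigma> = \<alpha> + p * t"
  obtain a1 b1 a2 b2 :: real where ab: "0 < a1" "0 < b1" "0 < a2" "0 < b2" and abt: "(b1 - a1) + (b2 - a2) = t"
    and quot: "\<And>k. besov_coeff n k (s + t) / besov_coeff n k s = pochhammer_ratio b1 a1 k * pochhammer_ratio b2 a2 k"
    by (rule besov_coeff_quotient[OF n]) (rule that)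
  obtain m1 where m1: "a1 < b1 + real m1" using reals_Archimedean2[of "a1 - b1"] by (auto simp: algebra_simps)
  obtain m2 where m2: "a2 < b2 + real m2" using reals_Archimedean2[of "a2 - b2"] by (auto simp: algebra_simps)
  define N0 where "N0 = real n / p"
  define C0 where "C0 = (2 powr (real n / p) / bump_mass TYPE('a)) powr (1 / p)"
  have C0: "C0 \<ge> 0" by (simp add: C0_def)
  obtain K1 where K1: "K1 \<ge> 0" "\<And>(U :: nat \<Rightarrow> 'a \<Rightarrow> complex) v p C. harmonic_series U \<Longrightarrow> continuous_on (ball 0 1) v \<Longrightarrow>
       p > 0 \<Longrightarrow> C \<ge> 0 \<Longrightarrow> locally_controlled p N0 C v (series_sum U) \<Longrightarrow>
       locally_controlled p (N0 + m1) (K1 * C) v (series_sum (\<lambda>k x. pochhammer_ratio (b1 + real m1) b1 k *\<^sub>R U k x))"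
    using locally_controlled_raise_iterate[OF ab(2), of N0 m1, where 'a='a] by blast
  obtain K2 where K2: "K2 \<ge> 0" "\<And>(U :: nat \<Rightarrow> 'a \<Rightarrow> complex) v p C. harmonic_series U \<Longrightarrow> continuous_on (ball 0 1) v \<Longrightarrow>
       p > 0 \<Longrightarrow> C \<ge> 0 \<Longrightarrow> locally_controlled p (N0 + m1) C v (series_sum U) \<Longrightarrow>
       locally_controlled p (N0 + m1 + m2) (K2 * C) v (series_sum (\<lambda>k x. pochhammer_ratio (b2 + real m2) b2 k *\<^sub>R U k x))"
    using locally_controlled_raise_iterate[OF ab(4), of "N0 + m1" m2, where 'a='a] by blast
  define \<tau>1 where "\<tau>1 = b1 + real m1 - a1"
  define \<tau>2 where "\<tau>2 = b2 + real m2 - a2"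
  obtain K3 where K3: "K3 \<ge> 0" "\<And>(U :: nat \<Rightarrow> 'a \<Rightarrow> complex) A. harmonic_series U \<Longrightarrow> \<forall>j. A j \<ge> 0 \<Longrightarrow>
      dyadic_majorant A (series_sum U) \<Longrightarrow>
      dyadic_majorant (\<lambda>j. K3 * ((1/2) ^ j) powr \<tau>1 * A j) (series_sum (\<lambda>k x. pochhammer_ratio a1 (b1 + real m1) k *\<^sub>R U k x))"
    by (rule dyadic_majorant_moment[OF ab(1) m1, where 'a='a, folded \<tau>1_def]) (rule that)
  obtain K4 where K4: "K4 \<ge> 0" "\<And>(U :: nat \<Rightarrow> 'a \<Rightarrow> complex) A. harmonic_series U \<Longrightarrow> \<forall>j. A j \<ge> 0 \<Longrightarrow>
      dyadic_majorant A (series_sum U) \<Longrightarrow>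
      dyadic_majorant (\<lambda>j. K4 * ((1/2) ^ j) powr \<tau>2 * A j) (series_sum (\<lambda>k x. pochhammer_ratio a2 (b2 + real m2) k *\<^sub>R U k x))"
    by (rule dyadic_majorant_moment[OF ab(3) m2, where 'a='a, folded \<tau>2_def]) (rule that)
  define N where "N = N0 + real m1 + real m2"
  define C1 where "C1 = K2 * (K1 * C0)"
  have C1: "C1 \<ge> 0" using K1 K2 C0 by (simp add: C1_def)
  define C2 where "C2 = K4 * K3 * C1 * 4 powr N * (4 powr \<bar>\<sigma>\<bar>) powr (1 / p)"
  have C2: "C2 \<ge> 0" using C1 K3 K4 by (simp add: C2_def)
  define C3 where "C3 = (C2 * 2 powr (\<bar>real n + \<alpha>\<bar> / p)) * 4 powr (1 / p)"
  have C3: "C3 \<ge> 0" using C2 by (simp add: C3_def)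
  have main: "norm (u x) \<le> C3 * S powr (1 / p) * growth_factor n \<alpha> p (norm x)"
    if u: "harmonic_on (ball 0 1) u" and S: "0 \<le> S" 
      and J: "(\<integral>\<^sup>+ y. ennreal (indicator (ball 0 1) y * ((1 - (norm y)\<^sup>2) powr \<sigma> * norm (D_op s t u y) powr p)) \<partial>lborel) \<le> ennreal S"
      and x: "norm x < 1" for u :: "'a \<Rightarrow> complex" and S x
  proof -
    define U where "U = homogeneous_part u"
    have ex: "homogeneous_expansion u U" unfolding U_def by (rule homogeneous_expansion_exists(1)[OF u])
    define V where "V k x = (pochhammer_ratio b1 a1 k * pochhammer_ratio b2 a2 k) *\<^sub>R U k x" for k x
    note D_op = D_op_eq_series_sum[OF u ab quot[unfolded n_def], folded U_def, folded V_def[abs_def]]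
    have hU: "harmonic_series U" and hV: "harmonic_series V" and D: "D_op s t u = series_sum V"
      using D_op by blast+
    define v where "v = series_sum V"
    have mv: "bump_mean_value v" unfolding v_def by (rule series_sum_bump_mean_value[OF hV])
    have cv: "continuous_on (ball 0 1) v" using mv by (simp add: bump_mean_value_def)
    have l0: "locally_controlled p N0 C0 v (series_sum V)"
      using bump_mean_value_locally_controlled[OF mv p] by (simp add: N0_def C0_def n_def v_def)
    \<comment> \<open>derivatives first: \<open>V1\<close> and \<open>V2\<close> raise \<open>b1\<close> and \<open>b2\<close> so far that only averages remain to be taken\<close>
    define V1 where "V1 k x = pochhammer_ratio (b1 + real m1) b1 k *\<^sub>R V k x" for k x
    have hV1: "harmonic_series V1"
      unfolding V1_def[abs_def] by (intro harmonic_series_multiplier hV tame_pochhammer_ratio ab) (use ab in simp)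
    have l1: "locally_controlled p (N0 + m1) (K1 * C0) v (series_sum V1)"
      unfolding V1_def[abs_def] by (rule K1(2)[OF hV cv p(1) C0 l0])
    define V2 where "V2 k x = pochhammer_ratio (b2 + real m2) b2 k *\<^sub>R V1 k x" for k x
    have hV2: "harmonic_series V2"
      unfolding V2_def[abs_def] by (intro harmonic_series_multiplier hV1 tame_pochhammer_ratio ab) (use ab in simp)
    have "locally_controlled p (N0 + m1 + m2) (K2 * (K1 * C0)) v (series_sum V2)"
      unfolding V2_def[abs_def] by (rule K2(2)[OF hV1 cv p(1) _ l1]) (use K1 C0 in simp)
    then have l2: "locally_controlled p N C1 v (series_sum V2)" by (simp add: N_def C1_def)
    define T where "T j = (LINT y:dyadic_shell j|lborel. norm (v y) powr p)" for j
    define A where "A j = C1 * ((1/2) ^ j / 4) powr (- N) * T j powr (1 / p)" for j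
    have A0: "A j \<ge> 0" for j using C1 by (simp add: A_def)
    have dA: "dyadic_majorant A (series_sum V2)"
      unfolding A_def[abs_def] T_def by (rule locally_controlled_imp_dyadic_majorant[OF l2 cv C1 p(1)])
    \<comment> \<open>averages: \<open>V3\<close> and \<open>V4\<close> lower \<open>b1 + m1\<close> to \<open>a1\<close> and \<open>b2 + m2\<close> to \<open>a2\<close>\<close>
    define V3 where "V3 k x = pochhammer_ratio a1 (b1 + real m1) k *\<^sub>R V2 k x" for k x
    have hV3: "harmonic_series V3"
      unfolding V3_def[abs_def] by (intro harmonic_series_multiplier hV2 tame_pochhammer_ratio ab) (use ab in simp)
    have d3: "dyadic_majorant (\<lambda>j. K3 * ((1/2) ^ j) powr \<tau>1 * A j) (series_sum V3)"
      unfolding V3_def[abs_def] by (rule K3(2)[OF hV2 _ dA]) (use A0 in blast)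
    have A30: "0 \<le> K3 * ((1/2) ^ j) powr \<tau>1 * A j" for j using K3 A0 by simp
    define V4 where "V4 k x = pochhammer_ratio a2 (b2 + real m2) k *\<^sub>R V3 k x" for k x
    have d4: "dyadic_majorant (\<lambda>j. K4 * ((1/2) ^ j) powr \<tau>2 * (K3 * ((1/2) ^ j) powr \<tau>1 * A j)) (series_sum V4)"
      unfolding V4_def[abs_def] by (rule K4(2)[OF hV3 _ d3]) (use A30 in blast)
    \<comment> \<open>all ratios telescope, so \<open>u\<close> is back\<close>
    have "V4 k x = U k x" for k x
    proof -
      have bm: "b1 + real m1 > 0" "b2 + real m2 > 0" using ab by simp_all
      have "V4 k x = (pochhammer_ratio a2 (b2 + real m2) k * pochhammer_ratio (b2 + real m2) b2 k * pochhammer_ratio b2 a2 k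
        * (pochhammer_ratio a1 (b1 + real m1) k * pochhammer_ratio (b1 + real m1) b1 k * pochhammer_ratio b1 a1 k)) *\<^sub>R U k x"
        by (simp add: V4_def V3_def V2_def V1_def V_def mult_ac)
      also have "\<dots> = U k x"
        unfolding pochhammer_ratio_mult[OF bm(1)] pochhammer_ratio_mult[OF bm(2)] 
          pochhammer_ratio_mult[OF ab(2)] pochhammer_ratio_mult[OF ab(4)]
        using pochhammer_pos[OF ab(1), of k] pochhammer_pos[OF ab(3), of k] by (simp add: pochhammer_ratio_def)
      finally show ?thesis .
    qed
    moreover have "series_sum U x = u x"
      using ex x by (auto simp: homogeneous_expansion_def series_sum_def sums_iff)
    ultimately have ux: "series_sum V4 x = u x" by (simp add: series_sum_def)
    define F where "F = {j. 1 - (1/2) ^ j \<le> norm x}"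
    have fF: "finite F" unfolding F_def by (rule finite_dyadic_below[OF x])
    \<comment> \<open>the contribution of the \<open>j\<close>-th shell to the quasinorm\<close>
    define G where "G j = (LINT y:dyadic_shell j|lborel. (1 - (norm y)\<^sup>2) powr \<sigma> * norm (v y) powr p)" for j
    have pos1: "1 - (norm y)\<^sup>2 > 0" if "y \<in> ball 0 1" for y :: 'a 
      using that by (simp add: abs_square_less_1)
    have cw: "continuous_on (ball 0 1) (\<lambda>y. (1 - (norm y)\<^sup>2) powr \<sigma> * norm (v y) powr p)"
    proof (intro continuous_on_mult continuous_on_norm_powr cv p continuous_on_powr continuous_intros)
      show "\<forall>y\<in>ball 0 1. 1 - (norm (y::'a))\<^sup>2 \<noteq> 0" using pos1 by force
    qed
    have iG: "set_integrable lborel (dyadic_shell j) (\<lambda>y. (1 - (norm y)\<^sup>2) powr \<sigma> * norm (v y) powr p)" for j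
      unfolding set_integrable_def
      by (intro borel_integrable_compact compact_dyadic_shell continuous_on_subset[OF cw dyadic_shell_subset])
    have G0: "G j \<ge> 0" for j
      unfolding G_def set_lebesgue_integral_def by (intro Bochner_Integration.integral_nonneg) auto
    have T0: "T j \<ge> 0" for j
      unfolding T_def set_lebesgue_integral_def by (intro Bochner_Integration.integral_nonneg) auto
    have sumG: "(\<Sum>j\<in>F. G j) \<le> 4 * S"
    proof -
      let ?g = "\<lambda>y::'a. (1 - (norm y)\<^sup>2) powr \<sigma> * norm (v y) powr p"
      have "ennreal (\<Sum>j\<in>F. G j) = ennreal (LINT y|lborel. (\<Sum>j\<in>F. indicator (dyadic_shell j) y *\<^sub>R ?g y))"
        unfolding G_def set_lebesgue_integral_def using iG
        by (subst Bochner_Integration.integral_sum) (auto simp: set_integrable_def)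
      also have "\<dots> = (\<integral>\<^sup>+ y. ennreal (\<Sum>j\<in>F. indicator (dyadic_shell j) y *\<^sub>R ?g y) \<partial>lborel)"
        using iG by (intro nn_integral_eq_integral[symmetric] Bochner_Integration.integrable_sum)
          (auto simp: set_integrable_def intro!: sum_nonneg)
      also have "\<dots> \<le> (\<integral>\<^sup>+ y. ennreal 4 * ennreal (indicator (ball 0 1) y * ?g y) \<partial>lborel)"
      proof (intro nn_integral_mono)
        fix y :: 'a
        show "ennreal (\<Sum>j\<in>F. indicator (dyadic_shell j) y *\<^sub>R ?g y) \<le> ennreal 4 * ennreal (indicator (ball 0 1) y * ?g y)"
        proof (cases "y \<in> ball 0 1")
          case True
          have "(\<Sum>j\<in>F. indicator (dyadic_shell j) y *\<^sub>R ?g y) = (\<Sum>j\<in>F. indicator (dyadic_shell j) y) * ?g y"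
            by (simp add: sum_distrib_right)
          also have "\<dots> \<le> 4 * ?g y" by (intro mult_right_mono sum_indicator_dyadic_shell_le fF) auto
          finally show ?thesis using True by (simp add: ennreal_mult[symmetric] del: ennreal_numeral)
        next
          case False
          then have "y \<notin> dyadic_shell j" for j using dyadic_shell_subset by blast
          then show ?thesis by simp
        qed
      qed
      also have "\<dots> = ennreal 4 * (\<integral>\<^sup>+ y. ennreal (indicator (ball 0 1) y * ?g y) \<partial>lborel)"
      proof (rule nn_integral_cmult)
        have "(\<lambda>y. indicator (ball 0 1) y *\<^sub>R ?g y) \<in> borel_measurable borel"
          by (rule borel_measurable_continuous_on_indicator[OF _ cw]) simp
        then show "(\<lambda>y. ennreal (indicator (ball 0 1) y * ?g y)) \<in> borel_measurable lborel" by simp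
      qed
      also have "\<dots> \<le> ennreal 4 * ennreal S" using J unfolding D v_def by (intro mult_left_mono) auto
      finally have "ennreal (\<Sum>j\<in>F. G j) \<le> ennreal (4 * S)" using S by (simp add: ennreal_mult del: ennreal_numeral)
      then show ?thesis using S by (simp add: ennreal_le_iff)
    qed
    have TG: "T j \<le> 4 powr \<bar>\<sigma>\<bar> * ((1/2) ^ j) powr (- \<sigma>) * G j" for j
    proof -
      have "T j \<le> (LINT y:dyadic_shell j|lborel. (4 powr \<bar>\<sigma>\<bar> * ((1/2) ^ j) powr (- \<sigma>)) * ((1 - (norm y)\<^sup>2) powr \<sigma> * norm (v y) powr p))"
        unfolding T_def
      proof (rule set_integral_mono)
        show "set_integrable lborel (dyadic_shell j) (\<lambda>y. norm (v y) powr p)"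
          unfolding set_integrable_def
          by (intro borel_integrable_compact compact_dyadic_shell continuous_on_norm_powr p
            continuous_on_subset[OF cv dyadic_shell_subset])
        show "set_integrable lborel (dyadic_shell j) (\<lambda>y. (4 powr \<bar>\<sigma>\<bar> * ((1/2) ^ j) powr (- \<sigma>)) * ((1 - (norm y)\<^sup>2) powr \<sigma> * norm (v y) powr p))"
          by (intro set_integrable_mult_right iG)
        fix y :: 'a assume y: "y \<in> dyadic_shell j"
        have "1 = ((1/2 :: real) ^ j) powr (- \<sigma>) * ((1/2) ^ j) powr \<sigma>" by (simp add: powr_add[symmetric])
        also have "\<dots> \<le> ((1/2) ^ j) powr (- \<sigma>) * (4 powr \<bar>\<sigma>\<bar> * (1 - (norm y)\<^sup>2) powr \<sigma>)"
          by (intro mult_left_mono dyadic_shell_weight[OF y]) auto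
        finally have "1 * norm (v y) powr p \<le> (((1/2) ^ j) powr (- \<sigma>) * (4 powr \<bar>\<sigma>\<bar> * (1 - (norm y)\<^sup>2) powr \<sigma>)) * norm (v y) powr p"
          by (intro mult_right_mono) auto
        then show "norm (v y) powr p \<le> (4 powr \<bar>\<sigma>\<bar> * ((1/2) ^ j) powr (- \<sigma>)) * ((1 - (norm y)\<^sup>2) powr \<sigma> * norm (v y) powr p)"
          by (simp add: mult_ac)
      qed
      then show ?thesis unfolding G_def by (subst (asm) set_integral_mult_right)
    qed
    have summand: "K4 * ((1/2) ^ j) powr \<tau>2 * (K3 * ((1/2) ^ j) powr \<tau>1 * A j) \<le> 
      C2 * 2 powr (\<bar>real n + \<alpha>\<bar> / p) * growth_factor n \<alpha> p (norm x) * G j powr (1 / p)" if j: "j \<in> F" for j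
    proof -
      define h where "h = (1/2 :: real) ^ j"
      have h: "h > 0" by (simp add: h_def)
      have "T j powr (1 / p) \<le> (4 powr \<bar>\<sigma>\<bar> * h powr (- \<sigma>) * G j) powr (1 / p)"
        unfolding h_def using p T0 by (intro powr_mono2 TG) auto
      also have "\<dots> = (4 powr \<bar>\<sigma>\<bar>) powr (1 / p) * h powr (- \<sigma> / p) * G j powr (1 / p)"
        using h G0[of j] by (simp add: powr_mult powr_powr)
      finally have Tj: "T j powr (1 / p) \<le> (4 powr \<bar>\<sigma>\<bar>) powr (1 / p) * h powr (- \<sigma> / p) * G j powr (1 / p)" .
      have h4: "(h / 4) powr (- N) = h powr (- N) * 4 powr N"
        by (simp add: powr_divide powr_minus_divide)
      have exps: "\<tau>2 + \<tau>1 - N - \<sigma> / p = - ((real n + \<alpha>) / p)"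
      proof -
        have "\<tau>2 + \<tau>1 - N = t - n / p" using abt by (simp add: \<tau>1_def \<tau>2_def N_def N0_def)
        moreover have "\<sigma> / p = \<alpha> / p + t" using p by (simp add: \<sigma>_def add_divide_distrib)
        ultimately show ?thesis by (simp add: add_divide_distrib)
      qed
      have "K4 * h powr \<tau>2 * (K3 * h powr \<tau>1 * A j) = 
        (K4 * K3 * C1 * 4 powr N) * (h powr \<tau>2 * h powr \<tau>1 * h powr (- N)) * T j powr (1 / p)"
        by (simp add: A_def h_def[symmetric] h4 mult_ac)
      also have "\<dots> \<le> (K4 * K3 * C1 * 4 powr N) * (h powr \<tau>2 * h powr \<tau>1 * h powr (- N)) * 
         ((4 powr \<bar>\<sigma>\<bar>) powr (1 / p) * h powr (- \<sigma> / p) * G j powr (1 / p))"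
        using K3 K4 C1 by (intro mult_left_mono Tj) auto
      also have "\<dots> = C2 * (h powr \<tau>2 * h powr \<tau>1 * h powr (- N) * h powr (- \<sigma> / p)) * G j powr (1 / p)"
        by (simp add: C2_def mult_ac)
      also have "h powr \<tau>2 * h powr \<tau>1 * h powr (- N) * h powr (- \<sigma> / p) = h powr (- ((real n + \<alpha>) / p))"
        unfolding powr_add[symmetric] using exps by simp
      also have "C2 * h powr (- ((real n + \<alpha>) / p)) * G j powr (1 / p) \<le> 
        C2 * (2 powr (\<bar>real n + \<alpha>\<bar> / p) * growth_factor n \<alpha> p (norm x)) * G j powr (1 / p)"
        unfolding h_def using j x p C2
        by (intro mult_right_mono mult_left_mono dyadic_power_le_growth_factor) (auto simp: F_def)
      finally show ?thesis by (simp add: h_def mult_ac)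
    qed
    have gf: "growth_factor n \<alpha> p (norm x) \<ge> 0" using growth_factor_pos[OF norm_ge_zero x] by (simp add: less_imp_le)
    have "norm (u x) \<le> (\<Sum>j\<in>F. K4 * ((1/2) ^ j) powr \<tau>2 * (K3 * ((1/2) ^ j) powr \<tau>1 * A j))"
      using d4 x unfolding dyadic_majorant_def F_def ux[symmetric] by blast
    also have "\<dots> \<le> (\<Sum>j\<in>F. C2 * 2 powr (\<bar>real n + \<alpha>\<bar> / p) * growth_factor n \<alpha> p (norm x) * G j powr (1 / p))"
      by (intro sum_mono summand)
    also have "\<dots> = C2 * 2 powr (\<bar>real n + \<alpha>\<bar> / p) * growth_factor n \<alpha> p (norm x) * (\<Sum>j\<in>F. G j powr (1 / p))"
      by (simp add: sum_distrib_left)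
    also have "\<dots> \<le> C2 * 2 powr (\<bar>real n + \<alpha>\<bar> / p) * growth_factor n \<alpha> p (norm x) * (4 * S) powr (1 / p)"
      using C2 gf by (intro mult_left_mono sum_powr_inverse_le[OF p fF _ sumG] G0) auto
    also have "\<dots> = C3 * S powr (1 / p) * growth_factor n \<alpha> p (norm x)"
      using S by (simp add: C3_def powr_mult mult_ac)
    finally show ?thesis .
  qed
  show ?thesis
  proof (intro exI[of _ "C3 + 1"] conjI allI impI)
    show "C3 + 1 > 0" using C3 by simp
    fix u :: "'a \<Rightarrow> complex" and S and x :: 'a
    assume "harmonic_on (ball 0 1) u" "0 \<le> S" 
      "(\<integral>\<^sup>+ y. ennreal (indicator (ball 0 1) y * ((1 - (norm y)\<^sup>2) powr (\<alpha> + p * t) * norm (D_op s t u y) powr p)) \<partial>lborel) \<le> ennreal S"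
      and x: "norm x < 1"
    then have "norm (u x) \<le> C3 * S powr (1 / p) * growth_factor n \<alpha> p (norm x)" by (intro main) (simp_all add: \<sigma>_def)
    also have "\<dots> \<le> (C3 + 1) * S powr (1 / p) * growth_factor n \<alpha> p (norm x)"
      using growth_factor_pos[OF norm_ge_zero x, of n \<alpha> p] by (intro mult_right_mono) auto
    finally show "norm (u x) \<le> (C3 + 1) * S powr (1 / p) * growth_factor DIM('a) \<alpha> p (norm x)" by (simp add: n_def)
  qed
qed

section \<open>The weighted measure and the quasinorm\<close>

lemma one_minus_norm_square_pos: "y \<in> ball 0 1 \<Longrightarrow> 0 < 1 - (norm y)\<^sup>2"
  using abs_square_less_1[of "norm y"] by simp

lemma continuous_on_weight: "continuous_on (ball 0 1) (\<lambda>y::'a::euclidean_space. (1 - (norm y)\<^sup>2) powr \<alpha>)"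
  by (intro continuous_on_powr continuous_intros ballI) (use one_minus_norm_square_pos in force)

lemma emeasure_lborel_ball_eq_measure:
  "emeasure lborel (ball (0::'a::euclidean_space) r) = ennreal (measure lborel (ball (0::'a) r))"
  by (rule emeasure_eq_ennreal_measure)
    (use emeasure_bounded_finite[OF bounded_ball, of "0::'a" r] in auto)

lemma nn_integral_ball_measure:
  fixes f :: "'a::euclidean_space \<Rightarrow> ennreal"
  assumes "f \<in> borel_measurable (lebesgue_on (ball 0 1))"
  shows "(\<integral>\<^sup>+ y. f y \<partial>ball_measure) = 
    ennreal (1 / measure lborel (ball (0::'a) 1)) * (\<integral>\<^sup>+ y. f y * indicator (ball 0 1) y \<partial>lborel)"
proof -
  have B: "ball (0::'a) 1 \<in> sets lebesgue" by simp
  have Bs: "ball (0::'a) 1 \<in> sets (lebesgue_on (ball 0 1))"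
    using sets_restrict_space_iff[of "ball (0::'a) 1" lebesgue] by simp
  have V: "measure lborel (ball (0::'a) 1) > 0" using content_ball_pos[of 1 "0::'a"] by simp
  have "emeasure (lebesgue_on (ball 0 1)) (ball (0::'a) 1) = emeasure lebesgue (ball (0::'a) 1)"
    by (subst emeasure_restrict_space) auto
  also have "\<dots> = ennreal (measure lborel (ball (0::'a) 1))"
    using emeasure_lborel_ball_eq_measure[of 1, where 'a='a] by simp
  finally have e: "emeasure (lebesgue_on (ball 0 1)) (ball (0::'a) 1) = ennreal (measure lborel (ball (0::'a) 1))" .
  have "(\<integral>\<^sup>+ y. f y \<partial>ball_measure) = 
     (\<integral>\<^sup>+ y. f y * indicator (ball 0 1) y \<partial>lebesgue_on (ball 0 1)) / ennreal (measure lborel (ball (0::'a) 1))"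
    unfolding ball_measure_def by (subst nn_integral_uniform_measure[OF assms Bs]) (simp add: e)
  also have "(\<integral>\<^sup>+ y. f y * indicator (ball 0 1) y \<partial>lebesgue_on (ball 0 1)) = 
     (\<integral>\<^sup>+ y. f y * indicator (ball 0 1) y * indicator (ball 0 1) y \<partial>lebesgue)"
    by (rule nn_integral_restrict_space) simp
  also have "\<dots> = (\<integral>\<^sup>+ y. f y * indicator (ball 0 1) y \<partial>lebesgue)"
    by (intro nn_integral_cong) (auto simp: indicator_def)
  also have "\<dots> = (\<integral>\<^sup>+ y. f y * indicator (ball 0 1) y \<partial>lborel)" by (rule nn_integral_completion)
  finally show ?thesis
    using V by (simp add: divide_ennreal_def inverse_ennreal mult.commute inverse_eq_divide)
qed

lemma measure_outer_shell_le:
  assumes h: "0 \<le> h" "h \<le> 1"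
  shows "measure lborel (ball (0::'a::euclidean_space) 1 - ball 0 (1 - h)) \<le> 
    unit_ball_vol (real DIM('a)) * (real DIM('a) * h)"
proof -
  have "measure lborel (ball (0::'a) 1 - ball 0 (1 - h)) = 
     measure lborel (ball (0::'a) 1) - measure lborel (ball (0::'a) (1 - h))"
    using h by (intro measure_Diff) (auto simp: emeasure_lborel_ball_eq_measure)
  also have "\<dots> = unit_ball_vol (real DIM('a)) * (1 - (1 - h) ^ DIM('a))"
    using h by (simp add: content_ball algebra_simps)
  also have "\<dots> \<le> unit_ball_vol (real DIM('a)) * (real DIM('a) * h)"
    using Bernoulli_inequality[of "- h" "DIM('a)"] h by (intro mult_left_mono) auto
  finally show ?thesis .
qed

text \<open>The shell where \<open>1 - |y| \<le> 2\<^sup>-\<^sup>j\<close> has measure of order \<open>2\<^sup>-\<^sup>j\<close>, so the integral is dominated by a geometric series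
  with ratio \<open>2\<close> to the power \<open>-(1 + \<alpha>)\<close>.\<close>
lemma nn_integral_weight_finite:
  fixes \<alpha> :: real
  assumes "\<alpha> > -1"
  shows "(\<integral>\<^sup>+ y. ennreal ((1 - (norm y)\<^sup>2) powr \<alpha>) * indicator (ball (0::'a::euclidean_space) 1) y \<partial>lborel) < \<infinity>"
proof -
  define E where "E j = ball (0::'a) 1 - ball 0 (1 - (1/2) ^ j)" for j :: nat
  define c where "c j = 4 powr \<bar>\<alpha>\<bar> * ((1/2) ^ j) powr \<alpha>" for j :: nat
  have c0: "c j \<ge> 0" for j by (simp add: c_def)
  have fin: "emeasure lborel (E j) < \<infinity>" for j
    by (rule emeasure_bounded_finite) (auto simp: E_def intro: bounded_subset[OF bounded_ball])
  have Em: "E j \<in> sets lborel" for j by (simp add: E_def)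
  have "(\<integral>\<^sup>+ y. ennreal ((1 - (norm y)\<^sup>2) powr \<alpha>) * indicator (ball (0::'a) 1) y \<partial>lborel) \<le> 
     (\<integral>\<^sup>+ y. (\<Sum>j. ennreal (c j) * indicator (E j) y) \<partial>lborel)"
  proof (rule nn_integral_mono)
    fix y :: 'a
    show "ennreal ((1 - (norm y)\<^sup>2) powr \<alpha>) * indicator (ball (0::'a) 1) y \<le> (\<Sum>j. ennreal (c j) * indicator (E j) y)"
    proof (cases "y \<in> ball 0 1")
      case True
      then have y: "norm y < 1" by simp
      obtain j where j: "1 - (1/2) ^ j \<le> norm y" "norm y < 1 - (1/2) ^ Suc j"
        using dyadic_index[OF norm_ge_zero y] by blast
      have h: "0 < (1/2 :: real) ^ j" by simp
      have "y \<in> dyadic_shell j"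
        unfolding dyadic_shell_def using j h by simp
      from dyadic_shell_weight[OF this, of "- \<alpha>"]
      have w: "((1/2) ^ j) powr (- \<alpha>) \<le> 4 powr \<bar>\<alpha>\<bar> * (1 - (norm y)\<^sup>2) powr (- \<alpha>)" by simp
      define e where "e = 1 - (norm y)\<^sup>2"
      have e: "e > 0" using one_minus_norm_square_pos[OF True] by (simp add: e_def)
      have "e powr \<alpha> * ((1/2) ^ j) powr \<alpha> * ((1/2) ^ j) powr (- \<alpha>) \<le> e powr \<alpha> * ((1/2) ^ j) powr \<alpha> * (4 powr \<bar>\<alpha>\<bar> * e powr (- \<alpha>))"
        using w by (intro mult_left_mono) (auto simp: e_def)
      moreover have "((1/2 :: real) ^ j) powr \<alpha> * ((1/2) ^ j) powr (- \<alpha>) = 1" "e powr \<alpha> * e powr (- \<alpha>) = 1"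
        using e by (simp_all add: powr_add[symmetric])
      ultimately have "e powr \<alpha> \<le> c j" unfolding c_def by (simp add: mult_ac) (metis mult.left_commute mult.right_neutral)
      then have "ennreal (e powr \<alpha>) * indicator (ball (0::'a) 1) y \<le> ennreal (c j) * indicator (E j) y"
        using True j by (simp add: E_def ennreal_leI)
      also have "\<dots> \<le> (\<Sum>j. ennreal (c j) * indicator (E j) y)"
      proof -
        define F where "F j = ennreal (c j) * indicator (E j) y" for j
        have "F j \<le> (\<Sum>j. F j)" using sum_le_suminf[of F "{j}"] by simp
        then show ?thesis by (simp only: F_def)
      qed
      finally show ?thesis by (simp add: e_def)
    qed simp
  qed
  also have "\<dots> = (\<Sum>j. \<integral>\<^sup>+ y. ennreal (c j) * indicator (E j) y \<partial>lborel)"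
    by (rule nn_integral_suminf) (use Em in auto)
  also have "\<dots> = (\<Sum>j. ennreal (c j) * emeasure lborel (E j))"
    using Em by (simp add: nn_integral_cmult_indicator)
  also have "\<dots> \<le> (\<Sum>j. ennreal ((4 powr \<bar>\<alpha>\<bar> * unit_ball_vol (real DIM('a)) * real DIM('a)) * ((1/2) powr (1 + \<alpha>)) ^ j))"
  proof (intro suminf_le summableI)
    fix j
    define h where "h = (1/2 :: real) ^ j"
    have h: "0 < h" "h \<le> 1" by (auto simp: h_def power_le_one)
    have "ennreal (c j) * emeasure lborel (E j) = ennreal (c j * measure lborel (E j))"
      using fin[of j] c0[of j] by (simp add: emeasure_eq_ennreal_measure ennreal_mult less_top)
    also have "\<dots> \<le> ennreal (c j * (unit_ball_vol (real DIM('a)) * (real DIM('a) * h)))"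
      unfolding E_def h_def[symmetric] using h c0
      by (intro ennreal_leI mult_left_mono measure_outer_shell_le) auto
    also have "c j * (unit_ball_vol (real DIM('a)) * (real DIM('a) * h)) = 
      (4 powr \<bar>\<alpha>\<bar> * unit_ball_vol (real DIM('a)) * real DIM('a)) * (h powr 1 * h powr \<alpha>)"
      using h by (simp add: c_def h_def[symmetric])
    also have "h powr 1 * h powr \<alpha> = ((1/2) powr (1 + \<alpha>)) ^ j"
    proof -
      have "h = (1/2) powr real j" by (simp add: h_def powr_realpow)
      then have "h powr 1 * h powr \<alpha> = (1/2) powr (real j * (1 + \<alpha>))"
        by (simp only: powr_add[symmetric] powr_powr distrib_left)
      also have "\<dots> = ((1/2) powr (1 + \<alpha>)) ^ j"
        by (simp add: powr_realpow[symmetric] powr_powr mult.commute)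
      finally show ?thesis .
    qed
    finally show "ennreal (c j) * emeasure lborel (E j) \<le> 
      ennreal ((4 powr \<bar>\<alpha>\<bar> * unit_ball_vol (real DIM('a)) * real DIM('a)) * ((1/2) powr (1 + \<alpha>)) ^ j)" .
  qed
  also have "\<dots> < \<infinity>"
  proof -
    have "(1/2::real) powr (1 + \<alpha>) < 1" using powr_less_mono2[of "1 + \<alpha>" "1/2" 1] assms by simp
    then have "summable (\<lambda>j. (4 powr \<bar>\<alpha>\<bar> * unit_ball_vol (real DIM('a)) * real DIM('a)) * ((1/2) powr (1 + \<alpha>)) ^ j)"
      by (intro summable_mult summable_geometric) simp
    then show ?thesis by (subst suminf_ennreal2) auto
  qed
  finally show ?thesis .
qed

text \<open>The Bochner integral that defines the constant would be zero if the weight were not integrable, so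
  positivity rests on the finiteness of the integral.\<close>
lemma weight_const_pos: "weight_const TYPE('a::euclidean_space) \<alpha> > 0"
proof (cases "\<alpha> > -1")
  case True
  define f where "f y = (1 - (norm y)\<^sup>2) powr \<alpha>" for y :: 'a
  have B: "ball (0::'a) 1 \<in> sets lebesgue" by simp
  have fm: "f \<in> borel_measurable (lebesgue_on (ball 0 1))"
    unfolding f_def[abs_def] by (rule continuous_imp_measurable_on_sets_lebesgue[OF continuous_on_weight B])
  have sets: "sets (ball_measure :: 'a measure) = sets (lebesgue_on (ball 0 1))" by (simp add: ball_measure_def)
  have fm': "f \<in> borel_measurable ball_measure" using fm by (simp add: measurable_cong_sets[OF sets refl])
  have "(\<integral>\<^sup>+ y. ennreal (f y) \<partial>ball_measure) = 
    ennreal (1 / measure lborel (ball (0::'a) 1)) * (\<integral>\<^sup>+ y. ennreal (f y) * indicator (ball 0 1) y \<partial>lborel)"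
    by (rule nn_integral_ball_measure) (use fm in simp)
  also have "\<dots> < \<infinity>" using nn_integral_weight_finite[OF True, where 'a='a] by (simp add: f_def ennreal_mult_less_top)
  finally have fin: "(\<integral>\<^sup>+ y. ennreal (f y) \<partial>ball_measure) < \<infinity>" .
  have int: "integrable ball_measure f"
    by (rule integrableI_nonneg[OF fm' _ fin]) (simp add: f_def)
  have "(LINT y|ball_measure. f y) \<noteq> 0"
  proof
    assume "(LINT y|ball_measure. f y) = 0"
    then have "AE y in ball_measure. f y = 0"
      by (subst (asm) integral_nonneg_eq_0_iff_AE[OF int]) (auto simp: f_def)
    moreover have "AE y in (ball_measure :: 'a measure). y \<in> ball 0 1"
      by (rule AE_I2) (simp add: ball_measure_def space_restrict_space)
    ultimately have "AE y in (ball_measure :: 'a measure). False"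
    proof eventually_elim
      case (elim y)
      then show False using one_minus_norm_square_pos[of y] by (simp add: f_def)
    qed
    then have "emeasure (ball_measure :: 'a measure) (space ball_measure) = 0"
      using AE_iff_null[of "ball_measure :: 'a measure" "\<lambda>_. False"] by (simp add: null_sets_def)
    moreover have "emeasure (ball_measure :: 'a measure) (space ball_measure) = 1"
    proof -
      define V where "V = measure lborel (ball (0::'a) 1)"
      have V: "V > 0" using content_ball_pos[of 1 "0::'a"] by (simp add: V_def)
      have "emeasure (ball_measure :: 'a measure) (space ball_measure) = (\<integral>\<^sup>+ y. 1 \<partial>(ball_measure :: 'a measure))"
        by simp
      also have "\<dots> = ennreal (1 / V) * (\<integral>\<^sup>+ y. 1 * indicator (ball (0::'a) 1) y \<partial>lborel)"
        unfolding V_def by (rule nn_integral_ball_measure) simp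
      also have "\<dots> = ennreal (1 / V) * ennreal V"
        by (simp add: V_def emeasure_lborel_ball_eq_measure)
      also have "\<dots> = 1" using V by (simp add: ennreal_mult[symmetric])
      finally show ?thesis .
    qed
    ultimately show False by simp
  qed
  moreover have "(LINT y|ball_measure. f y) \<ge> 0"
    by (rule Bochner_Integration.integral_nonneg) (simp add: f_def)
  ultimately have "0 < (LINT y|ball_measure. f y)" by linarith
  then show ?thesis using True by (simp add: weight_const_def f_def)
qed (simp add: weight_const_def)

lemma nn_integral_weighted_ball_measure:
  fixes g :: "'a::euclidean_space \<Rightarrow> real"
  assumes g: "continuous_on (ball 0 1) g" "\<And>y. 0 \<le> g y"
  shows "(\<integral>\<^sup>+ y. ennreal (g y) \<partial>weighted_ball_measure \<alpha>) = 
    ennreal (1 / (weight_const TYPE('a) \<alpha> * measure lborel (ball (0::'a) 1))) * 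
    (\<integral>\<^sup>+ y. ennreal (indicator (ball 0 1) y * ((1 - (norm y)\<^sup>2) powr \<alpha> * g y)) \<partial>lborel)"
proof -
  define W where "W = weight_const TYPE('a) \<alpha>"
  define V where "V = measure lborel (ball (0::'a) 1)"
  have W: "W > 0" unfolding W_def by (rule weight_const_pos)
  have V: "V > 0" unfolding V_def using content_ball_pos[of 1 "0::'a"] by simp
  let ?w = "\<lambda>y::'a. (1 - (norm y)\<^sup>2) powr \<alpha>"
  have B: "ball (0::'a) 1 \<in> sets lebesgue" by simp
  have sets: "sets (ball_measure :: 'a measure) = sets (lebesgue_on (ball 0 1))" by (simp add: ball_measure_def)
  have wm: "?w \<in> borel_measurable (lebesgue_on (ball 0 1))"
    by (rule continuous_imp_measurable_on_sets_lebesgue[OF continuous_on_weight B])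
  have gm: "g \<in> borel_measurable (lebesgue_on (ball 0 1))"
    by (rule continuous_imp_measurable_on_sets_lebesgue[OF g(1) B])
  have dm: "(\<lambda>y. ennreal (1 / W * ?w y)) \<in> borel_measurable (lebesgue_on (ball 0 1))" using wm by measurable
  have gm': "(\<lambda>y. ennreal (g y)) \<in> borel_measurable (lebesgue_on (ball 0 1))" using gm by measurable
  have "(\<integral>\<^sup>+ y. ennreal (g y) \<partial>weighted_ball_measure \<alpha>) = 
     (\<integral>\<^sup>+ y. ennreal (1 / W * ?w y) * ennreal (g y) \<partial>ball_measure)"
    unfolding weighted_ball_measure_def W_def[symmetric]
    by (rule nn_integral_density) (use dm gm' in \<open>simp_all add: measurable_cong_sets[OF sets refl]\<close>)
  also have "\<dots> = ennreal (1 / V) * (\<integral>\<^sup>+ y. ennreal (1 / W * ?w y) * ennreal (g y) * indicator (ball 0 1) y \<partial>lborel)"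
    unfolding V_def by (rule nn_integral_ball_measure) (use dm gm' in measurable)
  also have "(\<integral>\<^sup>+ y. ennreal (1 / W * ?w y) * ennreal (g y) * indicator (ball 0 1) y \<partial>lborel) = 
     (\<integral>\<^sup>+ y. ennreal (1 / W) * ennreal (indicator (ball 0 1) y * (?w y * g y)) \<partial>lborel)"
    by (intro nn_integral_cong) 
      (use W g(2) in \<open>auto simp: indicator_def ennreal_mult[symmetric] mult_ac\<close>)
  also have "\<dots> = ennreal (1 / W) * (\<integral>\<^sup>+ y. ennreal (indicator (ball 0 1) y * (?w y * g y)) \<partial>lborel)"
  proof (rule nn_integral_cmult)
    have "(\<lambda>y. indicator (ball 0 1) y *\<^sub>R (?w y * g y)) \<in> borel_measurable borel"
      by (rule borel_measurable_continuous_on_indicator) (auto intro!: continuous_on_mult continuous_on_weight g)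
    then show "(\<lambda>y. ennreal (indicator (ball 0 1) y * (?w y * g y))) \<in> borel_measurable lborel" by simp
  qed
  finally show ?thesis unfolding W_def[symmetric] V_def[symmetric]
    using W V by (simp add: mult.assoc[symmetric] ennreal_mult[symmetric] mult.commute)
qed

theorem theorem5p1:
  fixes p \<alpha> s t :: real
  assumes "DIM('a::euclidean_space) \<ge> 2"
    and "0 < p" and "p < 1"
    and "\<alpha> + p * t > -1"
  shows "\<exists>C::real. C > 0 \<and>
    (\<forall>u \<in> (harmonic_besov p \<alpha> :: ('a \<Rightarrow> complex) set). \<forall>x \<in> ball 0 1.
       ennreal (norm (u x)) \<le>
         ennreal C * besov_quasinorm p \<alpha> s t u *
         ennreal (if \<alpha> \<le> - real DIM('a) then 1
                  else 1 / (1 - (norm x)\<^sup>2) powr ((real DIM('a) + \<alpha>) / p)))"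
proof -
  \<comment> \<open>the normalization of the measure, which is removed from the quasinorm at the end\<close>
  define \<kappa> where "\<kappa> = weight_const TYPE('a) \<alpha> * measure lborel (ball (0::'a) 1)"
  have \<kappa>: "\<kappa> > 0" unfolding \<kappa>_def
    using weight_const_pos[where 'a='a, of \<alpha>] content_ball_pos[of 1 "0::'a"] by simp
  obtain C where C: "C > 0" and est: "\<And>(u :: 'a \<Rightarrow> complex) S x. harmonic_on (ball 0 1) u \<Longrightarrow> 0 \<le> S \<Longrightarrow>
     (\<integral>\<^sup>+ y. ennreal (indicator (ball 0 1) y * ((1 - (norm y)\<^sup>2) powr (\<alpha> + p * t) * norm (D_op s t u y) powr p)) \<partial>lborel) \<le> ennreal S \<Longrightarrow>
     norm x < 1 \<Longrightarrow> norm (u x) \<le> C * S powr (1 / p) * growth_factor DIM('a) \<alpha> p (norm x)"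
    using pointwise_estimate[where 'a='a, of p \<alpha> t s] assms by auto
  define C' where "C' = C * \<kappa> powr (1 / p)"
  have C': "C' > 0" using C \<kappa> by (simp add: C'_def)
  show ?thesis
  proof (intro exI[of _ C'] conjI ballI C')
    fix u :: "'a \<Rightarrow> complex" and x :: 'a
    assume "u \<in> harmonic_besov p \<alpha>" and "x \<in> ball 0 1"
    then have u: "harmonic_on (ball 0 1) u" and x: "norm x < 1" by (auto simp: harmonic_besov_def)
    define \<Phi> where "\<Phi> = growth_factor DIM('a) \<alpha> p (norm x)"
    have \<Phi>: "\<Phi> > 0" unfolding \<Phi>_def using growth_factor_pos[OF norm_ge_zero x] .
    define J where "J = (\<integral>\<^sup>+ y. ennreal (norm (I_op s t u y) powr p) \<partial>weighted_ball_measure \<alpha>)"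
    define S' where "S' = (\<integral>\<^sup>+ y. ennreal (indicator (ball 0 1) y * ((1 - (norm y)\<^sup>2) powr (\<alpha> + p * t) * norm (D_op s t u y) powr p)) \<partial>lborel)"
    have I: "norm (I_op s t u y) powr p = (1 - (norm y)\<^sup>2) powr (p * t) * norm (D_op s t u y) powr p" for y
      using assms(2) by (simp add: I_op_def norm_mult powr_mult powr_powr mult.commute)
    have "continuous_on (ball 0 1) (\<lambda>y. norm (I_op s t u y) powr p)"
      unfolding I by (intro continuous_on_mult continuous_on_weight continuous_on_norm_powr continuous_on_D_op u assms)
    then have "J = ennreal (1 / \<kappa>) * (\<integral>\<^sup>+ y. ennreal (indicator (ball 0 1) y * ((1 - (norm y)\<^sup>2) powr \<alpha> * norm (I_op s t u y) powr p)) \<partial>lborel)"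
      unfolding J_def \<kappa>_def by (rule nn_integral_weighted_ball_measure) simp
    also have "(\<integral>\<^sup>+ y. ennreal (indicator (ball 0 1) y * ((1 - (norm y)\<^sup>2) powr \<alpha> * norm (I_op s t u y) powr p)) \<partial>lborel) = S'"
      unfolding S'_def I by (intro nn_integral_cong) (simp add: powr_add mult.assoc)
    finally have JS: "J = ennreal (1 / \<kappa>) * S'" .
    have "ennreal (norm (u x)) \<le> ennreal C' * besov_quasinorm p \<alpha> s t u * ennreal \<Phi>"
    proof (cases "J = \<infinity>")
      case True
      then have "besov_quasinorm p \<alpha> s t u = \<infinity>"
        by (simp add: besov_quasinorm_def Lp_quasinorm_def J_def)
      then show ?thesis using C' \<Phi> by (simp add: ennreal_mult_top ennreal_top_mult)
    next
      case False
      define j where "j = enn2real J"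
      have j: "J = ennreal j" "j \<ge> 0" using False by (auto simp: j_def less_top)
      have q: "besov_quasinorm p \<alpha> s t u = ennreal (j powr (1 / p))"
        using False by (simp add: besov_quasinorm_def Lp_quasinorm_def J_def[symmetric] j_def)
      have "S' = ennreal \<kappa> * (ennreal (1 / \<kappa>) * S')"
        using \<kappa> by (simp add: mult.assoc[symmetric] ennreal_mult[symmetric])
      also have "\<dots> = ennreal (\<kappa> * j)" using JS j \<kappa> by (simp add: ennreal_mult)
      finally have "S' = ennreal (\<kappa> * j)" .
      then have "norm (u x) \<le> C * (\<kappa> * j) powr (1 / p) * \<Phi>"
        unfolding \<Phi>_def using j \<kappa> x by (intro est[OF u]) (auto simp: S'_def)
      also have "\<dots> = C' * j powr (1 / p) * \<Phi>" using \<kappa> j by (simp add: C'_def powr_mult)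
      finally have "ennreal (norm (u x)) \<le> ennreal (C' * j powr (1 / p) * \<Phi>)" by (rule ennreal_leI)
      then show ?thesis using C' \<Phi> by (simp add: q ennreal_mult)
    qed
    then show "ennreal (norm (u x)) \<le> ennreal C' * besov_quasinorm p \<alpha> s t u *
         ennreal (if \<alpha> \<le> - real DIM('a) then 1 else 1 / (1 - (norm x)\<^sup>2) powr ((real DIM('a) + \<alpha>) / p))"
      unfolding \<Phi>_def growth_factor_def .
  qed
qed

end
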